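(* Let $\mathcal{P}$ be one of the problems 2S-Sup, 2S-MatSup, 2S-MuSup. Suppose there is an efficiently generalizable $\eta$-approximation algorithm for $\mathcal{P}$-Poly, and let $\mathcal{S}$ be the set of all potential black-box strategies its extension procedure may produce. Then for any $\gamma,\epsilon,\alpha\in(0,1)$ there is an algorithm for $\mathcal{P}$-BB which, using $O\big(\frac{1}{\epsilon\alpha}\log\big(\frac{nm|\mathcal{S}|}{\gamma}\big)\log\big(\frac{nm}{\gamma}\big)\big)$ samples from $\mathcal{D}$, computes a black-box solution $F_I$ and $F_A$ for all $A\in\mathcal{D}$ such that, with probability at least $1-\gamma$, one of the following holds: (1) $\sum_{i\in F_I}c^I_i+\mathbb{E}_{A\sim\mathcal{D}}\big[\sum_{i\in F_A}c^A_i\big]\le(1+\epsilon)B$ and $\Pr_{A\sim\mathcal{D}}\big[d(j,F_I\cup F_A)\le\eta R_j \text{ for all } j\in A\big]\ge 1-\alpha$; (2) the algorithm returns INFEASIBLE and the given instance is infeasible.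
   Context: Setting: a set of clients $\mathcal{C}$ ($n=|\mathcal{C}|$) and facilities $\mathcal{F}$ ($m=|\mathcal{F}|$) in a metric space with distance $d$; $d(j,S)=\min_{i\in S}d(i,j)$. Each facility $i$ has stage-I cost $c^I_i\ge 0$. A distribution $\mathcal{D}$ over scenarios; a scenario $A$ is a set of clients $A\subseteq\mathcal{C}$ together with stage-II costs $c^A_i\ge0$; "$A\in\mathcal{D}$" means $A$ is in the support of $\mathcal{D}$. Each client $j$ has a radius demand $R_j\ge 0$, and $d(j,\mathcal{F})\le R_j$ for all $j$. There is a budget $B$ and a family $\mathcal{M}_I\subseteq 2^{\mathcal{F}}$ of allowed stage-I sets: in 2S-Sup $\mathcal{M}_I=2^{\mathcal{F}}$; in 2S-MatSup $\mathcal{M}_I$ is the family of independent sets of a given matroid; in 2S-MuSup $\mathcal{M}_I=\{F_I:\sum_{i\in F_I}f^\ell_i\le W_\ell\ \forall \ell\in[L]\}$ for given nonnegative integer weights $f^\ell_i$ and budgets $W_\ell\ge0$, with $\Lambda=\prod_\ell W_\ell$. A strategy $s$ consists of a stage-I set $F^s_I\in\mathcal{M}_I$ and a stage-II set $F^s_A\subseteq\mathcal{F}$ for every $A\in\mathcal{D}$; $C^I(s)=\sum_{i\in F^s_I}c^I_i$, $C^{II}(s,A)=\sum_{i\in F^s_A}c^A_i$, $C(s,A)=C^I(s)+C^{II}(s,A)$, $\mathrm{maxdist}(s,A)=\max_{j\in A}d(j,F^s_I\cup F^s_A)/R_j$. The instance is feasible if some strategy $s^*$ has $\mathbb{E}_{A\sim\mathcal{D}}[C(s^*,A)]\le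 B$ and $\mathrm{maxdist}(s^*,A)\le1$ for all $A\in\mathcal{D}$. In $\mathcal{P}$-Poly (polynomial-scenarios model) $\mathcal{D}$ is given as an explicit list of $N$ scenarios with probabilities; in $\mathcal{P}$-BB (black-box model) one only has an oracle that samples $A\sim\mathcal{D}$. It is assumed (without loss of generality, via a dummy facility with infinitesimal continuous random stage-II cost always opened) that $C(s,A)$, $A\sim\mathcal{D}$, has a continuous CDF for every strategy considered. An $\eta$-approximation algorithm for $\mathcal{P}$-Poly runs in time polynomial in its input size (in particular in $N$) and on every instance either returns a strategy $s$ with $\mathbb{E}_{A}[C(s,A)]\le B$ and $\max_A\mathrm{maxdist}(s,A)\le\eta$, or returns INFEASIBLE, the latter only if the instance is infeasible. It is efficiently generalizable if, for every explicit instance whose distribution $\mathcal{D}'$ has support contained in that of $\mathcal{D}$ (with the same $\mathcal{C},\mathcal{F},\mathcal{M}_I,B,R$), there is an efficient procedure extending its output strategy $s$ to a strategy $\bar s$ on $\mathcal{D}$ such that: $\max_{A\in\mathcal{D}}\mathrm{maxdist}(\bar s,A)\le\eta$; $\bar s$ agrees with $s$ on the stage-I set and on $F_A$ for every $A$ in the support of $\mathcal{D}'$; and the set $\mathcal{S}$ of all strategies $\bar s$ obtainable this way (over all such $\mathcal{D}'$) has $|\mathcal{S}|\le\psi$ for a fixed known $\psi$. *)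

theory Defs
  imports "HOL-Probability.Probability"
begin

section \<open>A model of computation: while-programs over real-valued list structures\<close>

text \<open>
  Algorithms are finite programs of a real-RAM language with unit-cost real arithmetic and
  comparison. Its data are binary trees with real numbers at the leaves.
\<close>

datatype val = VNil | VNum real | VPair val val

fun vlist :: "val list \<Rightarrow> val" where
  "vlist [] = VNil"
| "vlist (v # vs) = VPair v (vlist vs)"

text \<open>
  Input sizes are bit lengths, defined for data whose numbers are all rational. (With irrational
  numbers, as in samples of continuous costs, running times are only required to be finite.)
\<close>

fun rational_val :: "val \<Rightarrow> bool" where
  "rational_val VNil \<longleftrightarrow> True"
| "rational_val (VNum x) \<longleftrightarrow> x \<in> \<rat>"
| "rational_val (VPair u v) \<longleftrightarrow> rational_val u \<and> rational_val v"

definition num_bits :: "real \<Rightarrow> nat" where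
  "num_bits x = (LEAST b. \<exists>p q :: int. \<bar>p\<bar> < 2 ^ b \<and> 0 < q \<and> q < 2 ^ b \<and> x = of_int p / of_int q)"

fun vsize :: "val \<Rightarrow> nat" where
  "vsize VNil = 1"
| "vsize (VNum x) = Suc (num_bits x)"
| "vsize (VPair u v) = Suc (vsize u + vsize v)"

definition vbool :: "bool \<Rightarrow> val" where
  "vbool b = VNum (if b then 1 else 0)"

datatype prim = Fst | Snd | IsNum | IsPair | Add | Sub | Mul | Divide | LessThan

text \<open>Primitives applied to data of the wrong shape return \<open>VNil\<close>.\<close>

fun apply_prim :: "prim \<Rightarrow> val \<Rightarrow> val" where
  "apply_prim Fst (VPair u v) = u"
| "apply_prim Snd (VPair u v) = v"
| "apply_prim IsNum (VNum x) = vbool True"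
| "apply_prim IsNum _ = vbool False"
| "apply_prim IsPair (VPair u v) = vbool True"
| "apply_prim IsPair _ = vbool False"
| "apply_prim Add (VPair (VNum x) (VNum y)) = VNum (x + y)"
| "apply_prim Sub (VPair (VNum x) (VNum y)) = VNum (x - y)"
| "apply_prim Mul (VPair (VNum x) (VNum y)) = VNum (x * y)"
| "apply_prim Divide (VPair (VNum x) (VNum y)) = VNum (x / y)"
| "apply_prim LessThan (VPair (VNum x) (VNum y)) = vbool (x < y)"
| "apply_prim _ _ = VNil"

text \<open>
  A program transforms one value. \<open>Both p q\<close> pairs the results of \<open>p\<close> and \<open>q\<close> on the same
  input, \<open>Cond\<close> and \<open>Loop\<close> test whether their first argument yields \<open>VNum 1\<close>, \<open>Ask\<close> sends
  an external query and \<open>Draw\<close> ignores its input and returns the next sample.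
\<close>

datatype prog =
    Skip
  | Lit val
  | Prim prim
  | Both prog prog
  | Then prog prog
  | Cond prog prog prog
  | Loop prog prog
  | Ask
  | Draw

text \<open>
  \<open>exec Q \<omega> p v k v' k' t\<close>: with query answers \<open>Q\<close> and sample sequence \<open>\<omega>\<close>, program \<open>p\<close> started on \<open>v\<close>
  when \<open>k\<close> samples have been drawn terminates with result \<open>v'\<close> after \<open>t\<close> steps, and then
  \<open>k'\<close> samples have been drawn.
\<close>

inductive exec ::
  "(val \<Rightarrow> val) \<Rightarrow> (nat \<Rightarrow> val) \<Rightarrow> prog \<Rightarrow> val \<Rightarrow> nat \<Rightarrow> val \<Rightarrow> nat \<Rightarrow> nat \<Rightarrow> bool"
  for Q :: "val \<Rightarrow> val" and \<omega> :: "nat \<Rightarrow> val" where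
  exec_Skip: "exec Q \<omega> Skip v k v k 1"
| exec_Lit: "exec Q \<omega> (Lit c) v k c k 1"
| exec_Prim: "exec Q \<omega> (Prim f) v k (apply_prim f v) k 1"
| exec_Both: "exec Q \<omega> p v k u k' t \<Longrightarrow> exec Q \<omega> q v k' w k'' t' \<Longrightarrow>
    exec Q \<omega> (Both p q) v k (VPair u w) k'' (t + t' + 1)"
| exec_Then: "exec Q \<omega> p v k u k' t \<Longrightarrow> exec Q \<omega> q u k' w k'' t' \<Longrightarrow>
    exec Q \<omega> (Then p q) v k w k'' (t + t' + 1)"
| exec_Cond_True: "exec Q \<omega> b v k (VNum 1) k' t \<Longrightarrow> exec Q \<omega> p v k' w k'' t' \<Longrightarrow>
    exec Q \<omega> (Cond b p q) v k w k'' (t + t' + 1)"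
| exec_Cond_False: "exec Q \<omega> b v k u k' t \<Longrightarrow> u \<noteq> VNum 1 \<Longrightarrow> exec Q \<omega> q v k' w k'' t' \<Longrightarrow>
    exec Q \<omega> (Cond b p q) v k w k'' (t + t' + 1)"
| exec_Loop_True: "exec Q \<omega> b v k (VNum 1) k1 t1 \<Longrightarrow> exec Q \<omega> p v k1 u k2 t2 \<Longrightarrow>
    exec Q \<omega> (Loop b p) u k2 w k3 t3 \<Longrightarrow> exec Q \<omega> (Loop b p) v k w k3 (t1 + t2 + t3 + 1)"
| exec_Loop_False: "exec Q \<omega> b v k u k' t \<Longrightarrow> u \<noteq> VNum 1 \<Longrightarrow>
    exec Q \<omega> (Loop b p) v k v k' (t + 1)"
| exec_Ask: "exec Q \<omega> Ask v k (Q v) k 1"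
| exec_Draw: "exec Q \<omega> Draw v k (\<omega> k) (Suc k) 1"

primrec sample_free :: "prog \<Rightarrow> bool" where
  "sample_free Skip \<longleftrightarrow> True"
| "sample_free (Lit c) \<longleftrightarrow> True"
| "sample_free (Prim f) \<longleftrightarrow> True"
| "sample_free (Both p q) \<longleftrightarrow> sample_free p \<and> sample_free q"
| "sample_free (Then p q) \<longleftrightarrow> sample_free p \<and> sample_free q"
| "sample_free (Cond b p q) \<longleftrightarrow> sample_free b \<and> sample_free p \<and> sample_free q"
| "sample_free (Loop b p) \<longleftrightarrow> sample_free b \<and> sample_free p"
| "sample_free Ask \<longleftrightarrow> True"
| "sample_free Draw \<longleftrightarrow> False"

text \<open>Execution of a sample-free program; the sample sequence is a dummy.\<close>

definition run :: "(val \<Rightarrow> val) \<Rightarrow> prog \<Rightarrow> val \<Rightarrow> val \<Rightarrow> nat \<Rightarrow> bool" where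
  "run Q p v w t \<longleftrightarrow> exec Q (\<lambda>_. VNil) p v 0 w 0 t"


section \<open>Two-stage supplier instances\<close>

text \<open>
  Clients and facilities are points, named by natural numbers, of one finite metric space.
  In \<open>MultiKnapsack\<close> each list entry is a pair of weights \<open>f\<close> and a budget \<open>W\<close>.
\<close>

datatype constraint =
    Unconstrained
  | Matroid "nat set set"
  | MultiKnapsack "((nat \<Rightarrow> nat) \<times> nat) list"

datatype problem = TwoS_Sup | TwoS_MatSup | TwoS_MuSup

record inst =
  clients :: "nat set"
  facilities :: "nat set"
  dst :: "nat \<Rightarrow> nat \<Rightarrow> real"
  cost1 :: "nat \<Rightarrow> real"
  radius :: "nat \<Rightarrow> real"
  constr :: constraint
  budget :: real

definition matroid_on :: "nat set \<Rightarrow> nat set set \<Rightarrow> bool" where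
  "matroid_on E \<I> \<longleftrightarrow> \<I> \<subseteq> Pow E \<and> {} \<in> \<I> \<and>
     (\<forall>X\<in>\<I>. \<forall>Y\<subseteq>X. Y \<in> \<I>) \<and>
     (\<forall>X\<in>\<I>. \<forall>Y\<in>\<I>. card X < card Y \<longrightarrow> (\<exists>e\<in>Y - X. insert e X \<in> \<I>))"

fun allowed_by :: "constraint \<Rightarrow> nat set \<Rightarrow> nat set set" where
  "allowed_by Unconstrained F = Pow F"
| "allowed_by (Matroid \<I>) F = \<I>"
| "allowed_by (MultiKnapsack ks) F = {X. X \<subseteq> F \<and> (\<forall>(f, W)\<in>set ks. (\<Sum>i\<in>X. f i) \<le> W)}"

definition allowed :: "inst \<Rightarrow> nat set set" where
  "allowed I = allowed_by (constr I) (facilities I)"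

fun constraint_ok :: "problem \<Rightarrow> nat set \<Rightarrow> constraint \<Rightarrow> bool" where
  "constraint_ok TwoS_Sup F Unconstrained \<longleftrightarrow> True"
| "constraint_ok TwoS_MatSup F (Matroid \<I>) \<longleftrightarrow> matroid_on F \<I>"
| "constraint_ok TwoS_MuSup F (MultiKnapsack ks) \<longleftrightarrow> True"
| "constraint_ok _ _ _ \<longleftrightarrow> False"

text \<open>\<open>\<infinity>\<close> if \<open>S\<close> is empty.\<close>

definition dist_to :: "inst \<Rightarrow> nat \<Rightarrow> nat set \<Rightarrow> ereal" where
  "dist_to I j S = (INF i\<in>S. ereal (dst I i j))"

definition valid_inst :: "problem \<Rightarrow> inst \<Rightarrow> bool" where
  "valid_inst P I \<longleftrightarrow>
     finite (clients I) \<and> clients I \<noteq> {} \<and> finite (facilities I) \<and> facilities I \<noteq> {} \<and>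
     Metric_space (clients I \<union> facilities I) (dst I) \<and>
     (\<forall>i\<in>facilities I. 0 \<le> cost1 I i) \<and>
     (\<forall>j\<in>clients I. 0 \<le> radius I j \<and> dist_to I j (facilities I) \<le> ereal (radius I j)) \<and>
     constraint_ok P (facilities I) (constr I) \<and> 0 \<le> budget I"

text \<open>
  A scenario is a client set together with its stage-II costs; these are extensional functions
  on the facilities, so that equal data means equal scenarios. A strategy consists of the
  stage-I set and the map from scenarios to stage-II sets.
\<close>

type_synonym scenario = "nat set \<times> (nat \<Rightarrow> real)"
type_synonym strategy = "nat set \<times> (scenario \<Rightarrow> nat set)"

definition scenarios :: "inst \<Rightarrow> scenario set" where
  "scenarios I = Pow (clients I) \<times> (facilities I \<rightarrow>\<^sub>E {0..})"

definition stage1_cost :: "inst \<Rightarrow> strategy \<Rightarrow> real" where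
  "stage1_cost I s = (\<Sum>i\<in>fst s. cost1 I i)"

definition stage2_cost :: "strategy \<Rightarrow> scenario \<Rightarrow> real" where
  "stage2_cost s A = (\<Sum>i\<in>snd s A. snd A i)"

definition cost :: "inst \<Rightarrow> strategy \<Rightarrow> scenario \<Rightarrow> real" where
  "cost I s A = stage1_cost I s + stage2_cost s A"

text \<open>
  In \<open>ereal\<close>, \<open>0 / 0 = 0\<close> and \<open>x / 0 = \<infinity>\<close> for \<open>x > 0\<close>, so a client of radius \<open>0\<close> must be served
  at distance \<open>0\<close>. The supremum over the empty client set is \<open>-\<infinity>\<close>.
\<close>

definition maxdist :: "inst \<Rightarrow> strategy \<Rightarrow> scenario \<Rightarrow> ereal" where
  "maxdist I s A = (SUP j\<in>fst A. dist_to I j (fst s \<union> snd s A) / ereal (radius I j))"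

text \<open>
  In the following, \<open>D\<close> is the distribution and \<open>\<Omega>\<close> its support, given separately because
  \<open>\<Omega>\<close> is \<open>space D\<close> in the black-box model but the set of listed scenarios for a
  distribution given explicitly.
\<close>

definition is_strategy :: "inst \<Rightarrow> scenario measure \<Rightarrow> scenario set \<Rightarrow> strategy \<Rightarrow> bool" where
  "is_strategy I D \<Omega> s \<longleftrightarrow> fst s \<in> allowed I \<and> (\<forall>A\<in>\<Omega>. snd s A \<subseteq> facilities I) \<and>
     snd s \<in> measurable D (count_space UNIV)"

definition within_budget :: "inst \<Rightarrow> scenario measure \<Rightarrow> strategy \<Rightarrow> bool" where
  "within_budget I D s \<longleftrightarrow>
     integrable D (cost I s) \<and> (\<integral>A. cost I s A \<partial>D) \<le> budget I"

definition feasible :: "inst \<Rightarrow> scenario measure \<Rightarrow> scenario set \<Rightarrow> bool" where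
  "feasible I D \<Omega> \<longleftrightarrow>
     (\<exists>s. is_strategy I D \<Omega> s \<and> within_budget I D s \<and> (\<forall>A\<in>\<Omega>. maxdist I s A \<le> 1))"


section \<open>Encodings of instances as program data\<close>

definition enc_on :: "nat set \<Rightarrow> (nat \<Rightarrow> val) \<Rightarrow> val" where
  "enc_on X f = vlist (map f (sorted_list_of_set X))"

definition enc_subset :: "nat set \<Rightarrow> nat set \<Rightarrow> val" where
  "enc_subset X Y = enc_on X (\<lambda>x. vbool (x \<in> Y))"

text \<open>A matroid is not part of the input data: it is accessed by queries about independent sets (\<open>Ask\<close>).\<close>

fun enc_constraint :: "nat set \<Rightarrow> constraint \<Rightarrow> val" where
  "enc_constraint F Unconstrained = VNil"
| "enc_constraint F (Matroid \<I>) = VNil"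
| "enc_constraint F (MultiKnapsack ks) =
     vlist (map (\<lambda>(f, W). VPair (VNum (real W)) (enc_on F (\<lambda>i. VNum (real (f i))))) ks)"

definition enc_inst :: "inst \<Rightarrow> val" where
  "enc_inst I =
     (let pts = sorted_list_of_set (clients I) @ sorted_list_of_set (facilities I) in
      vlist [vlist (map (\<lambda>x. vlist (map (\<lambda>y. VNum (dst I x y)) pts)) pts),
             enc_on (clients I) (\<lambda>j. VNum (radius I j)),
             enc_on (facilities I) (\<lambda>i. VNum (cost1 I i)),
             enc_constraint (facilities I) (constr I),
             VNum (budget I)])"

definition enc_scenario :: "inst \<Rightarrow> scenario \<Rightarrow> val" where
  "enc_scenario I A =
     VPair (enc_subset (clients I) (fst A)) (enc_on (facilities I) (\<lambda>i. VNum (snd A i)))"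

definition enc_poly :: "inst \<Rightarrow> (scenario \<times> real) list \<Rightarrow> val" where
  "enc_poly I L =
     VPair (enc_inst I) (vlist (map (\<lambda>(A, p). VPair (VNum p) (enc_scenario I A)) L))"

text \<open>Membership queries for the family of allowed stage-I sets.\<close>

definition allowed_query :: "inst \<Rightarrow> val \<Rightarrow> val" where
  "allowed_query I v = vbool (\<exists>X\<in>allowed I. v = enc_subset (facilities I) X)"

abbreviation INFEASIBLE :: val where
  "INFEASIBLE \<equiv> VNil"

definition enc_strategy :: "inst \<Rightarrow> (scenario \<times> real) list \<Rightarrow> strategy \<Rightarrow> val" where
  "enc_strategy I L s =
     VPair (enc_subset (facilities I) (fst s))
           (vlist (map (\<lambda>(A, p). enc_subset (facilities I) (snd s A)) L))"

text \<open>
  The number \<open>\<Lambda>\<close> of the multi-knapsack problem is added to the input size, that is, running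
  times are pseudopolynomial in the knapsack budgets.
\<close>

fun pseudo_size :: "constraint \<Rightarrow> nat" where
  "pseudo_size (MultiKnapsack ks) = (\<Prod>(f, W)\<leftarrow>ks. W)"
| "pseudo_size _ = 0"

definition poly_time :: "nat \<Rightarrow> nat \<Rightarrow> inst \<Rightarrow> val \<Rightarrow> nat \<Rightarrow> bool" where
  "poly_time c e I v t \<longleftrightarrow>
     (rational_val v \<longrightarrow> t \<le> c * (vsize v + pseudo_size (constr I)) ^ e + c)"


section \<open>The polynomial-scenarios model\<close>

definition poly_list :: "inst \<Rightarrow> (scenario \<times> real) list \<Rightarrow> bool" where
  "poly_list I L \<longleftrightarrow> pmf_of_list_wf L \<and> (\<forall>p\<in>set (map snd L). 0 < p) \<and>
     distinct (map fst L) \<and> set (map fst L) \<subseteq> scenarios I"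

definition approximation_algorithm :: "problem \<Rightarrow> prog \<Rightarrow> real \<Rightarrow> bool" where
  "approximation_algorithm P alg \<eta> \<longleftrightarrow> sample_free alg \<and>
     (\<exists>c e. \<forall>I L. valid_inst P I \<longrightarrow> poly_list I L \<longrightarrow>
        (let D' = measure_pmf (pmf_of_list L); \<Omega>' = set (map fst L) in
         \<exists>out t. run (allowed_query I) alg (enc_poly I L) out t \<and>
           poly_time c e I (enc_poly I L) t \<and>
           ((out = INFEASIBLE \<and> \<not> feasible I D' \<Omega>') \<or>
            (\<exists>s. out = enc_strategy I L s \<and> is_strategy I D' \<Omega>' s \<and> within_budget I D' s \<and>
                 (\<forall>A\<in>\<Omega>'. maxdist I s A \<le> ereal \<eta>)))))"

definition returns :: "prog \<Rightarrow> inst \<Rightarrow> (scenario \<times> real) list \<Rightarrow> strategy \<Rightarrow> bool" where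
  "returns alg I L s \<longleftrightarrow> fst s \<subseteq> facilities I \<and>
     (\<forall>A\<in>set (map fst L). snd s A \<subseteq> facilities I) \<and>
     (\<exists>t. run (allowed_query I) alg (enc_poly I L) (enc_strategy I L s) t)"

text \<open>
  The extension procedure gets an explicit instance, the strategy \<open>s\<close> returned for it and one
  scenario of \<open>\<Omega>\<close>, and computes the stage-II set of the extended strategy for that scenario.
\<close>

definition enc_extension :: "inst \<Rightarrow> (scenario \<times> real) list \<Rightarrow> strategy \<Rightarrow> scenario \<Rightarrow> val" where
  "enc_extension I L s A = VPair (enc_poly I L) (VPair (enc_strategy I L s) (enc_scenario I A))"

definition extends_to ::
  "prog \<Rightarrow> inst \<Rightarrow> scenario set \<Rightarrow> (scenario \<times> real) list \<Rightarrow> strategy \<Rightarrow> strategy \<Rightarrow> bool" where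
  "extends_to ext I \<Omega> L s s' \<longleftrightarrow> fst s' = fst s \<and> snd s' \<in> extensional \<Omega> \<and>
     (\<forall>A\<in>\<Omega>. snd s' A \<subseteq> facilities I \<and>
        (\<exists>t. run (allowed_query I) ext (enc_extension I L s A) (enc_subset (facilities I) (snd s' A)) t))"

definition potential_strategies :: "prog \<Rightarrow> prog \<Rightarrow> inst \<Rightarrow> scenario set \<Rightarrow> strategy set" where
  "potential_strategies alg ext I \<Omega> =
     {s'. \<exists>L s. poly_list I L \<and> set (map fst L) \<subseteq> \<Omega> \<and> returns alg I L s \<and>
                extends_to ext I \<Omega> L s s'}"

text \<open>
  The bound \<open>\<psi>\<close> on the number of potential strategies may depend on the instance and on the
  support \<open>\<Omega>\<close>, but it is the same for all budgets.
\<close>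

definition efficiently_generalizable ::
  "problem \<Rightarrow> prog \<Rightarrow> prog \<Rightarrow> real \<Rightarrow> (inst \<Rightarrow> scenario set \<Rightarrow> nat) \<Rightarrow> bool" where
  "efficiently_generalizable P alg ext \<eta> \<psi> \<longleftrightarrow> sample_free ext \<and>
     (\<exists>c e. \<forall>I \<Omega> L s. valid_inst P I \<longrightarrow> \<Omega> \<subseteq> scenarios I \<longrightarrow>
        poly_list I L \<longrightarrow> set (map fst L) \<subseteq> \<Omega> \<longrightarrow> returns alg I L s \<longrightarrow>
        (\<exists>s'. extends_to ext I \<Omega> L s s' \<and>
              (\<forall>A\<in>\<Omega>. \<exists>t. run (allowed_query I) ext (enc_extension I L s A)
                              (enc_subset (facilities I) (snd s' A)) t \<and>
                           poly_time c e I (enc_extension I L s A) t) \<and>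
              (\<forall>A\<in>\<Omega>. maxdist I s' A \<le> ereal \<eta>) \<and>
              (\<forall>A\<in>set (map fst L). snd s' A = snd s A))) \<and>
     (\<forall>I \<Omega>. valid_inst P I \<longrightarrow> \<Omega> \<subseteq> scenarios I \<longrightarrow>
        (\<forall>b\<ge>0. finite (potential_strategies alg ext (I\<lparr>budget := b\<rparr>) \<Omega>) \<and>
                card (potential_strategies alg ext (I\<lparr>budget := b\<rparr>) \<Omega>) \<le> \<psi> I \<Omega>))"


section \<open>The black-box model\<close>

text \<open>The space of \<open>D\<close> plays the role of its support.\<close>

definition bb_instance :: "problem \<Rightarrow> inst \<Rightarrow> scenario measure \<Rightarrow> bool" where
  "bb_instance P I D \<longleftrightarrow> valid_inst P I \<and> prob_space D \<and> space D \<subseteq> scenarios I \<and>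
     fst \<in> measurable D (count_space UNIV) \<and>
     (\<forall>i\<in>facilities I. (\<lambda>A. snd A i) \<in> borel_measurable D)"

text \<open>
  The strategies considered are the potential black-box strategies, for budgets between the
  given one and the one relaxed by the factor \<open>1 + \<epsilon>\<close>.
\<close>

definition continuous_costs :: "prog \<Rightarrow> prog \<Rightarrow> real \<Rightarrow> inst \<Rightarrow> scenario measure \<Rightarrow> bool" where
  "continuous_costs alg ext \<epsilon> I D \<longleftrightarrow>
     (\<forall>b\<in>{budget I..(1 + \<epsilon>) * budget I}.
        \<forall>s\<in>potential_strategies alg ext (I\<lparr>budget := b\<rparr>) (space D).
          snd s \<in> measurable D (count_space UNIV) \<and>
          continuous_on UNIV (cdf (distr D borel (cost I s))))"

definition samples :: "scenario measure \<Rightarrow> (nat \<Rightarrow> scenario) measure" where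
  "samples D = (\<Pi>\<^sub>M k\<in>(UNIV :: nat set). D)"

text \<open>
  The black-box solution is a strategy for all of \<open>D\<close>. It is represented by the stage-I set,
  which is the first component of the output \<open>out\<close> of the sampling phase, and by a sample-free
  program \<open>dec\<close>, which computes the stage-II set of any scenario from the input, \<open>out\<close> and the
  scenario.
\<close>

definition bb_outputs ::
  "prog \<Rightarrow> inst \<Rightarrow> scenario measure \<Rightarrow> val \<Rightarrow> val \<Rightarrow> strategy \<Rightarrow> bool" where
  "bb_outputs dec I D inp out s \<longleftrightarrow> is_strategy I D (space D) s \<and>
     (\<exists>adv. out = VPair (enc_subset (facilities I) (fst s)) adv) \<and>
     (\<forall>A\<in>space D. \<exists>t. run (allowed_query I) dec (VPair inp (VPair out (enc_scenario I A)))
                         (enc_subset (facilities I) (snd s A)) t)"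

text \<open>
  The logarithms in the sample bound are read as at least \<open>1\<close>. For \<open>n * m \<ge> 2\<close> and \<open>q \<ge> 1\<close>
  this only changes the constant of the O-notation; for \<open>n = m = q = 1\<close> the product of the plain
  logarithms tends to \<open>0\<close> as \<open>\<gamma>\<close> tends to \<open>1\<close>, so that no sample at all would be allowed.
\<close>

definition Log :: "real \<Rightarrow> real" where
  "Log x = max 1 (ln x)"

definition sample_bound :: "nat \<Rightarrow> nat \<Rightarrow> nat \<Rightarrow> real \<Rightarrow> real \<Rightarrow> real \<Rightarrow> real" where
  "sample_bound n m q \<gamma> \<epsilon> \<alpha> =
     1 / (\<epsilon> * \<alpha>) * Log (real n * real m * real q / \<gamma>) * Log (real n * real m / \<gamma>)"

end

theory Submission
  imports Defs
begin

text \<open>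
  Running times of the black-box algorithm are not bounded, so a single batch of \<open>N\<close> samples suffices:
  the approximation algorithm is run, with budget \<open>(1 + \<epsilon> / 2) * B\<close>, on the uniform distribution over
  every subset of at least \<open>(1 - \<alpha> / 16) * N\<close> of the samples. The first strategy that is found is
  extended to all scenarios and truncated: scenarios whose stage-II cost exceeds the \<open>\<alpha> / 4\<close> upper
  quantile \<open>T\<close> of the sample costs get no stage-II facilities.

  Discarding a fraction of the samples is what makes \<open>1 / (\<epsilon> * \<alpha>)\<close> samples enough without any variance
  bound. If an \<open>\<alpha>\<close>-fraction of mass lies above a cost threshold \<open>t\<close>, then the discarded part lowers the
  mean by order \<open>\<alpha> * t\<close>, and an exponential moment bound with the drift \<open>\<epsilon> * B + \<alpha> * t\<close> and the variance
  proxy \<open>t * B\<close> has exponent of order \<open>N * \<epsilon> * \<alpha>\<close>. On the feasible side this shows that some large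
  subset of the samples has average cost at most \<open>(1 + \<epsilon> / 2) * B\<close> for an optimal strategy; on the
  generalization side it shows, by a union bound over all potential strategies, that every strategy
  that is cheap on a large subset of the samples has truncated mean at most \<open>(1 + \<epsilon>) * B\<close>.
\<close>


section \<open>Executable functions on program data\<close>

text \<open>The search tries all large subsets of the samples, yet the union bound is over
  strategies only: for a fixed strategy one event serves every large subset and every threshold at
  once, because the samples outside a subset, at most \<alpha> * N / 16 of them, contribute at most
  t each to costs capped at t.

  The fractions of \<alpha> form a chain. The population quantiles of mass \<alpha> and \<alpha> / 8
  enclose the sample quantile of mass \<alpha> / 4, so truncation hits mass at most \<alpha>. The
  discarded \<alpha> / 16 is half of the \<alpha> / 8 above t; the other half is drift. The feasible
  side trims mass \<alpha> / 64, which leaves one factor 2 for fluctuation and one for rounding. The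
  slack \<epsilon> * B is halved: one half relaxes the budget of the search, the other is lost
  between sample and distribution.

  Explicit instances list distinct scenarios, so candidate averages are sums over sets. These agree
  with sums over sample indices only if the samples are distinct, which continuity of the costs
  provides almost surely.\<close>

lemma exec_sample_free:
  "exec Q \<omega> p v k w k' t \<Longrightarrow> sample_free p \<Longrightarrow> k' = k \<and> (\<forall>\<omega>' l. exec Q \<omega>' p v l w l t)"
proof (induction rule: exec.induct)
  case (exec_Loop_True b v k k1 t1 p u k2 t2 w k3 t3)
  then show ?case using exec.exec_Loop_True by fastforce
qed (simp_all del: One_nat_def add_Suc_right add_0_right, (blast intro: exec.intros)+)

text \<open>The specifications of \<open>alg\<close> and \<open>ext\<close> fix a dummy sample
  sequence and the counter 0. A sample-free program sees neither, so quantifying over both and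
  dropping the step count gives a form in which these programs can be called in the middle of a
  sampling run.\<close>

definition runs :: "(val \<Rightarrow> val) \<Rightarrow> prog \<Rightarrow> val \<Rightarrow> val \<Rightarrow> bool" where
  "runs Q p v w \<longleftrightarrow> (\<forall>\<omega> k. \<exists>t. exec Q \<omega> p v k w k t)"

lemma run_imp_runs: "run Q p v w t \<Longrightarrow> sample_free p \<Longrightarrow> runs Q p v w"
  unfolding run_def runs_def using exec_sample_free by blast

lemma runs_imp_run: "runs Q p v w \<Longrightarrow> \<exists>t. run Q p v w t"
  unfolding run_def runs_def by blast

lemma runs_Skip: "runs Q Skip v v"
  and runs_Lit: "runs Q (Lit c) v c"
  and runs_Prim: "runs Q (Prim f) v (apply_prim f v)"
  unfolding runs_def by (blast intro: exec.intros)+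

lemma runs_Both: "runs Q p v u \<Longrightarrow> runs Q q v w \<Longrightarrow> runs Q (Both p q) v (VPair u w)"
  unfolding runs_def by (meson exec_Both)

lemma runs_Then: "runs Q p v u \<Longrightarrow> runs Q q u w \<Longrightarrow> runs Q (Then p q) v w"
  unfolding runs_def by (meson exec_Then)

lemma runs_Cond:
  "runs Q b v u \<Longrightarrow> (u = VNum 1 \<Longrightarrow> runs Q p v w) \<Longrightarrow> (u \<noteq> VNum 1 \<Longrightarrow> runs Q q v w) \<Longrightarrow>
   runs Q (Cond b p q) v w"
  unfolding runs_def by (metis exec_Cond_True exec_Cond_False)

lemma runs_Loop_True:
  "runs Q b v (VNum 1) \<Longrightarrow> runs Q p v u \<Longrightarrow> runs Q (Loop b p) u w \<Longrightarrow> runs Q (Loop b p) v w"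
  unfolding runs_def by (meson exec_Loop_True)

lemma runs_Loop_False: "runs Q b v u \<Longrightarrow> u \<noteq> VNum 1 \<Longrightarrow> runs Q (Loop b p) v v"
  unfolding runs_def by (meson exec_Loop_False)

abbreviation vfst :: "val \<Rightarrow> val" where "vfst v \<equiv> apply_prim Fst v"
abbreviation vsnd :: "val \<Rightarrow> val" where "vsnd v \<equiv> apply_prim Snd v"

text \<open>Programs have no variables. The loop state \<open>VPair e (VPair a l)\<close> carries an
  environment, the accumulator and the unread rest of the list; the environment is what gives the
  body access to the enclosing input.\<close>

definition fold_prog :: "prog \<Rightarrow> prog" where
  "fold_prog p =
     (let snd2 = Then (Prim Snd) (Prim Snd) in
      Then
        (Loop (Then snd2 (Prim IsPair))
           (Both (Prim Fst)
             (Both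
               (Then (Both (Prim Fst) (Both (Then (Prim Snd) (Prim Fst)) (Then snd2 (Prim Fst)))) p)
               (Then snd2 (Prim Snd)))))
        (Then (Prim Snd) (Prim Fst)))"

lemma sample_free_fold_prog [simp]: "sample_free (fold_prog p) = sample_free p"
  by (simp add: fold_prog_def Let_def)

fun velems :: "val \<Rightarrow> val list" where
  "velems (VPair x l) = x # velems l"
| "velems _ = []"

lemma velems_vlist [simp]: "velems (vlist xs) = xs"
  by (induction xs) auto

text \<open>The body is specified only on elements of \<open>l\<close>, since \<open>alg\<close> and
  \<open>ext\<close> have known results only on genuine codes. Elsewhere \<open>g\<close> is
  arbitrary, so it can be assembled from the outcomes of those calls.\<close>

lemma runs_fold:
  assumes "\<And>x a. x \<in> set (velems l) \<Longrightarrow> P a \<Longrightarrow> runs Q p (VPair e (VPair a x)) (g a x) \<and> P (g a x)"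
    and "P a"
  shows "runs Q (fold_prog p) (VPair e (VPair a l)) (foldl g a (velems l))"
proof -
  define snd2 where "snd2 = Then (Prim Snd) (Prim Snd)"
  have snd2: "runs Q snd2 v (vsnd (vsnd v))" for v
    unfolding snd2_def by (rule runs_Then[OF runs_Prim runs_Prim])
  define tst where "tst = Then snd2 (Prim IsPair)"
  have tst: "runs Q tst v (apply_prim IsPair (vsnd (vsnd v)))" for v
    unfolding tst_def by (intro runs_Then[OF snd2] runs_Prim)
  define arg where "arg = Both (Prim Fst) (Both (Then (Prim Snd) (Prim Fst)) (Then snd2 (Prim Fst)))"
  have arg: "runs Q arg v (VPair (vfst v) (VPair (vfst (vsnd v)) (vfst (vsnd (vsnd v)))))" for v
    unfolding arg_def by (intro runs_Both runs_Then[OF snd2] runs_Then[OF runs_Prim] runs_Prim)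
  define body where "body = Both (Prim Fst) (Both (Then arg p) (Then snd2 (Prim Snd)))"
  \<comment> \<open>\<open>velems\<close> ignores whatever ends the list, so the loop leaves some
    tail \<open>l'\<close> behind; the final projection drops it.\<close>
  have "\<exists>l'. runs Q (Loop tst body) (VPair e (VPair a l)) (VPair e (VPair (foldl g a (velems l)) l'))"
    using assms
  proof (induction l arbitrary: a)
    case (VPair x l)
    have g: "runs Q p (VPair e (VPair a x)) (g a x)" "P (g a x)"
      using VPair.prems by auto
    have "runs Q body (VPair e (VPair a (VPair x l))) (VPair e (VPair (g a x) l))"
      unfolding body_def
      using runs_Prim[of Q Fst "VPair e (VPair a (VPair x l))"] g(1)
        runs_Then[OF snd2 runs_Prim, of Snd "VPair e (VPair a (VPair x l))"]
        arg[of "VPair e (VPair a (VPair x l))"]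
      by (auto intro!: runs_Both runs_Then[where p = arg])
    moreover have "\<exists>l'. runs Q (Loop tst body) (VPair e (VPair (g a x) l))
        (VPair e (VPair (foldl g (g a x) (velems l)) l'))"
      using VPair.prems g(2) by (intro VPair.IH) auto
    moreover have "runs Q tst (VPair e (VPair a (VPair x l))) (VNum 1)"
      using tst[of "VPair e (VPair a (VPair x l))"] by (simp add: vbool_def)
    ultimately show ?case
      by (auto intro: runs_Loop_True)
  next
    case VNil
    then show ?case
      using runs_Loop_False[OF tst[of "VPair e (VPair a VNil)"], of body]
      by (auto simp: vbool_def)
  next
    case (VNum y)
    then show ?case
      using runs_Loop_False[OF tst[of "VPair e (VPair a (VNum y))"], of body]
      by (auto simp: vbool_def)
  qed
  then obtain l' where l': "runs Q (Loop tst body) (VPair e (VPair a l))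
      (VPair e (VPair (foldl g a (velems l)) l'))" ..
  show ?thesis
    unfolding fold_prog_def Let_def snd2_def[symmetric] tst_def[symmetric] arg_def[symmetric]
      body_def[symmetric]
    using runs_Then[OF l' runs_Then[OF runs_Prim runs_Prim], of Snd Fst] by simp
qed

text \<open>One program serves all oracles and all data, malformed data included, so computable
  functions compose without side conditions. The oracle matters only inside \<open>alg\<close> and
  \<open>ext\<close>.\<close>

definition computable :: "(val \<Rightarrow> val) \<Rightarrow> bool" where
  "computable f \<longleftrightarrow> (\<exists>p. sample_free p \<and> (\<forall>Q v. runs Q p v (f v)))"

lemma computable_id: "computable (\<lambda>v. v)"
  unfolding computable_def by (intro exI[of _ Skip]) (simp add: runs_Skip)

lemma computable_const: "computable (\<lambda>v. c)"
  unfolding computable_def by (intro exI[of _ "Lit c"]) (simp add: runs_Lit)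

lemma computable_comp: "computable g \<Longrightarrow> computable f \<Longrightarrow> computable (\<lambda>v. g (f v))"
  unfolding computable_def by (meson runs_Then sample_free.simps(5))

lemma computable_prim: "computable f \<Longrightarrow> computable (\<lambda>v. apply_prim h (f v))"
  by (rule computable_comp[of "apply_prim h"])
     (auto simp: computable_def intro!: exI[of _ "Prim h"] runs_Prim)

lemma computable_pair: "computable f \<Longrightarrow> computable g \<Longrightarrow> computable (\<lambda>v. VPair (f v) (g v))"
  unfolding computable_def by (meson runs_Both sample_free.simps(4))

lemma computable_if:
  assumes "computable b" "computable f" "computable g"
  shows "computable (\<lambda>v. if b v = VNum 1 then f v else g v)"
proof -
  obtain p q r where "sample_free p" "sample_free q" "sample_free r"
    "\<And>Q v. runs Q p v (b v)" "\<And>Q v. runs Q q v (f v)" "\<And>Q v. runs Q r v (g v)"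
    using assms unfolding computable_def by metis
  then show ?thesis
    unfolding computable_def by (intro exI[of _ "Cond p q r"]) (auto intro!: runs_Cond)
qed

text \<open>The body receives environment, accumulator and element packed into one value, hence the
  projections in the first premise. Letting \<open>g\<close> depend on \<open>v\<close> is what
  permits nested folds.\<close>

lemma computable_fold:
  assumes "computable (\<lambda>u. g (vfst u) (vfst (vsnd u)) (vsnd (vsnd u)))"
    and "computable a" "computable l"
  shows "computable (\<lambda>v. foldl (\<lambda>b x. g v b x) (a v) (velems (l v)))"
proof -
  obtain p q r where pqr: "sample_free p" "sample_free q" "sample_free r"
    "\<And>Q u. runs Q p u (g (vfst u) (vfst (vsnd u)) (vsnd (vsnd u)))"
    "\<And>Q v. runs Q q v (a v)" "\<And>Q v. runs Q r v (l v)"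
    using assms unfolding computable_def by metis
  have "runs Q p (VPair e (VPair b x)) (g e b x)" for Q e b x
    using pqr(4)[of Q "VPair e (VPair b x)"] by simp
  then have "runs Q (fold_prog p) (VPair v (VPair (a v) (l v))) (foldl (g v) (a v) (velems (l v)))" for Q v
    by (intro runs_fold[where P = "\<lambda>_. True"]) auto
  then have "runs Q (Then (Both Skip (Both q r)) (fold_prog p)) v
      (foldl (g v) (a v) (velems (l v)))" for Q v
    using runs_Then[OF runs_Both[OF runs_Skip runs_Both[OF pqr(5,6)]]] by blast
  with pqr(1-3) show ?thesis
    unfolding computable_def by (intro exI[of _ "Then (Both Skip (Both q r)) (fold_prog p)"]) auto
qed

lemmas computable_intros =
  computable_fold computable_if computable_pair computable_prim computable_id computable_const

section \<open>Arithmetic and list routines on program data\<close>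

abbreviation vadd :: "val \<Rightarrow> val \<Rightarrow> val" where "vadd u v \<equiv> apply_prim Add (VPair u v)"
abbreviation vmul :: "val \<Rightarrow> val \<Rightarrow> val" where "vmul u v \<equiv> apply_prim Mul (VPair u v)"
abbreviation vdiv :: "val \<Rightarrow> val \<Rightarrow> val" where "vdiv u v \<equiv> apply_prim Divide (VPair u v)"
abbreviation vless :: "val \<Rightarrow> val \<Rightarrow> val" where "vless u v \<equiv> apply_prim LessThan (VPair u v)"

lemma vbool_eq_1 [simp]: "vbool b = VNum 1 \<longleftrightarrow> b"
  by (simp add: vbool_def)

definition vlength :: "val \<Rightarrow> val" where
  "vlength l = foldl (\<lambda>a x. vadd a (VNum 1)) (VNum 0) (velems l)"

text \<open>A fold reads one list only, so the other one travels in the accumulator and loses its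
  head at each step. Applied to the code of a facility set and a cost vector, the result is the
  stage-II cost.\<close>

definition vdot :: "val \<Rightarrow> val \<Rightarrow> val" where
  "vdot u w = vsnd (foldl (\<lambda>a x. VPair (vsnd (vfst a)) (vadd (vsnd a) (vmul x (vfst (vfst a)))))
     (VPair w (VNum 0)) (velems u))"

text \<open>The zero vector of matching length is the code of the empty set, the stage-II set of a
  truncated scenario.\<close>

definition vzero :: "val \<Rightarrow> val" where
  "vzero l = foldl (\<lambda>a x. VPair (VNum 0) a) VNil (velems l)"

text \<open>The language has no equality test: two numbers are equal when neither is less than the
  other.\<close>

definition veq :: "val \<Rightarrow> val \<Rightarrow> val" where
  "veq u w = vsnd (foldl (\<lambda>a x. VPair (vsnd (vfst a))
       (if vless x (vfst (vfst a)) = VNum 1 then VNum 0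
        else if vless (vfst (vfst a)) x = VNum 1 then VNum 0 else vsnd a))
     (VPair w (VNum 1)) (velems u))"

definition velem :: "val \<Rightarrow> val \<Rightarrow> val" where
  "velem x l = foldl (\<lambda>a y. if veq (vfst x) (vfst y) = VNum 1
       then if veq (vsnd x) (vsnd y) = VNum 1 then VNum 1 else a else a) (VNum 0) (velems l)"

definition vcands :: "val \<Rightarrow> val" where
  "vcands l = foldl (\<lambda>cs x. foldl (\<lambda>new c.
       if velem x c = VNum 1 then VPair c new else VPair c (VPair (VPair x c) new)) VNil (velems cs))
     (VPair VNil VNil) (velems l)"

definition vuniform :: "val \<Rightarrow> val" where
  "vuniform c = foldl (\<lambda>a x. VPair (VPair (vdiv (VNum 1) (vlength c)) x) a) VNil (velems c)"

definition vcount_ge :: "val \<Rightarrow> val \<Rightarrow> val" where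
  "vcount_ge x l = foldl (\<lambda>a y. if vless y x = VNum 1 then a else vadd a (VNum 1)) (VNum 0) (velems l)"

text \<open>Computes an upper order statistic without sorting, by recounting for each entry that
  beats the current value.\<close>

definition vthreshold :: "val \<Rightarrow> val \<Rightarrow> val" where
  "vthreshold \<kappa> l = foldl (\<lambda>T x. if vless T x = VNum 1
       then if vless (vcount_ge x l) \<kappa> = VNum 1 then T else x else T) (VNum 0) (velems l)"

lemma computable_comp2:
  assumes "computable (\<lambda>v. h (vfst v) (vsnd v))" "computable f" "computable g"
  shows "computable (\<lambda>v. h (f v) (g v))"
  using computable_comp[OF assms(1) computable_pair[OF assms(2,3)]] by simp

lemma computable_vlength: "computable f \<Longrightarrow> computable (\<lambda>v. vlength (f v))"
  unfolding vlength_def by (intro computable_intros)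

lemma computable_vzero: "computable f \<Longrightarrow> computable (\<lambda>v. vzero (f v))"
  unfolding vzero_def by (intro computable_intros)

lemma computable_vdot: "computable f \<Longrightarrow> computable g \<Longrightarrow> computable (\<lambda>v. vdot (f v) (g v))"
  unfolding vdot_def by (intro computable_intros)

lemma computable_veq: "computable f \<Longrightarrow> computable g \<Longrightarrow> computable (\<lambda>v. veq (f v) (g v))"
  unfolding veq_def by (intro computable_intros)

lemma computable_velem: "computable f \<Longrightarrow> computable g \<Longrightarrow> computable (\<lambda>v. velem (f v) (g v))"
  by (rule computable_comp2[of velem]) (unfold velem_def, intro computable_intros computable_veq)

lemma computable_vcands: "computable f \<Longrightarrow> computable (\<lambda>v. vcands (f v))"
  unfolding vcands_def by (intro computable_intros computable_velem)

lemma computable_vuniform: "computable f \<Longrightarrow> computable (\<lambda>v. vuniform (f v))"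
  by (rule computable_comp[of vuniform]) (unfold vuniform_def, intro computable_intros computable_vlength)

lemma computable_vcount_ge: "computable f \<Longrightarrow> computable g \<Longrightarrow> computable (\<lambda>v. vcount_ge (f v) (g v))"
  by (rule computable_comp2[of vcount_ge]) (unfold vcount_ge_def, intro computable_intros)

lemma computable_vthreshold: "computable f \<Longrightarrow> computable g \<Longrightarrow> computable (\<lambda>v. vthreshold (f v) (g v))"
  by (rule computable_comp2[of vthreshold]) (unfold vthreshold_def, intro computable_intros computable_vcount_ge)

section \<open>Encodings of scenarios, and the list operations of the algorithm\<close>

lemma vlength_vlist [simp]: "vlength (vlist xs) = VNum (real (length xs))"
proof -
  have "foldl (\<lambda>a x. vadd a (VNum 1)) (VNum r) xs = VNum (r + real (length xs))" for r
    by (induction xs arbitrary: r) auto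
  then show ?thesis by (simp add: vlength_def)
qed

lemma vzero_vlist [simp]: "vzero (vlist xs) = vlist (replicate (length xs) (VNum 0))"
proof -
  have "foldl (\<lambda>a x. VPair (VNum 0) a) (vlist (replicate n (VNum 0))) xs =
      vlist (replicate (n + length xs) (VNum 0))" for n
  proof (induction xs arbitrary: n)
    case (Cons x xs)
    show ?case using Cons[of "Suc n"] by simp
  qed simp
  from this[of 0] show ?thesis by (simp add: vzero_def)
qed

lemma vdot_vlist:
  assumes "length xs = length ys"
  shows "vdot (vlist (map VNum xs)) (vlist (map VNum ys)) = VNum (\<Sum>(x, y)\<leftarrow>zip xs ys. x * y)"
proof -
  have "vsnd (foldl (\<lambda>a x. VPair (vsnd (vfst a)) (vadd (vsnd a) (vmul x (vfst (vfst a)))))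
       (VPair (vlist (map VNum ys)) (VNum r)) (map VNum xs)) = VNum (r + (\<Sum>(x, y)\<leftarrow>zip xs ys. x * y))" for r
    using assms by (induction xs ys arbitrary: r rule: list_induct2) (auto simp: algebra_simps)
  from this[of 0] show ?thesis by (simp add: vdot_def)
qed

lemma veq_vlist:
  assumes "length xs = length ys"
  shows "veq (vlist (map VNum xs)) (vlist (map VNum ys)) = vbool (xs = ys)"
proof -
  define step where "step = (\<lambda>a x. VPair (vsnd (vfst a))
       (if vless x (vfst (vfst a)) = VNum 1 then VNum 0
        else if vless (vfst (vfst a)) x = VNum 1 then VNum 0 else vsnd a))"
  have "vsnd (foldl step (VPair (vlist (map VNum ys)) (vbool b)) (map VNum xs)) =
      vbool (b \<and> xs = ys)" for b
    using assms
  proof (induction xs ys arbitrary: b rule: list_induct2)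
    case (Cons x xs y ys)
    have "step (VPair (vlist (map VNum (y # ys))) (vbool b)) (VNum x) =
        VPair (vlist (map VNum ys)) (vbool (b \<and> x = y))"
      by (auto simp: step_def vbool_def)
    then show ?case using Cons.IH by auto
  qed simp
  from this[of True] show ?thesis
    by (simp add: veq_def step_def vbool_def)
qed

lemma enc_on_VNum: "enc_on X (\<lambda>x. VNum (f x)) = vlist (map VNum (map f (sorted_list_of_set X)))"
  by (simp add: enc_on_def comp_def)

lemma enc_subset_VNum:
  "enc_subset X Y = vlist (map VNum (map (\<lambda>x. if x \<in> Y then 1 else 0) (sorted_list_of_set X)))"
  by (simp add: enc_subset_def enc_on_def vbool_def comp_def)

text \<open>Equal codes mean equal scenarios because cost functions are extensional on the
  facilities; this is why all scenarios concerned are assumed to lie in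
  \<open>scenarios I\<close>.\<close>

lemma velem_enc_scenario:
  assumes fin: "finite (clients I)" "finite (facilities I)"
    and "insert A (set xs) \<subseteq> scenarios I"
  shows "velem (enc_scenario I A) (vlist (map (enc_scenario I) xs)) = vbool (A \<in> set xs)"
proof -
  have eq: "veq (vfst (enc_scenario I A)) (vfst (enc_scenario I B)) = VNum 1 \<and>
      veq (vsnd (enc_scenario I A)) (vsnd (enc_scenario I B)) = VNum 1 \<longleftrightarrow> A = B"
    if "B \<in> set xs" for B
  proof -
    have "A \<in> scenarios I" "B \<in> scenarios I" using assms(3) that by auto
    then have "fst A \<subseteq> clients I" "fst B \<subseteq> clients I"
      "snd A \<in> extensional (facilities I)" "snd B \<in> extensional (facilities I)"
      by (auto simp: scenarios_def PiE_def)
    then have "(\<forall>j\<in>clients I. j \<in> fst A \<longleftrightarrow> j \<in> fst B) \<and> (\<forall>i\<in>facilities I. snd A i = snd B i) \<longleftrightarrow> A = B"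
      by (auto intro!: prod_eqI extensionalityI)
    then show ?thesis
      using fin by (auto simp: enc_scenario_def enc_on_VNum enc_subset_VNum veq_vlist
          simp del: map_map split: if_splits)
  qed
  define g where "g = (\<lambda>a y. if veq (vfst (enc_scenario I A)) (vfst y) = VNum 1
       then if veq (vsnd (enc_scenario I A)) (vsnd y) = VNum 1 then VNum 1 else a else a)"
  have g: "g (vbool b) (enc_scenario I B) = vbool (b \<or> A = B)" if "B \<in> set xs" for b B
    using eq[OF that] by (auto simp: g_def vbool_def)
  have "foldl g (vbool b) (map (enc_scenario I) ys) = vbool (b \<or> A \<in> set ys)"
    if "set ys \<subseteq> set xs" for b ys
    using that by (induction ys arbitrary: b) (auto simp: g)
  from this[of xs False] show ?thesis by (simp add: velem_def g_def vbool_def)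
qed

text \<open>Subsets are represented by duplicate-free lists, as explicit instances must list
  distinct scenarios while a sample may repeat. Hence a scenario is never added to a list that
  contains it. The same subset may occur several times, which does no harm to a search.\<close>

definition candidates :: "'a list \<Rightarrow> 'a list list" where
  "candidates xs =
     foldl (\<lambda>cs x. foldl (\<lambda>new c. if x \<in> set c then c # new else c # (x # c) # new) [] cs) [[]] xs"

lemma candidates_snoc_set:
  "set (candidates (xs @ [x])) =
     set (candidates xs) \<union> (\<lambda>c. x # c) ` {c \<in> set (candidates xs). x \<notin> set c}"
proof -
  have "set (foldl (\<lambda>new c. if x \<in> set c then c # new else c # (x # c) # new) ys cs) =
      set ys \<union> set cs \<union> (\<lambda>c. x # c) ` {c \<in> set cs. x \<notin> set c}" for ys cs
    by (induction cs arbitrary: ys) auto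
  then show ?thesis by (simp add: candidates_def)
qed

lemma candidates_sound: "c \<in> set (candidates xs) \<Longrightarrow> distinct c \<and> set c \<subseteq> set xs"
proof (induction xs arbitrary: c rule: rev_induct)
  case Nil
  then show ?case by (simp add: candidates_def)
next
  case (snoc x xs)
  then show ?case by (fastforce simp: candidates_snoc_set)
qed

lemma candidates_complete: "Y \<subseteq> set xs \<Longrightarrow> \<exists>c\<in>set (candidates xs). set c = Y"
proof (induction xs arbitrary: Y rule: rev_induct)
  case Nil
  then show ?case by (simp add: candidates_def)
next
  case (snoc x xs)
  show ?case
  proof (cases "Y \<subseteq> set xs")
    case True
    then show ?thesis using snoc.IH by (auto simp: candidates_snoc_set)
  next
    case False
    with snoc.prems have "x \<in> Y" by auto
    obtain c where "c \<in> set (candidates xs)" "set c = Y - {x}"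
      using snoc.IH[of "Y - {x}"] snoc.prems by auto
    then show ?thesis
      using \<open>x \<in> Y\<close> by (intro bexI[of _ "x # c"]) (auto simp: candidates_snoc_set)
  qed
qed

lemma vcands_enc_scenario:
  assumes fin: "finite (clients I)" "finite (facilities I)" and "set xs \<subseteq> scenarios I"
  shows "vcands (vlist (map (enc_scenario I) xs)) =
    vlist (map (\<lambda>c. vlist (map (enc_scenario I) c)) (candidates xs))"
  using assms(3)
proof (induction xs rule: rev_induct)
  case Nil
  then show ?case by (simp add: vcands_def candidates_def)
next
  case (snoc x xs)
  let ?e = "\<lambda>c. vlist (map (enc_scenario I) c)"
  have "foldl (\<lambda>new c. if velem (enc_scenario I x) c = VNum 1 then VPair c new
          else VPair c (VPair (VPair (enc_scenario I x) c) new)) (vlist (map ?e new)) (map ?e cs) =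
      vlist (map ?e (foldl (\<lambda>new c. if x \<in> set c then c # new else c # (x # c) # new) new cs))"
    if "\<forall>c\<in>set cs. set c \<subseteq> scenarios I" for new cs
    using that
  proof (induction cs arbitrary: new)
    case (Cons c cs)
    then have "velem (enc_scenario I x) (?e c) = vbool (x \<in> set c)"
      using snoc.prems by (intro velem_enc_scenario[OF fin]) auto
    moreover have "\<forall>c\<in>set cs. set c \<subseteq> scenarios I" using Cons.prems by simp
    note Cons.IH[OF this, of "c # new"] Cons.IH[OF this, of "c # (x # c) # new"]
    ultimately show ?case by (cases "x \<in> set c") simp_all
  qed simp
  from this[of "candidates xs" "[]"] have
    "foldl (\<lambda>new c. if velem (enc_scenario I x) c = VNum 1 then VPair c new
          else VPair c (VPair (VPair (enc_scenario I x) c) new)) VNil (velems (vcands (?e xs))) =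
     vlist (map ?e (candidates (xs @ [x])))"
    using snoc candidates_sound[of _ xs] by (fastforce simp: candidates_def)
  then show ?case by (simp add: vcands_def)
qed

lemma vuniform_vlist:
  "vuniform (vlist c) = vlist (map (\<lambda>x. VPair (VNum (1 / real (length c))) x) (rev c))"
proof -
  have "foldl (\<lambda>a x. VPair (VPair u x) a) (vlist ys) c = vlist (map (\<lambda>x. VPair u x) (rev c) @ ys)"
    for u ys
  proof (induction c arbitrary: ys)
    case (Cons x c)
    show ?case using Cons[of "VPair u x # ys"] by simp
  qed simp
  from this[of _ "[]"] show ?thesis by (simp add: vuniform_def)
qed

section \<open>Empirical upper quantiles\<close>

definition count_ge :: "real \<Rightarrow> real list \<Rightarrow> nat" where
  "count_ge x ys = length (filter (\<lambda>y. x \<le> y) ys)"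

lemma vcount_ge_vlist: "vcount_ge (VNum x) (vlist (map VNum ys)) = VNum (real (count_ge x ys))"
proof -
  have "foldl (\<lambda>a y. if vless y (VNum x) = VNum 1 then a else vadd a (VNum 1)) (VNum r) (map VNum ys) =
      VNum (r + real (count_ge x ys))" for r
    by (induction ys arbitrary: r) (auto simp: count_ge_def simp del: apply_prim.simps(11))
  from this[of 0] show ?thesis by (simp add: vcount_ge_def)
qed

text \<open>The inserted 0 is the start value of the program's scan and keeps \<open>Max\<close> on
  a nonempty set. Since costs are nonnegative, it is a value that all samples reach.\<close>

definition threshold :: "real \<Rightarrow> real list \<Rightarrow> real" where
  "threshold \<kappa> ys = Max (insert 0 {y \<in> set ys. \<kappa> \<le> real (count_ge y ys)})"

lemma vthreshold_vlist: "vthreshold (VNum \<kappa>) (vlist (map VNum ys)) = VNum (threshold \<kappa> ys)"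
proof -
  have "foldl (\<lambda>T x. if vless T x = VNum 1
       then if vless (vcount_ge x (vlist (map VNum ys))) (VNum \<kappa>) = VNum 1 then T else x else T)
       (VNum r) (map VNum zs) = VNum (Max (insert r {y \<in> set zs. \<kappa> \<le> real (count_ge y ys)}))" for r zs
  proof (induction zs arbitrary: r)
    case (Cons z zs)
    define A where "A = {y \<in> set zs. \<kappa> \<le> real (count_ge y ys)}"
    have "finite A" by (simp add: A_def)
    have *: "{y \<in> set (z # zs). \<kappa> \<le> real (count_ge y ys)} =
        (if \<kappa> \<le> real (count_ge z ys) then insert z A else A)"
      by (auto simp: A_def)
    have "Max (insert r (insert z A)) = Max (insert (max r z) A)"
      using \<open>finite A\<close> by (cases "A = {}") (auto simp: ac_simps)
    then show ?case
      using Cons[of r] Cons[of z] unfolding *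
      by (auto simp: vcount_ge_vlist max_def not_le A_def[symmetric])
  qed simp
  from this[of 0 ys] show ?thesis by (simp add: vthreshold_def threshold_def)
qed

text \<open>This and the next lemma are the two sides of a quantile: at least
  \<open>\<kappa>\<close> samples reach the threshold and fewer than \<open>\<kappa>\<close> exceed
  it. The probabilistic part knows nothing else about the threshold.\<close>

lemma threshold_count_ge:
  assumes "\<forall>y\<in>set ys. 0 \<le> y" "\<kappa> \<le> real (length ys)"
  shows "\<kappa> \<le> real (count_ge (threshold \<kappa> ys) ys)"
proof -
  have "threshold \<kappa> ys \<in> insert 0 {y \<in> set ys. \<kappa> \<le> real (count_ge y ys)}"
    unfolding threshold_def by (rule Max_in) auto
  moreover have "count_ge 0 ys = length ys"
    using assms(1) by (auto simp: count_ge_def filter_id_conv)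
  ultimately show ?thesis using assms(2) by auto
qed

lemma threshold_count_greater:
  assumes "\<kappa> > 0"
  shows "real (length (filter (\<lambda>y. threshold \<kappa> ys < y) ys)) < \<kappa>"
proof (cases "\<exists>y\<in>set ys. threshold \<kappa> ys < y")
  case False
  then have "filter (\<lambda>y. threshold \<kappa> ys < y) ys = []" by (simp add: filter_empty_conv)
  with assms show ?thesis by simp
next
  case True
  define B where "B = {y \<in> set ys. threshold \<kappa> ys < y}"
  have B: "finite B" "B \<noteq> {}" using True by (auto simp: B_def)
  \<comment> \<open>The samples that exceed the threshold are exactly those that reach the least
    larger value \<open>z\<close>. If there were \<open>\<kappa>\<close> of them, \<open>z\<close>
    would itself be admissible in the maximum.\<close>
  define z where "z = Min B"
  have "z \<in> B" unfolding z_def using B by (rule Min_in)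
  have "filter (\<lambda>y. threshold \<kappa> ys < y) ys = filter (\<lambda>y. z \<le> y) ys"
    using \<open>z \<in> B\<close> B(1) by (intro filter_cong) (auto simp: z_def B_def)
  moreover have "\<not> \<kappa> \<le> real (count_ge z ys)"
  proof
    assume "\<kappa> \<le> real (count_ge z ys)"
    then have "z \<le> threshold \<kappa> ys"
      unfolding threshold_def using \<open>z \<in> B\<close> by (intro Max_ge) (auto simp: B_def)
    then show False using \<open>z \<in> B\<close> by (simp add: B_def)
  qed
  ultimately show ?thesis by (simp add: count_ge_def)
qed

section \<open>The programs\<close>

text \<open>The language has no logarithm, so the sample size is found by repeated multiplication.
  With \<open>x0\<close> = \<gamma> / 3 and \<beta> = exp (\<epsilon> * \<alpha> / 512) the loop
  stops at the first N for which 3 * (q + 1) * exp (- (\<epsilon> * \<alpha> * N / 512)) is at most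
  \<gamma>. Each draw is put in front of the earlier ones, hence the reversed order.\<close>

lemma sampler_exists:
  "\<exists>p. \<forall>Q \<omega> v q N. (\<forall>n<N. x0 * \<beta> ^ n < q + 1) \<longrightarrow> q + 1 \<le> x0 * \<beta> ^ N \<longrightarrow>
     (\<exists>t. exec Q \<omega> p (VPair v (VNum q)) 0
        (VPair (VPair v (VNum q)) (vlist (map \<omega> (rev [0..<N])))) N t)"
proof -
  have "computable (\<lambda>v. vless (vfst (vsnd v)) (vadd (vsnd (vfst v)) (VNum 1)))"
    by (intro computable_intros)
  then obtain tst where tst: "\<And>Q v. runs Q tst v (vless (vfst (vsnd v)) (vadd (vsnd (vfst v)) (VNum 1)))"
    unfolding computable_def by blast
  have "computable (\<lambda>v. vmul (vfst (vsnd v)) (VNum \<beta>))"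
    by (intro computable_intros)
  then obtain mul where mul: "\<And>Q v. runs Q mul v (vmul (vfst (vsnd v)) (VNum \<beta>))"
    unfolding computable_def by blast
  have "computable (\<lambda>v. vsnd (vsnd v))"
    by (intro computable_intros)
  then obtain snd2 where snd2: "\<And>Q v. runs Q snd2 v (vsnd (vsnd v))"
    unfolding computable_def by blast
  have "computable (\<lambda>v. VPair v (VPair (VNum x0) VNil))"
    by (intro computable_intros)
  then obtain init where init: "\<And>Q v. runs Q init v (VPair v (VPair (VNum x0) VNil))"
    unfolding computable_def by blast
  have "computable (\<lambda>v. VPair (vfst v) (vsnd (vsnd v)))"
    by (intro computable_intros)
  then obtain fin where fin: "\<And>Q v. runs Q fin v (VPair (vfst v) (vsnd (vsnd v)))"
    unfolding computable_def by blast
  define body where "body = Both (Prim Fst) (Both mul (Both Draw snd2))"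
  define p where "p = Then init (Then (Loop tst body) fin)"
  have "\<exists>t. exec Q \<omega> p (VPair v (VNum q)) 0
        (VPair (VPair v (VNum q)) (vlist (map \<omega> (rev [0..<N])))) N t"
    if less: "\<forall>n<N. x0 * \<beta> ^ n < q + 1" and le: "q + 1 \<le> x0 * \<beta> ^ N" for Q \<omega> v q N
  proof -
    define st where "st n = VPair (VPair v (VNum q))
      (VPair (VNum (x0 * \<beta> ^ n)) (vlist (map \<omega> (rev [0..<n]))))" for n
    have t: "runs Q tst (st n) (vbool (x0 * \<beta> ^ n < q + 1))" for n
      using tst[of Q "st n"] by (simp add: st_def)
    have b: "\<exists>t. exec Q \<omega> body (st n) n (st (Suc n)) (Suc n) t" for n
    proof -
      \<comment> \<open>\<open>snd2\<close> is executed after the draw, hence with the counter at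
        \<open>Suc n\<close>.\<close>
      obtain t1 t2 t3 where ex: "exec Q \<omega> (Prim Fst) (st n) n (VPair v (VNum q)) n t1"
        "exec Q \<omega> mul (st n) n (VNum (x0 * \<beta> ^ Suc n)) n t2"
        "exec Q \<omega> snd2 (st n) (Suc n) (vlist (map \<omega> (rev [0..<n]))) (Suc n) t3"
        using runs_Prim[of Q Fst "st n"] mul[of Q "st n"] snd2[of Q "st n"]
        unfolding runs_def by (auto simp: st_def mult_ac) blast
      show ?thesis
        using exec_Both[OF ex(1) exec_Both[OF ex(2) exec_Both[OF exec_Draw ex(3)]]]
        by (auto simp: body_def st_def)
    qed
    have "\<exists>t. exec Q \<omega> (Loop tst body) (st n) n (st N) N t" if "n \<le> N" for n
      using that
    proof (induction n rule: inc_induct)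
      case base
      obtain t where "exec Q \<omega> tst (st N) N (vbool False) N t"
        using t[of N] le unfolding runs_def by auto
      then show ?case using exec_Loop_False[of Q \<omega> tst "st N" N "vbool False"] by fastforce
    next
      case (step n)
      have "x0 * \<beta> ^ n < q + 1" using less step.hyps by blast
      then have "runs Q tst (st n) (vbool True)" using t[of n] by simp
      then obtain t1 where "exec Q \<omega> tst (st n) n (vbool True) n t1"
        unfolding runs_def by blast
      then show ?case
        using b[of n] step.IH exec_Loop_True[of Q \<omega> tst "st n" n n _ body] by (fastforce simp: vbool_def)
    qed
    from this[of 0] obtain t2 where t2: "exec Q \<omega> (Loop tst body) (st 0) 0 (st N) N t2" by auto
    obtain t1 where t1: "exec Q \<omega> init (VPair v (VNum q)) 0 (st 0) 0 t1"
      using init[of Q "VPair v (VNum q)"] unfolding runs_def st_def by auto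
    obtain t3 where t3: "exec Q \<omega> fin (st N) N
        (VPair (VPair v (VNum q)) (vlist (map \<omega> (rev [0..<N])))) N t3"
      using fin[of Q "st N"] unfolding runs_def st_def by fastforce
    show ?thesis
      unfolding p_def using exec_Then[OF t1 exec_Then[OF t2 t3]] by blast
  qed
  then show ?thesis by blast
qed

definition vscale_budget :: "real \<Rightarrow> val \<Rightarrow> val" where
  "vscale_budget b v = VPair (vfst v) (VPair (vfst (vsnd v)) (VPair (vfst (vsnd (vsnd v)))
     (VPair (vfst (vsnd (vsnd (vsnd v))))
       (VPair (vmul (VNum b) (vfst (vsnd (vsnd (vsnd (vsnd v)))))) VNil))))"

lemma computable_vscale_budget: "computable f \<Longrightarrow> computable (\<lambda>v. vscale_budget b (f v))"
  unfolding vscale_budget_def by (intro computable_intros)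

lemma vscale_budget_enc_inst:
  "vscale_budget b (enc_inst I) = enc_inst (I\<lparr>budget := b * budget I\<rparr>)"
  by (simp add: vscale_budget_def enc_inst_def Let_def)

text \<open>\<open>L\<close> and \<open>s\<close> are the explicit instance and its strategy, which
  the solver stores together with \<open>T\<close> behind the stage-I code \<open>F\<close>. Since
  \<open>vdot e c\<close> is the stage-II cost of the extended strategy on the given scenario, the
  conditional is the truncation.\<close>

lemma decoder_exists:
  assumes "sample_free ext"
  shows "\<exists>dec. sample_free dec \<and> (\<forall>Q v F L s T a c e. runs Q ext (VPair L (VPair s (VPair a c))) e \<longrightarrow>
    runs Q dec (VPair v (VPair (VPair F (VPair (VPair L s) T)) (VPair a c)))
      (if vless T (vdot e c) = VNum 1 then vzero e else e))"
proof -
  have "computable (\<lambda>v. VPair (vfst (vfst (vsnd (vfst (vsnd v)))))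
      (VPair (vsnd (vfst (vsnd (vfst (vsnd v))))) (vsnd (vsnd v))))"
    by (intro computable_intros)
  then obtain arg where arg: "sample_free arg"
    "\<And>Q v. runs Q arg v (VPair (vfst (vfst (vsnd (vfst (vsnd v)))))
      (VPair (vsnd (vfst (vsnd (vfst (vsnd v))))) (vsnd (vsnd v))))"
    unfolding computable_def by blast
  have "computable (\<lambda>v. if vless (vsnd (vsnd (vfst (vsnd (vfst v))))) (vdot (vsnd v) (vsnd (vsnd (vsnd (vfst v))))) = VNum 1
      then vzero (vsnd v) else vsnd v)"
    by (intro computable_intros computable_vdot computable_vzero)
  then obtain fin where fin: "sample_free fin"
    "\<And>Q v. runs Q fin v (if vless (vsnd (vsnd (vfst (vsnd (vfst v))))) (vdot (vsnd v) (vsnd (vsnd (vsnd (vfst v))))) = VNum 1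
      then vzero (vsnd v) else vsnd v)"
    unfolding computable_def by blast
  define dec where "dec = Then (Both Skip (Then arg ext)) fin"
  have "runs Q dec (VPair v (VPair (VPair F (VPair (VPair L s) T)) (VPair a c)))
      (if vless T (vdot e c) = VNum 1 then vzero e else e)"
    if "runs Q ext (VPair L (VPair s (VPair a c))) e" for Q v F L s T a c e
  proof -
    let ?v = "VPair v (VPair (VPair F (VPair (VPair L s) T)) (VPair a c))"
    have "runs Q arg ?v (VPair L (VPair s (VPair a c)))" using arg(2)[of Q ?v] by simp
    then have "runs Q (Both Skip (Then arg ext)) ?v (VPair ?v e)"
      using that by (intro runs_Both runs_Skip runs_Then)
    then show ?thesis
      unfolding dec_def using fin(2)[of Q "VPair ?v e"] by (auto intro!: runs_Then)
  qed
  moreover have "sample_free dec" using arg fin assms by (simp add: dec_def)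
  ultimately show ?thesis by blast
qed

text \<open>A search as a fold: accumulators that satisfy \<open>IsP\<close> are absorbing. The
  conclusion forgets which success came first, since any success will do.\<close>

lemma foldl_first:
  assumes "\<And>a c. IsP a \<Longrightarrow> g a c = a"
    and "\<And>a c. c \<in> set cs \<Longrightarrow> \<not> IsP a \<Longrightarrow> g a c = (if ok c then h c else z)"
    and "\<And>c. c \<in> set cs \<Longrightarrow> ok c \<Longrightarrow> IsP (h c)" "\<not> IsP z"
  shows "(foldl g z cs = z \<and> (\<forall>c\<in>set cs. \<not> ok c)) \<or> (\<exists>c\<in>set cs. ok c \<and> foldl g z cs = h c)"
  using assms(2,3)
proof (induction cs)
  case (Cons c cs)
  show ?case
  proof (cases "ok c")
    case True
    then have "g z c = h c" "IsP (h c)" using Cons.prems assms(4) by auto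
    moreover have "foldl g a cs = a" if "IsP a" for a cs
      using that assms(1) by (induction cs) auto
    ultimately show ?thesis using True by auto
  next
    case False
    then have "g z c = z" using Cons.prems assms(4) by auto
    then show ?thesis using Cons False by auto
  qed
qed simp

abbreviation is_pair :: "val \<Rightarrow> bool" where
  "is_pair v \<equiv> apply_prim IsPair v = VNum 1"

text \<open>Nothing here refers to instances. \<open>h\<close> and \<open>e\<close> are arbitrary
  functions that record what \<open>alg\<close> and \<open>ext\<close> return, and they are
  constrained only on the calls that are made. A pair signals a strategy, as
  \<open>INFEASIBLE\<close> is \<open>VNil\<close>.\<close>

lemma solver_exists:
  assumes "sample_free alg" "sample_free ext"
  shows "\<exists>p. \<forall>Q v l h e.
    (let poly = (\<lambda>c. VPair (vscale_budget b (vfst v)) (vuniform c));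
         ok = (\<lambda>c. vless (vlength c) (vmul (VNum \<rho>) (vlength l)) \<noteq> VNum 1);
         cs = velems (vcands l) in
      (\<forall>c\<in>set cs. ok c \<longrightarrow> runs Q alg (poly c) (h c)) \<longrightarrow>
      (\<forall>c\<in>set cs. ok c \<longrightarrow> is_pair (h c) \<longrightarrow>
         (\<forall>A\<in>set (velems l). runs Q ext (VPair (poly c) (VPair (h c) A)) (e c A))) \<longrightarrow>
      runs Q p (VPair v l) VNil \<and> (\<forall>c\<in>set cs. ok c \<longrightarrow> \<not> is_pair (h c)) \<or>
      (\<exists>c\<in>set cs. ok c \<and> is_pair (h c) \<and>
         runs Q p (VPair v l) (VPair (vfst (h c)) (VPair (VPair (poly c) (h c))
           (vthreshold (vmul (VNum \<kappa>) (vlength l))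
             (foldl (\<lambda>a A. VPair (vdot (e c A) (vsnd A)) a) VNil (velems l)))))))"
proof -
  have "computable (\<lambda>u. VPair (vscale_budget b (vfst (vfst (vfst u)))) (vuniform (vsnd (vsnd u))))"
    by (intro computable_intros computable_vscale_budget computable_vuniform)
  then obtain pol where pol:
    "\<And>Q u. runs Q pol u (VPair (vscale_budget b (vfst (vfst (vfst u)))) (vuniform (vsnd (vsnd u))))"
    unfolding computable_def by blast
  have "computable (\<lambda>u. vless (vlength (vsnd (vsnd u))) (vmul (VNum \<rho>) (vlength (vsnd (vfst u)))))"
    by (intro computable_intros computable_vlength)
  then obtain len where len:
    "\<And>Q u. runs Q len u (vless (vlength (vsnd (vsnd u))) (vmul (VNum \<rho>) (vlength (vsnd (vfst u)))))"
    unfolding computable_def by blast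
  have "computable (\<lambda>u. vfst (vsnd u))" by (intro computable_intros)
  then obtain acc where acc: "\<And>Q u. runs Q acc u (vfst (vsnd u))"
    unfolding computable_def by blast
  have "computable (\<lambda>v. VPair v (VPair VNil (vcands (vsnd v))))"
    by (intro computable_intros computable_vcands)
  then obtain prep where prep: "\<And>Q v. runs Q prep v (VPair v (VPair VNil (vcands (vsnd v))))"
    unfolding computable_def by blast
  \<comment> \<open>An accumulator that is a pair marks an earlier success and is passed on
    unchanged; candidates that are too short are skipped before \<open>alg\<close> is
    called.\<close>
  define attempt where "attempt = Cond (Then acc (Prim IsPair)) acc (Cond len (Lit VNil)
    (Then pol (Then (Both Skip alg) (Cond (Then (Prim Snd) (Prim IsPair)) Skip (Lit VNil)))))"
  define search where "search = Both Skip (Then prep (fold_prog attempt))"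
  have "computable (\<lambda>u. VPair (vfst (vfst u)) (VPair (vsnd (vfst u)) (vsnd (vsnd u))))"
    by (intro computable_intros)
  then obtain arg where arg:
    "\<And>Q u. runs Q arg u (VPair (vfst (vfst u)) (VPair (vsnd (vfst u)) (vsnd (vsnd u))))"
    unfolding computable_def by blast
  have "computable (\<lambda>u. VPair (vdot (vsnd u) (vsnd (vsnd (vsnd (vfst u))))) (vfst (vsnd (vfst u))))"
    by (intro computable_intros computable_vdot)
  then obtain add where add:
    "\<And>Q u. runs Q add u (VPair (vdot (vsnd u) (vsnd (vsnd (vsnd (vfst u))))) (vfst (vsnd (vfst u))))"
    unfolding computable_def by blast
  have "computable (\<lambda>u. VPair (vsnd u) (VPair VNil (vsnd (vfst u))))"
    by (intro computable_intros)
  then obtain prep2 where prep2: "\<And>Q u. runs Q prep2 u (VPair (vsnd u) (VPair VNil (vsnd (vfst u))))"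
    unfolding computable_def by blast
  have "computable (\<lambda>w. VPair (vfst (vsnd (vsnd (vfst w)))) (VPair (vsnd (vfst w))
      (vthreshold (vmul (VNum \<kappa>) (vlength (vsnd (vfst (vfst w))))) (vsnd w))))"
    by (intro computable_intros computable_vthreshold computable_vlength)
  then obtain outp where outp:
    "\<And>Q w. runs Q outp w (VPair (vfst (vsnd (vsnd (vfst w)))) (VPair (vsnd (vfst w))
      (vthreshold (vmul (VNum \<kappa>) (vlength (vsnd (vfst (vfst w))))) (vsnd w))))"
    unfolding computable_def by blast
  define finish where "finish = Cond (Then (Prim Snd) (Prim IsPair))
    (Then (Both Skip (Then prep2 (fold_prog (Then (Both Skip (Then arg ext)) add)))) outp) (Lit VNil)"
  show ?thesis
  proof (intro exI[of _ "Then search finish"] allI, unfold Let_def, intro impI)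
    fix Q v l h e
    define poly where "poly = (\<lambda>c. VPair (vscale_budget b (vfst v)) (vuniform c))"
    define ok where "ok = (\<lambda>c. vless (vlength c) (vmul (VNum \<rho>) (vlength l)) \<noteq> VNum 1)"
    define cs where "cs = velems (vcands l)"
    assume "\<forall>c\<in>set (velems (vcands l)). vless (vlength c) (vmul (VNum \<rho>) (vlength l)) \<noteq> VNum 1 \<longrightarrow>
        runs Q alg (VPair (vscale_budget b (vfst v)) (vuniform c)) (h c)"
      and "\<forall>c\<in>set (velems (vcands l)). vless (vlength c) (vmul (VNum \<rho>) (vlength l)) \<noteq> VNum 1 \<longrightarrow>
         is_pair (h c) \<longrightarrow> (\<forall>A\<in>set (velems l).
           runs Q ext (VPair (VPair (vscale_budget b (vfst v)) (vuniform c)) (VPair (h c) A)) (e c A))"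
    then have alg: "\<And>c. c \<in> set cs \<Longrightarrow> ok c \<Longrightarrow> runs Q alg (poly c) (h c)"
      and ext: "\<And>c A. c \<in> set cs \<Longrightarrow> ok c \<Longrightarrow> is_pair (h c) \<Longrightarrow> A \<in> set (velems l) \<Longrightarrow>
         runs Q ext (VPair (poly c) (VPair (h c) A)) (e c A)"
      by (simp_all add: poly_def ok_def cs_def)
    define g where "g = (\<lambda>a c. if is_pair a then a else if ok c \<and> is_pair (h c) then VPair (poly c) (h c) else VNil)"
    have attempt: "runs Q attempt (VPair (VPair v l) (VPair a c)) (g a c)" if c: "c \<in> set cs" for a c
    proof -
      let ?u = "VPair (VPair v l) (VPair a c)"
      have 1: "runs Q acc ?u a" using acc[of Q ?u] by simp
      have 2: "runs Q len ?u (vless (vlength c) (vmul (VNum \<rho>) (vlength l)))"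
        using len[of Q ?u] by simp
      have 3: "runs Q pol ?u (poly c)" using pol[of Q ?u] by (simp add: poly_def)
      have 4: "runs Q (Then (Both Skip alg) (Cond (Then (Prim Snd) (Prim IsPair)) Skip (Lit VNil))) (poly c)
          (if is_pair (h c) then VPair (poly c) (h c) else VNil)" if "ok c"
      proof (rule runs_Then[OF runs_Both[OF runs_Skip alg[OF c that]]], rule runs_Cond)
        show "runs Q (Then (Prim Snd) (Prim IsPair)) (VPair (poly c) (h c)) (apply_prim IsPair (h c))"
          using runs_Then[OF runs_Prim runs_Prim, of Q Snd IsPair "VPair (poly c) (h c)"] by simp
      qed (auto intro: runs_Skip runs_Lit)
      show ?thesis
        unfolding attempt_def
      proof (rule runs_Cond[OF runs_Then[OF 1 runs_Prim]])
        assume "\<not> is_pair a"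
        show "runs Q (Cond len (Lit VNil) (Then pol (Then (Both Skip alg)
            (Cond (Then (Prim Snd) (Prim IsPair)) Skip (Lit VNil))))) ?u (g a c)"
        proof (rule runs_Cond[OF 2])
          assume "vless (vlength c) (vmul (VNum \<rho>) (vlength l)) = VNum 1"
          then have "g a c = VNil" using \<open>\<not> is_pair a\<close> by (simp add: g_def ok_def)
          then show "runs Q (Lit VNil) ?u (g a c)" by (simp add: runs_Lit)
        next
          assume "vless (vlength c) (vmul (VNum \<rho>) (vlength l)) \<noteq> VNum 1"
          then have "ok c" by (simp add: ok_def)
          then show "runs Q (Then pol (Then (Both Skip alg)
            (Cond (Then (Prim Snd) (Prim IsPair)) Skip (Lit VNil)))) ?u (g a c)"
            using runs_Then[OF 3 4] \<open>\<not> is_pair a\<close> by (simp add: g_def)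
        qed
      qed (use 1 in \<open>simp add: g_def\<close>)
    qed
    have "runs Q (fold_prog attempt) (VPair (VPair v l) (VPair VNil (vcands l))) (foldl g VNil cs)"
      unfolding cs_def by (rule runs_fold[where P = "\<lambda>_. True"]) (use attempt in \<open>auto simp: cs_def\<close>)
    then have search: "runs Q search (VPair v l) (VPair (VPair v l) (foldl g VNil cs))"
      unfolding search_def using prep[of Q "VPair v l"]
      by (intro runs_Both runs_Skip) (auto intro: runs_Then)
    have "(foldl g VNil cs = VNil \<and> (\<forall>c\<in>set cs. \<not> (ok c \<and> is_pair (h c)))) \<or>
        (\<exists>c\<in>set cs. (ok c \<and> is_pair (h c)) \<and> foldl g VNil cs = VPair (poly c) (h c))"
      by (rule foldl_first[where IsP = is_pair]) (auto simp: g_def vbool_def)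
    then have "runs Q (Then search finish) (VPair v l) VNil \<and> (\<forall>c\<in>set cs. ok c \<longrightarrow> \<not> is_pair (h c)) \<or>
      (\<exists>c\<in>set cs. ok c \<and> is_pair (h c) \<and>
         runs Q (Then search finish) (VPair v l) (VPair (vfst (h c)) (VPair (VPair (poly c) (h c))
           (vthreshold (vmul (VNum \<kappa>) (vlength l))
             (foldl (\<lambda>a A. VPair (vdot (e c A) (vsnd A)) a) VNil (velems l))))))"
    proof
      assume *: "foldl g VNil cs = VNil \<and> (\<forall>c\<in>set cs. \<not> (ok c \<and> is_pair (h c)))"
      have "runs Q (Then (Prim Snd) (Prim IsPair)) (VPair (VPair v l) VNil) (vbool False)"
        using runs_Then[OF runs_Prim runs_Prim, of Q Snd IsPair "VPair (VPair v l) VNil"] by simp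
      then have "runs Q finish (VPair (VPair v l) VNil) VNil"
        unfolding finish_def by (rule runs_Cond) (auto intro: runs_Lit)
      then show ?thesis using * search by (auto intro: runs_Then)
    next
      assume "\<exists>c\<in>set cs. (ok c \<and> is_pair (h c)) \<and> foldl g VNil cs = VPair (poly c) (h c)"
      then obtain c where c: "c \<in> set cs" "ok c" "is_pair (h c)" "foldl g VNil cs = VPair (poly c) (h c)"
        by blast
      let ?f = "VPair (poly c) (h c)"
      let ?s = "VPair (VPair v l) ?f"
      have "runs Q (Then (Both Skip (Then arg ext)) add) (VPair ?f (VPair a A)) (VPair (vdot (e c A) (vsnd A)) a)"
        if "A \<in> set (velems l)" for a A
      proof -
        have "runs Q arg (VPair ?f (VPair a A)) (VPair (poly c) (VPair (h c) A))"
          using arg[of Q "VPair ?f (VPair a A)"] by simp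
        then have "runs Q (Both Skip (Then arg ext)) (VPair ?f (VPair a A)) (VPair (VPair ?f (VPair a A)) (e c A))"
          using ext[OF c(1-3) that] by (intro runs_Both runs_Skip runs_Then)
        then show ?thesis
          using add[of Q "VPair (VPair ?f (VPair a A)) (e c A)"] by (auto intro: runs_Then)
      qed
      then have 1: "runs Q (fold_prog (Then (Both Skip (Then arg ext)) add)) (VPair ?f (VPair VNil l))
          (foldl (\<lambda>a A. VPair (vdot (e c A) (vsnd A)) a) VNil (velems l))" (is "runs _ _ _ ?c")
        by (intro runs_fold[where P = "\<lambda>_. True"]) auto
      have 2: "runs Q prep2 ?s (VPair ?f (VPair VNil l))" using prep2[of Q ?s] by simp
      have 3: "runs Q outp (VPair ?s ?c) (VPair (vfst (h c)) (VPair ?f (vthreshold (vmul (VNum \<kappa>) (vlength l)) ?c)))"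
        using outp[of Q "VPair ?s ?c"] by simp
      have 4: "runs Q (Then (Prim Snd) (Prim IsPair)) ?s (vbool True)"
        using runs_Then[OF runs_Prim runs_Prim, of Q Snd IsPair ?s] by simp
      have "runs Q finish ?s (VPair (vfst (h c)) (VPair ?f (vthreshold (vmul (VNum \<kappa>) (vlength l)) ?c)))"
        unfolding finish_def
        by (rule runs_Cond[OF 4]) (auto intro: runs_Then[OF runs_Both[OF runs_Skip runs_Then[OF 2 1]] 3])
      then show ?thesis using c search by (auto intro: runs_Then)
    qed
    then show "runs Q (Then search finish) (VPair v l) VNil \<and>
        (\<forall>c\<in>set (velems (vcands l)). vless (vlength c) (vmul (VNum \<rho>) (vlength l)) \<noteq> VNum 1 \<longrightarrow> \<not> is_pair (h c)) \<or>
      (\<exists>c\<in>set (velems (vcands l)). vless (vlength c) (vmul (VNum \<rho>) (vlength l)) \<noteq> VNum 1 \<and> is_pair (h c) \<and>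
         runs Q (Then search finish) (VPair v l) (VPair (vfst (h c))
           (VPair (VPair (VPair (vscale_budget b (vfst v)) (vuniform c)) (h c))
             (vthreshold (vmul (VNum \<kappa>) (vlength l))
               (foldl (\<lambda>a A. VPair (vdot (e c A) (vsnd A)) a) VNil (velems l))))))"
      by (simp add: poly_def ok_def cs_def)
  qed
qed

section \<open>The solver on encoded instances\<close>

text \<open>Relaxing the budget keeps the oracle and the codes of scenarios. Thus \<open>alg\<close>
  and \<open>ext\<close> can work on the relaxed instance while their queries are answered for the
  original one.\<close>

lemma budget_update_simps [simp]:
  "enc_scenario (I\<lparr>budget := b\<rparr>) = enc_scenario I"
  "allowed (I\<lparr>budget := b\<rparr>) = allowed I"
  "allowed_query (I\<lparr>budget := b\<rparr>) = allowed_query I"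
  "scenarios (I\<lparr>budget := b\<rparr>) = scenarios I"
  "cost (I\<lparr>budget := b\<rparr>) = cost I"
  "stage1_cost (I\<lparr>budget := b\<rparr>) = stage1_cost I"
  "dist_to (I\<lparr>budget := b\<rparr>) = dist_to I"
  "maxdist (I\<lparr>budget := b\<rparr>) = maxdist I"
  "is_strategy (I\<lparr>budget := b\<rparr>) = is_strategy I"
  by (auto simp: fun_eq_iff enc_scenario_def allowed_def allowed_query_def scenarios_def cost_def
      stage1_cost_def dist_to_def maxdist_def is_strategy_def)

lemma valid_inst_budget_update: "valid_inst P I \<Longrightarrow> 0 \<le> b \<Longrightarrow> valid_inst P (I\<lparr>budget := b\<rparr>)"
  by (simp add: valid_inst_def)

lemma allowed_subset: "valid_inst P I \<Longrightarrow> X \<in> allowed I \<Longrightarrow> X \<subseteq> facilities I"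
  unfolding valid_inst_def allowed_def
  by (cases P; cases "constr I") (auto simp: matroid_on_def)

text \<open>The reversal mirrors \<open>vuniform\<close>, which builds its result by adding entries
  in front.\<close>

definition uniform_list :: "'a list \<Rightarrow> ('a \<times> real) list" where
  "uniform_list c = map (\<lambda>A. (A, 1 / real (length c))) (rev c)"

lemma uniform_list_simps [simp]:
  "map fst (uniform_list c) = rev c" "fst ` set (uniform_list c) = set c"
  by (force simp: uniform_list_def comp_def)+

lemma uniform_list_wf: "c \<noteq> [] \<Longrightarrow> pmf_of_list_wf (uniform_list c)"
  by (auto simp: pmf_of_list_wf_def uniform_list_def comp_def sum_list_triv)

lemma poly_list_uniform_list:
  "c \<noteq> [] \<Longrightarrow> distinct c \<Longrightarrow> set c \<subseteq> scenarios I \<Longrightarrow> poly_list I (uniform_list c)"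
  using uniform_list_wf[of c] by (auto simp: poly_list_def) (auto simp: uniform_list_def)

lemma pmf_of_list_uniform_list:
  fixes c :: "'a list"
  assumes "c \<noteq> []" "distinct c"
  shows "pmf_of_list (uniform_list c) = pmf_of_set (set c)"
proof (rule pmf_eqI)
  fix x
  have "sum_list (map snd (filter (\<lambda>z. fst z = x) (map (\<lambda>A. (A, u)) ys))) = (if x \<in> set ys then u else 0)"
    if "distinct ys" for u :: real and ys :: "'a list"
    using that by (induction ys) auto
  from this[of "rev c"] show "pmf (pmf_of_list (uniform_list c)) x = pmf (pmf_of_set (set c)) x"
    using assms by (subst pmf_pmf_of_list[OF uniform_list_wf])
      (simp_all add: uniform_list_def distinct_card indicator_def)
qed

lemma within_budget_uniform_list:
  assumes "c \<noteq> []" "distinct c"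
  shows "within_budget I (measure_pmf (pmf_of_list (uniform_list c))) s \<longleftrightarrow>
    (\<Sum>A\<in>set c. cost I s A) \<le> budget I * real (length c)"
  using assms
  by (simp add: within_budget_def pmf_of_list_uniform_list integral_pmf_of_set distinct_card
      integrable_measure_pmf_finite divide_le_eq)

lemma enc_poly_uniform_list:
  "VPair (vscale_budget b (enc_inst I)) (vuniform (vlist (map (enc_scenario I) c))) =
   enc_poly (I\<lparr>budget := b * budget I\<rparr>) (uniform_list c)"
  by (simp add: enc_poly_def vscale_budget_enc_inst vuniform_vlist uniform_list_def rev_map comp_def)

lemma vdot_enc_scenario:
  assumes "finite (facilities I)" "snd s A \<subseteq> facilities I"
  shows "vdot (enc_subset (facilities I) (snd s A)) (vsnd (enc_scenario I A)) = VNum (stage2_cost s A)"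
proof -
  let ?F = "sorted_list_of_set (facilities I)"
  have "vdot (enc_subset (facilities I) (snd s A)) (vsnd (enc_scenario I A)) =
      VNum (\<Sum>(x, y)\<leftarrow>zip (map (\<lambda>i. if i \<in> snd s A then 1 else 0) ?F) (map (snd A) ?F). x * y)"
    unfolding enc_subset_VNum enc_scenario_def enc_on_VNum
    by (simp add: vdot_vlist del: map_map)
  also have "\<dots> = VNum (\<Sum>i\<leftarrow>?F. (if i \<in> snd s A then 1 else 0) * snd A i)"
    by (simp add: zip_map_map zip_same_conv_map comp_def)
  also have "(\<Sum>i\<leftarrow>?F. (if i \<in> snd s A then 1 else 0) * snd A i) =
      (\<Sum>i\<in>facilities I. (if i \<in> snd s A then 1 else 0) * snd A i)"
    using assms(1) by (subst sum_list_distinct_conv_sum_set) auto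
  also have "\<dots> = (\<Sum>i\<in>snd s A. snd A i)"
    using assms by (intro sum.mono_neutral_cong_right) auto
  finally show ?thesis by (simp add: stage2_cost_def)
qed

lemma vzero_enc_subset: "vzero (enc_subset X Y) = enc_subset X {}"
  by (simp add: enc_subset_def enc_on_def vbool_def map_replicate_const)

lemma inj_on_enc_scenario:
  assumes "finite (clients I)" "finite (facilities I)"
  shows "inj_on (enc_scenario I) (scenarios I)"
proof (rule inj_onI)
  fix A B assume AB: "A \<in> scenarios I" "B \<in> scenarios I" "enc_scenario I A = enc_scenario I B"
  \<comment> \<open>Membership in a one-element list is decided from codes alone, so equal codes
    give equal answers.\<close>
  have "vbool (A \<in> set [B]) = velem (enc_scenario I A) (vlist (map (enc_scenario I) [B]))"
    using AB by (intro velem_enc_scenario[OF assms, symmetric]) auto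
  also have "\<dots> = velem (enc_scenario I B) (vlist (map (enc_scenario I) [B]))" using AB by simp
  also have "\<dots> = vbool (B \<in> set [B])"
    using AB by (intro velem_enc_scenario[OF assms]) auto
  finally show "A = B" by (auto simp: vbool_def split: if_splits)
qed

text \<open>The interface between programs and probability: what holds of a result once the samples
  are fixed, without mention of how the search was executed. It is a relation, since the successful
  candidate and its extension are not determined. The reversed cost list is the order in which the
  program collects the costs.\<close>

definition solver_spec ::
  "prog \<Rightarrow> prog \<Rightarrow> real \<Rightarrow> inst \<Rightarrow> scenario set \<Rightarrow> real \<Rightarrow> real \<Rightarrow> scenario list \<Rightarrow> val \<Rightarrow> bool" where
  "solver_spec alg ext \<eta> I \<Omega> \<rho> \<kappa> xs res \<longleftrightarrow>
     (res = INFEASIBLE \<and> (\<forall>c\<in>set (candidates xs). \<rho> * length xs \<le> length c \<longrightarrow>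
        \<not> feasible I (measure_pmf (pmf_of_list (uniform_list c))) (set c))) \<or>
     (\<exists>c\<in>set (candidates xs). \<exists>s s'. \<rho> * length xs \<le> length c \<and>
        fst s \<in> allowed I \<and> returns alg I (uniform_list c) s \<and>
        within_budget I (measure_pmf (pmf_of_list (uniform_list c))) s \<and>
        extends_to ext I \<Omega> (uniform_list c) s s' \<and>
        (\<forall>A\<in>\<Omega>. maxdist I s' A \<le> ereal \<eta>) \<and> (\<forall>A\<in>set c. snd s' A = snd s A) \<and>
        res = VPair (enc_subset (facilities I) (fst s))
          (VPair (VPair (enc_poly I (uniform_list c)) (enc_strategy I (uniform_list c) s))
            (VNum (threshold (\<kappa> * length xs) (rev (map (stage2_cost s') xs))))))"

lemma approximation_algorithm_run:
  assumes "approximation_algorithm P alg \<eta>" "valid_inst P I" "poly_list I L"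
  shows "\<exists>out. runs (allowed_query I) alg (enc_poly I L) out \<and>
     (if is_pair out then \<exists>s. out = enc_strategy I L s \<and> fst s \<in> allowed I \<and> returns alg I L s \<and>
        within_budget I (measure_pmf (pmf_of_list L)) s
      else \<not> feasible I (measure_pmf (pmf_of_list L)) (set (map fst L)))"
proof -
  let ?D = "measure_pmf (pmf_of_list L)" and ?\<Omega> = "set (map fst L)"
  have sf: "sample_free alg" using assms(1) by (simp add: approximation_algorithm_def)
  obtain out t where out: "run (allowed_query I) alg (enc_poly I L) out t"
    and "(out = INFEASIBLE \<and> \<not> feasible I ?D ?\<Omega>) \<or>
      (\<exists>s. out = enc_strategy I L s \<and> is_strategy I ?D ?\<Omega> s \<and> within_budget I ?D s \<and>
           (\<forall>A\<in>?\<Omega>. maxdist I s A \<le> ereal \<eta>))"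
    using assms unfolding approximation_algorithm_def Let_def by meson
  then show ?thesis
  proof (elim disjE exE conjE)
    assume "out = INFEASIBLE" "\<not> feasible I ?D ?\<Omega>"
    then show ?thesis using run_imp_runs[OF out sf] by (auto simp: vbool_def)
  next
    fix s assume s: "out = enc_strategy I L s" "is_strategy I ?D ?\<Omega> s" "within_budget I ?D s"
    then have "returns alg I L s" "fst s \<in> allowed I"
      using out allowed_subset[OF assms(2)] by (auto simp: returns_def is_strategy_def)
    moreover have pair: "is_pair out" using s by (simp add: enc_strategy_def vbool_def)
    ultimately show ?thesis
      using run_imp_runs[OF out sf] s by (intro exI[of _ out], unfold if_P[OF pair], blast)
  qed
qed

lemma efficiently_generalizable_extends:
  assumes "efficiently_generalizable P alg ext \<eta> \<psi>" "valid_inst P I" "\<Omega> \<subseteq> scenarios I"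
    "poly_list I L" "set (map fst L) \<subseteq> \<Omega>" "returns alg I L s"
  shows "\<exists>s'. extends_to ext I \<Omega> L s s' \<and> (\<forall>A\<in>\<Omega>. maxdist I s' A \<le> ereal \<eta>) \<and>
    (\<forall>A\<in>set (map fst L). snd s' A = snd s A)"
proof -
  obtain c e where "\<forall>I \<Omega> L s. valid_inst P I \<longrightarrow> \<Omega> \<subseteq> scenarios I \<longrightarrow>
        poly_list I L \<longrightarrow> set (map fst L) \<subseteq> \<Omega> \<longrightarrow> returns alg I L s \<longrightarrow>
        (\<exists>s'. extends_to ext I \<Omega> L s s' \<and>
              (\<forall>A\<in>\<Omega>. \<exists>t. run (allowed_query I) ext (enc_extension I L s A)
                              (enc_subset (facilities I) (snd s' A)) t \<and>
                           poly_time c e I (enc_extension I L s A) t) \<and>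
              (\<forall>A\<in>\<Omega>. maxdist I s' A \<le> ereal \<eta>) \<and>
              (\<forall>A\<in>set (map fst L). snd s' A = snd s A))"
    using assms(1) unfolding efficiently_generalizable_def by (elim conjE exE)
  from this[rule_format, OF assms(2-6)] show ?thesis by blast
qed

text \<open>Feeds the guarantees of \<open>alg\<close> and \<open>ext\<close> for the relaxed
  instance into the abstract search. The outcome is chosen separately for each candidate, and
  different candidates need not be related.\<close>

lemma bb_solver_exists:
  assumes alg: "approximation_algorithm P alg \<eta>" and gen: "efficiently_generalizable P alg ext \<eta> \<psi>"
    and b: "0 \<le> b" and \<rho>: "0 < \<rho>"
  shows "\<exists>p. \<forall>I \<Omega> xs qv. valid_inst P I \<longrightarrow> \<Omega> \<subseteq> scenarios I \<longrightarrow> set xs \<subseteq> \<Omega> \<longrightarrow> xs \<noteq> [] \<longrightarrow>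
    (\<exists>res. runs (allowed_query I) p (VPair (VPair (enc_inst I) qv) (vlist (map (enc_scenario I) xs))) res \<and>
      solver_spec alg ext \<eta> (I\<lparr>budget := b * budget I\<rparr>) \<Omega> \<rho> \<kappa> xs res)"
proof -
  have sf: "sample_free alg" "sample_free ext"
    using alg gen by (simp_all add: approximation_algorithm_def efficiently_generalizable_def)
  obtain p where p: "\<And>Q v l h e.
    (let poly = (\<lambda>c. VPair (vscale_budget b (vfst v)) (vuniform c));
         ok = (\<lambda>c. vless (vlength c) (vmul (VNum \<rho>) (vlength l)) \<noteq> VNum 1);
         cs = velems (vcands l) in
      (\<forall>c\<in>set cs. ok c \<longrightarrow> runs Q alg (poly c) (h c)) \<longrightarrow>
      (\<forall>c\<in>set cs. ok c \<longrightarrow> is_pair (h c) \<longrightarrow>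
         (\<forall>A\<in>set (velems l). runs Q ext (VPair (poly c) (VPair (h c) A)) (e c A))) \<longrightarrow>
      runs Q p (VPair v l) VNil \<and> (\<forall>c\<in>set cs. ok c \<longrightarrow> \<not> is_pair (h c)) \<or>
      (\<exists>c\<in>set cs. ok c \<and> is_pair (h c) \<and>
         runs Q p (VPair v l) (VPair (vfst (h c)) (VPair (VPair (poly c) (h c))
           (vthreshold (vmul (VNum \<kappa>) (vlength l))
             (foldl (\<lambda>a A. VPair (vdot (e c A) (vsnd A)) a) VNil (velems l)))))))"
    using solver_exists[OF sf, of b \<rho> \<kappa>] by blast
  show ?thesis
  proof (intro exI[of _ p] allI impI)
    fix I \<Omega> xs qv
    assume I: "valid_inst P I" and \<Omega>: "\<Omega> \<subseteq> scenarios I" "set xs \<subseteq> \<Omega>" and "xs \<noteq> []"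
    define I' where "I' = I\<lparr>budget := b * budget I\<rparr>"
    have fin: "finite (clients I)" "finite (facilities I)" using I by (simp_all add: valid_inst_def)
    have I': "valid_inst P I'"
      unfolding I'_def using I b by (intro valid_inst_budget_update) (auto simp: valid_inst_def)
    let ?Q = "allowed_query I"
    have aq: "allowed_query I' = ?Q" by (simp add: I'_def)
    define ev where "ev c = vlist (map (enc_scenario I) c)" for c
    define C where "C = {c \<in> set (candidates xs). \<rho> * length xs \<le> length c}"
    have C: "c \<noteq> [] \<and> distinct c \<and> set c \<subseteq> set xs \<and> set c \<subseteq> \<Omega> \<and> poly_list I' (uniform_list c)" if "c \<in> C" for c
    proof -
      \<comment> \<open>A uniform distribution needs a nonempty candidate; this is where 0 < \<rho>
        enters.\<close>
      have "c \<noteq> []" using that \<rho> \<open>xs \<noteq> []\<close> by (auto simp: C_def mult_le_0_iff)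
      moreover have "distinct c" "set c \<subseteq> set xs" using that candidates_sound by (auto simp: C_def)
      moreover from this have "set c \<subseteq> \<Omega>" "set c \<subseteq> scenarios I'"
        using \<Omega> by (auto simp: I'_def)
      ultimately show ?thesis
        using poly_list_uniform_list by blast
    qed
    have inj: "inj_on ev (set (candidates xs))"
    proof (rule inj_onI)
      fix c d assume cd: "c \<in> set (candidates xs)" "d \<in> set (candidates xs)" "ev c = ev d"
      then have "set c \<union> set d \<subseteq> scenarios I" using candidates_sound \<Omega> by blast
      moreover have "map (enc_scenario I) c = map (enc_scenario I) d"
        using cd(3) velems_vlist unfolding ev_def by metis
      ultimately show "c = d"
        using inj_on_map_eq_map[of "enc_scenario I" c d] inj_on_enc_scenario[OF fin]
        by (meson inj_on_subset)
    qed
    have cands: "velems (vcands (vlist (map (enc_scenario I) xs))) = map ev (candidates xs)"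
      using vcands_enc_scenario[OF fin, of xs] \<Omega> by (simp add: ev_def)
    have ok: "vless (vlength (ev c)) (vmul (VNum \<rho>) (vlength (vlist (map (enc_scenario I) xs)))) \<noteq> VNum 1
        \<longleftrightarrow> \<rho> * length xs \<le> length c" for c
      by (simp add: ev_def not_less)
    have poly: "VPair (vscale_budget b (vfst (VPair (enc_inst I) qv))) (vuniform (ev c)) =
        enc_poly I' (uniform_list c)" for c
      using enc_poly_uniform_list[of b I c] by (simp add: ev_def I'_def)
    have "\<exists>out s s'. runs ?Q alg (enc_poly I' (uniform_list c)) out \<and>
       (if is_pair out then out = enc_strategy I' (uniform_list c) s \<and> fst s \<in> allowed I' \<and>
          returns alg I' (uniform_list c) s \<and> within_budget I' (measure_pmf (pmf_of_list (uniform_list c))) s \<and>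
          extends_to ext I' \<Omega> (uniform_list c) s s' \<and>
          (\<forall>A\<in>\<Omega>. maxdist I' s' A \<le> ereal \<eta>) \<and> (\<forall>A\<in>set c. snd s' A = snd s A)
        else \<not> feasible I' (measure_pmf (pmf_of_list (uniform_list c))) (set c))" if c: "c \<in> C" for c
    proof -
      let ?L = "uniform_list c"
      obtain out where out: "runs ?Q alg (enc_poly I' ?L) out"
        "if is_pair out then \<exists>s. out = enc_strategy I' ?L s \<and> fst s \<in> allowed I' \<and> returns alg I' ?L s \<and>
            within_budget I' (measure_pmf (pmf_of_list ?L)) s
          else \<not> feasible I' (measure_pmf (pmf_of_list ?L)) (set c)"
        using approximation_algorithm_run[OF alg I', of ?L, unfolded uniform_list_simps set_rev aq] C[OF c]
        by blast
      show ?thesis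
      proof (cases "is_pair out")
        case True
        then obtain s where s: "out = enc_strategy I' ?L s" "fst s \<in> allowed I'" "returns alg I' ?L s"
          "within_budget I' (measure_pmf (pmf_of_list ?L)) s"
          using out by auto
        have "\<exists>s'. extends_to ext I' \<Omega> ?L s s' \<and> (\<forall>A\<in>\<Omega>. maxdist I' s' A \<le> ereal \<eta>) \<and>
              (\<forall>A\<in>set (map fst ?L). snd s' A = snd s A)"
          using efficiently_generalizable_extends[OF gen I' _ _ _ s(3), of \<Omega>] C[OF c] \<Omega>
          by (simp add: I'_def)
        then obtain s' where "extends_to ext I' \<Omega> ?L s s'" "\<forall>A\<in>\<Omega>. maxdist I' s' A \<le> ereal \<eta>"
          "\<forall>A\<in>set c. snd s' A = snd s A"
          by auto
        then show ?thesis
          using out(1) s by (intro exI[of _ out] exI[of _ s] exI[of _ s'], unfold if_P[OF True], blast)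
      next
        case False
        then show ?thesis using out by (intro exI[of _ out], unfold if_not_P[OF False], blast)
      qed
    qed
    then obtain out st st' where out: "\<And>c. c \<in> C \<Longrightarrow> runs ?Q alg (enc_poly I' (uniform_list c)) (out c)"
      and pair: "\<And>c. c \<in> C \<Longrightarrow> is_pair (out c) \<Longrightarrow> out c = enc_strategy I' (uniform_list c) (st c) \<and>
          fst (st c) \<in> allowed I' \<and> returns alg I' (uniform_list c) (st c) \<and>
          within_budget I' (measure_pmf (pmf_of_list (uniform_list c))) (st c) \<and>
          extends_to ext I' \<Omega> (uniform_list c) (st c) (st' c) \<and>
          (\<forall>A\<in>\<Omega>. maxdist I' (st' c) A \<le> ereal \<eta>) \<and> (\<forall>A\<in>set c. snd (st' c) A = snd (st c) A)"
      and nopair: "\<And>c. c \<in> C \<Longrightarrow> \<not> is_pair (out c) \<Longrightarrow>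
        \<not> feasible I' (measure_pmf (pmf_of_list (uniform_list c))) (set c)"
      by metis
    \<comment> \<open>\<open>solver_exists\<close> expects functions of codes. Inverting the two
      injective encodings turns the choices made for candidates and scenarios into such
      functions.\<close>
    define dv where "dv = inv_into (set (candidates xs)) ev"
    have dv: "dv (ev c) = c" if "c \<in> C" for c
      using inj that by (simp add: dv_def C_def)
    define dA where "dA = inv_into (scenarios I) (enc_scenario I)"
    have dA: "dA (enc_scenario I A) = A" if "A \<in> \<Omega>" for A
      using inj_on_enc_scenario[OF fin] that \<Omega> by (auto simp: dA_def)
    define e where "e v a = enc_subset (facilities I) (snd (st' (dv v)) (dA a))" for v a
    have ext: "runs ?Q ext (VPair (enc_poly I' (uniform_list c)) (VPair (out c) (enc_scenario I A)))
        (e (ev c) (enc_scenario I A))" if "c \<in> C" "is_pair (out c)" "A \<in> \<Omega>" for c A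
      using pair[OF that(1,2)] that(3) run_imp_runs[OF _ sf(2)]
      by (auto simp: extends_to_def enc_extension_def e_def dv[OF that(1)] dA[OF that(3)] I'_def)
    let ?l = "vlist (map (enc_scenario I) xs)"
    have "runs ?Q p (VPair (VPair (enc_inst I) qv) ?l) VNil \<and> (\<forall>c\<in>C. \<not> is_pair (out c)) \<or>
      (\<exists>c\<in>C. is_pair (out c) \<and>
         runs ?Q p (VPair (VPair (enc_inst I) qv) ?l) (VPair (vfst (out c)) (VPair (VPair (enc_poly I' (uniform_list c)) (out c))
           (vthreshold (vmul (VNum \<kappa>) (vlength ?l))
             (foldl (\<lambda>a A. VPair (vdot (e (ev c) A) (vsnd A)) a) VNil (map (enc_scenario I) xs))))))"
    proof -
      have 1: "\<forall>c\<in>set (map ev (candidates xs)).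
          vless (vlength c) (vmul (VNum \<rho>) (vlength ?l)) \<noteq> VNum 1 \<longrightarrow>
          runs ?Q alg (VPair (vscale_budget b (vfst (VPair (enc_inst I) qv))) (vuniform c)) (out (dv c))"
      proof (intro ballI impI)
        fix v assume v: "v \<in> set (map ev (candidates xs))"
          "vless (vlength v) (vmul (VNum \<rho>) (vlength ?l)) \<noteq> VNum 1"
        then obtain c where "v = ev c" "c \<in> C" using ok unfolding C_def by auto
        then show "runs ?Q alg (VPair (vscale_budget b (vfst (VPair (enc_inst I) qv))) (vuniform v)) (out (dv v))"
          using out dv poly by metis
      qed
      have 2: "\<forall>c\<in>set (map ev (candidates xs)).
          vless (vlength c) (vmul (VNum \<rho>) (vlength ?l)) \<noteq> VNum 1 \<longrightarrow> is_pair (out (dv c)) \<longrightarrow>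
          (\<forall>A\<in>set (velems ?l).
          runs ?Q ext (VPair (VPair (vscale_budget b (vfst (VPair (enc_inst I) qv))) (vuniform c))
            (VPair (out (dv c)) A)) (e c A))"
      proof (intro ballI impI)
        fix v a assume v: "v \<in> set (map ev (candidates xs))"
          "vless (vlength v) (vmul (VNum \<rho>) (vlength ?l)) \<noteq> VNum 1" "is_pair (out (dv v))"
          and a: "a \<in> set (velems ?l)"
        obtain c where c: "v = ev c" "c \<in> C" using v(1,2) ok unfolding C_def by auto
        obtain A where A: "a = enc_scenario I A" "A \<in> \<Omega>" using a \<Omega>(2) by auto
        show "runs ?Q ext (VPair (VPair (vscale_budget b (vfst (VPair (enc_inst I) qv))) (vuniform v))
            (VPair (out (dv v)) a)) (e v a)"
          using ext[OF c(2) _ A(2)] v(3) unfolding A(1) c(1) poly dv[OF c(2)] by blast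
      qed
      show ?thesis
        using p[of "VPair (enc_inst I) qv" ?l ?Q "\<lambda>c. out (dv c)" e, unfolded Let_def cands,
            THEN mp, OF 1, THEN mp, OF 2]
      proof (elim disjE conjE bexE)
        assume run: "runs ?Q p (VPair (VPair (enc_inst I) qv) ?l) VNil"
          and no: "\<forall>v\<in>set (map ev (candidates xs)).
            vless (vlength v) (vmul (VNum \<rho>) (vlength ?l)) \<noteq> VNum 1 \<longrightarrow> \<not> is_pair (out (dv v))"
        have "\<not> is_pair (out c)" if "c \<in> C" for c
          using no dv[OF that] that ok[of c] unfolding C_def by (metis (no_types, lifting) imageI list.set_map mem_Collect_eq)
        with run show ?thesis by blast
      next
        fix v assume v: "v \<in> set (map ev (candidates xs))"
            "vless (vlength v) (vmul (VNum \<rho>) (vlength ?l)) \<noteq> VNum 1" "is_pair (out (dv v))"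
          and run: "runs ?Q p (VPair (VPair (enc_inst I) qv) ?l) (VPair (vfst (out (dv v)))
            (VPair (VPair (VPair (vscale_budget b (vfst (VPair (enc_inst I) qv))) (vuniform v)) (out (dv v)))
             (vthreshold (vmul (VNum \<kappa>) (vlength ?l))
               (foldl (\<lambda>a A. VPair (vdot (e v A) (vsnd A)) a) VNil (velems ?l)))))"
        obtain c where c: "v = ev c" "c \<in> C" using v(1,2) ok unfolding C_def by auto
        show ?thesis
          using run v(3) c(2) unfolding c(1) poly dv[OF c(2)] velems_vlist by blast
      qed
    qed
    then show "\<exists>res. runs ?Q p (VPair (VPair (enc_inst I) qv) ?l) res \<and>
        solver_spec alg ext \<eta> (I\<lparr>budget := b * budget I\<rparr>) \<Omega> \<rho> \<kappa> xs res"
    proof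
      assume "runs ?Q p (VPair (VPair (enc_inst I) qv) ?l) VNil \<and> (\<forall>c\<in>C. \<not> is_pair (out c))"
      then show ?thesis
        using nopair by (intro exI[of _ VNil]) (auto simp: solver_spec_def I'_def[symmetric] C_def)
    next
      assume "\<exists>c\<in>C. is_pair (out c) \<and>
         runs ?Q p (VPair (VPair (enc_inst I) qv) ?l) (VPair (vfst (out c)) (VPair (VPair (enc_poly I' (uniform_list c)) (out c))
           (vthreshold (vmul (VNum \<kappa>) (vlength ?l))
             (foldl (\<lambda>a A. VPair (vdot (e (ev c) A) (vsnd A)) a) VNil (map (enc_scenario I) xs)))))"
      then obtain c where c: "c \<in> C" "is_pair (out c)"
        and run: "runs ?Q p (VPair (VPair (enc_inst I) qv) ?l) (VPair (vfst (out c)) (VPair (VPair (enc_poly I' (uniform_list c)) (out c))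
           (vthreshold (vmul (VNum \<kappa>) (vlength ?l))
             (foldl (\<lambda>a A. VPair (vdot (e (ev c) A) (vsnd A)) a) VNil (map (enc_scenario I) xs)))))"
        by blast
      note pr = pair[OF c]
      have sub: "snd (st' c) A \<subseteq> facilities I" if "A \<in> \<Omega>" for A
        using pr that by (auto simp: extends_to_def I'_def)
      have "foldl (\<lambda>a A. VPair (vdot (e (ev c) A) (vsnd A)) a) (vlist (map VNum ys)) (map (enc_scenario I) zs) =
          vlist (map VNum (rev (map (stage2_cost (st' c)) zs) @ ys))" if "set zs \<subseteq> \<Omega>" for zs ys
        using that
      proof (induction zs arbitrary: ys)
        case (Cons A zs)
        then have "vdot (e (ev c) (enc_scenario I A)) (vsnd (enc_scenario I A)) = VNum (stage2_cost (st' c) A)"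
          using sub by (simp add: e_def dv[OF c(1)] dA vdot_enc_scenario[OF fin(2)])
        then show ?case using Cons.IH[of "stage2_cost (st' c) A # ys"] Cons.prems by simp
      qed simp
      from this[of xs "[]"] have "foldl (\<lambda>a A. VPair (vdot (e (ev c) A) (vsnd A)) a) VNil (map (enc_scenario I) xs) =
          vlist (map VNum (rev (map (stage2_cost (st' c)) xs)))"
        using \<Omega> by simp
      moreover have "vfst (out c) = enc_subset (facilities I') (fst (st c))"
        using pr by (simp add: enc_strategy_def)
      ultimately have "runs ?Q p (VPair (VPair (enc_inst I) qv) ?l)
        (VPair (enc_subset (facilities I') (fst (st c)))
          (VPair (VPair (enc_poly I' (uniform_list c)) (enc_strategy I' (uniform_list c) (st c)))
            (VNum (threshold (\<kappa> * length xs) (rev (map (stage2_cost (st' c)) xs))))))"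
        using run pr by (simp add: vthreshold_vlist del: map_map map_append rev_map)
      then show ?thesis
        using pr c(1) unfolding solver_spec_def I'_def[symmetric] C_def by blast
    qed
  qed
qed

section \<open>Sums of functions of independent samples\<close>

text \<open>A sample sequence is one draw followed by an independent sample sequence: the product
  measure is the image of \<open>D \<Otimes>\<^sub>M samples D\<close> under prepending.
  Independence enters the product formula and the distinctness of samples through this
  recursion.\<close>

lemma samples_nn_integral_shift:
  assumes D: "prob_space D" and f: "f \<in> borel_measurable (samples D)"
  shows "(\<integral>\<^sup>+\<omega>. f \<omega> \<partial>samples D) = (\<integral>\<^sup>+x. \<integral>\<^sup>+\<omega>. f (case_nat x \<omega>) \<partial>samples D \<partial>D)"
proof -
  interpret D: prob_space D by fact
  interpret sequence_space D ..
  interpret S: prob_space "samples D"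
    unfolding samples_def by (rule prob_space_PiM) (rule D)
  have eq: "distr (D \<Otimes>\<^sub>M samples D) (samples D) (\<lambda>(s, \<omega>). case_nat s \<omega>) = samples D"
    using PiM_iter unfolding samples_def .
  have [measurable]: "(\<lambda>(s, \<omega>). case_nat s \<omega>) \<in> D \<Otimes>\<^sub>M samples D \<rightarrow>\<^sub>M samples D"
    unfolding samples_def by measurable
  note f [measurable]
  have "(\<integral>\<^sup>+\<omega>. f \<omega> \<partial>samples D) = (\<integral>\<^sup>+z. f (case_nat (fst z) (snd z)) \<partial>(D \<Otimes>\<^sub>M samples D))"
    by (subst eq[symmetric], subst nn_integral_distr) (auto simp: split_beta' cong: nn_integral_cong)
  also have "\<dots> = (\<integral>\<^sup>+x. \<integral>\<^sup>+\<omega>. f (case_nat x \<omega>) \<partial>samples D \<partial>D)"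
    by (subst S.nn_integral_fst[symmetric]) (auto simp: split_beta')
  finally show ?thesis .
qed

lemma samples_component_measurable [measurable]: "(\<lambda>\<omega>. \<omega> i) \<in> samples D \<rightarrow>\<^sub>M D"
  unfolding samples_def by measurable

lemma samples_nn_integral_prod:
  fixes g :: "scenario \<Rightarrow> ennreal"
  assumes D: "prob_space D" and g [measurable]: "g \<in> borel_measurable D"
  shows "(\<integral>\<^sup>+\<omega>. (\<Prod>i<N. g (\<omega> i)) \<partial>samples D) = (\<integral>\<^sup>+x. g x \<partial>D) ^ N"
proof (induction N)
  case 0
  interpret S: prob_space "samples D"
    unfolding samples_def by (rule prob_space_PiM) (rule D)
  show ?case by (simp add: S.emeasure_space_1)
next
  case (Suc N)
  have "(\<integral>\<^sup>+\<omega>. (\<Prod>i<Suc N. g (\<omega> i)) \<partial>samples D) =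
      (\<integral>\<^sup>+x. \<integral>\<^sup>+\<omega>. (\<Prod>i<Suc N. g (case_nat x \<omega> i)) \<partial>samples D \<partial>D)"
    by (rule samples_nn_integral_shift[OF D]) measurable
  also have "\<dots> = (\<integral>\<^sup>+x. \<integral>\<^sup>+\<omega>. g x * (\<Prod>i<N. g (\<omega> i)) \<partial>samples D \<partial>D)"
    by (simp add: prod.lessThan_Suc_shift del: prod.lessThan_Suc)
  also have "\<dots> = (\<integral>\<^sup>+x. g x * (\<integral>\<^sup>+y. g y \<partial>D) ^ N \<partial>D)"
    by (subst nn_integral_cmult) (simp_all add: Suc)
  also have "\<dots> = (\<integral>\<^sup>+x. g x \<partial>D) ^ Suc N"
    by (subst nn_integral_multc) (simp_all add: mult.commute)
  finally show ?case .
qed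

text \<open>Markov's inequality for the exponential of the sum. The rate is absorbed into
  \<open>f\<close>, so that upper tails, lower tails and the trimmed excess are all
  instances.\<close>

lemma samples_exp_bound:
  fixes f :: "scenario \<Rightarrow> real" and a m :: real
  assumes D: "prob_space D" and [measurable]: "f \<in> borel_measurable D"
    and M: "integrable D (\<lambda>x. exp (f x))" "(\<integral>x. exp (f x) \<partial>D) \<le> exp m"
  shows "measure (samples D) {\<omega> \<in> space (samples D). a \<le> (\<Sum>i<N. f (\<omega> i))} \<le> exp (N * m - a)"
proof -
  interpret S: prob_space "samples D"
    unfolding samples_def by (rule prob_space_PiM) (rule D)
  have "emeasure (samples D) {\<omega> \<in> space (samples D). a \<le> (\<Sum>i<N. f (\<omega> i))} =
      emeasure (samples D) {\<omega> \<in> space (samples D). 1 \<le> ennreal (exp (-a)) * (\<Prod>i<N. ennreal (exp (f (\<omega> i))))}"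
  proof (rule arg_cong[where f = "emeasure _"], rule Collect_cong, rule conj_cong[OF refl])
    fix \<omega>
    have "ennreal (exp (-a)) * (\<Prod>i<N. ennreal (exp (f (\<omega> i)))) = ennreal (exp ((\<Sum>i<N. f (\<omega> i)) - a))"
      by (simp add: prod_ennreal prod_nonneg exp_sum exp_diff exp_minus mult.commute divide_inverse
          flip: ennreal_mult)
    then show "(a \<le> (\<Sum>i<N. f (\<omega> i))) = (1 \<le> ennreal (exp (-a)) * (\<Prod>i<N. ennreal (exp (f (\<omega> i)))))"
      by (simp flip: ennreal_1)
  qed
  also have "\<dots> \<le> ennreal (exp (-a)) * (\<integral>\<^sup>+\<omega>. (\<Prod>i<N. ennreal (exp (f (\<omega> i)))) * indicator (space (samples D)) \<omega> \<partial>samples D)"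
    by (rule nn_integral_Markov_inequality) auto
  also have "(\<integral>\<^sup>+\<omega>. (\<Prod>i<N. ennreal (exp (f (\<omega> i)))) * indicator (space (samples D)) \<omega> \<partial>samples D) =
      (\<integral>\<^sup>+\<omega>. (\<Prod>i<N. ennreal (exp (f (\<omega> i)))) \<partial>samples D)"
    by (intro nn_integral_cong) auto
  also have "\<dots> = (\<integral>\<^sup>+x. ennreal (exp (f x)) \<partial>D) ^ N"
    by (rule samples_nn_integral_prod[OF D]) auto
  also have "\<dots> \<le> ennreal (exp m) ^ N"
    using M by (subst nn_integral_eq_integral) (auto intro!: power_mono ennreal_leI)
  also have "ennreal (exp (-a)) * \<dots> = ennreal (exp (N * m - a))"
    by (simp add: ennreal_power exp_diff exp_minus field_simps flip: exp_of_nat_mult ennreal_mult)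
  finally have "emeasure (samples D) {\<omega> \<in> space (samples D). a \<le> (\<Sum>i<N. f (\<omega> i))} \<le> ennreal (exp (N * m - a))"
    by (simp add: mult_left_mono)
  then show ?thesis
    by (simp add: S.emeasure_eq_measure)
qed

text \<open>On [0, 1] the square of Z is at most Z, so the moment bound involves only the mean. For
  a deviation proportional to m the exponent is of order N * m instead of the square of m times N;
  this is what allows 1 / \<alpha> instead of its square.\<close>

lemma samples_sum_upper_tail:
  fixes Z :: "scenario \<Rightarrow> real" and a m l :: real
  assumes D: "prob_space D" and [measurable]: "Z \<in> borel_measurable D"
    and Z: "\<And>x. x \<in> space D \<Longrightarrow> 0 \<le> Z x \<and> Z x \<le> 1" and m: "(\<integral>x. Z x \<partial>D) \<le> m"
    and l: "0 \<le> l" "l \<le> 1"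
  shows "measure (samples D) {\<omega> \<in> space (samples D). a \<le> (\<Sum>i<N. Z (\<omega> i))}
      \<le> exp (N * m * (l + l\<^sup>2) - l * a)"
proof (cases "l = 0")
  case True
  interpret S: prob_space "samples D"
    unfolding samples_def by (rule prob_space_PiM) (rule D)
  show ?thesis using True by simp
next
  case False
  with l have l0: "l > 0" by simp
  interpret prob_space D by fact
  have int: "integrable D Z"
    by (rule integrable_const_bound[of _ 1]) (use Z in auto)
  have i: "integrable D (\<lambda>x. exp (l * Z x))"
    by (rule integrable_const_bound[of _ "exp l"]) (use Z l in \<open>auto intro!: mult_left_le AE_I2\<close>)
  have le: "(\<integral>x. exp (l * Z x) \<partial>D) \<le> (\<integral>x. 1 + Z x * (l + l\<^sup>2) \<partial>D)"
  proof (rule integral_mono)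
    fix x assume "x \<in> space D"
    then have z: "0 \<le> Z x" "Z x \<le> 1" using Z by auto
    then have "exp (l * Z x) \<le> 1 + l * Z x + (l * Z x)\<^sup>2"
      by (intro exp_bound) (use l in \<open>auto intro: mult_le_one\<close>)
    also have "(l * Z x)\<^sup>2 \<le> l\<^sup>2 * Z x"
      using z by (auto simp: power_mult_distrib power2_eq_square[of "Z x"] intro!: mult_left_mono mult_left_le)
    finally show "exp (l * Z x) \<le> 1 + Z x * (l + l\<^sup>2)" by (simp add: algebra_simps)
  qed (use int i in auto)
  note le
  also have "\<dots> = 1 + (\<integral>x. Z x \<partial>D) * (l + l\<^sup>2)"
    using int by (simp add: prob_space)
  also have "\<dots> \<le> 1 + m * (l + l\<^sup>2)"
    using m l by (simp add: mult_right_mono)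
  also have "\<dots> \<le> exp (m * (l + l\<^sup>2))" by (rule exp_ge_add_one_self)
  finally have le: "(\<integral>x. exp (l * Z x) \<partial>D) \<le> exp (m * (l + l\<^sup>2))" .
  have "measure (samples D) {\<omega> \<in> space (samples D). l * a \<le> (\<Sum>i<N. l * Z (\<omega> i))}
      \<le> exp (N * (m * (l + l\<^sup>2)) - l * a)"
    by (intro samples_exp_bound[OF D]) (use i le in auto)
  with l0 show ?thesis by (simp add: mult.assoc flip: sum_distrib_left)
qed

text \<open>The remainder after the quadratic term has the sign of the cube of -x.\<close>

lemma exp_minus_le_quadratic:
  fixes x :: real assumes "0 \<le> x" shows "exp (-x) \<le> 1 - x + x\<^sup>2 / 2"
proof -
  have "\<exists>t. \<bar>t\<bar> \<le> \<bar>- x\<bar> \<and> exp (-x) = (\<Sum>m<3. (-x) ^ m / fact m) + exp t / fact 3 * (- x) ^ 3"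
    by (rule Maclaurin_exp_le)
  then obtain t where "exp (-x) = (\<Sum>m<3. (-x) ^ m / fact m) + exp t / fact 3 * (- x) ^ 3" by blast
  moreover have "exp t / fact 3 * (- x) ^ 3 \<le> 0"
    using assms by (simp add: mult_nonneg_nonneg)
  moreover have "(\<Sum>m<3. (-x) ^ m / fact m) = 1 - x + x\<^sup>2 / 2"
    by (simp add: eval_nat_numeral)
  ultimately show ?thesis by simp
qed

text \<open>Again the square of Z is at most Z. The factor 1/2 at the quadratic term matters: it
  leaves a positive coefficient at l = 1, the rate used for the \<alpha>-quantile.\<close>

lemma samples_sum_lower_tail:
  fixes Z :: "scenario \<Rightarrow> real" and a m l :: real
  assumes D: "prob_space D" and [measurable]: "Z \<in> borel_measurable D"
    and Z: "\<And>x. x \<in> space D \<Longrightarrow> 0 \<le> Z x \<and> Z x \<le> 1" and m: "m \<le> (\<integral>x. Z x \<partial>D)"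
    and l: "0 \<le> l" "l \<le> 1"
  shows "measure (samples D) {\<omega> \<in> space (samples D). (\<Sum>i<N. Z (\<omega> i)) \<le> a}
      \<le> exp (l * a - N * m * (l - l\<^sup>2 / 2))"
proof (cases "l = 0")
  case True
  interpret S: prob_space "samples D"
    unfolding samples_def by (rule prob_space_PiM) (rule D)
  show ?thesis using True by simp
next
  case False
  with l have l0: "l > 0" by simp
  interpret prob_space D by fact
  have l2: "l\<^sup>2 \<le> l" using l by (simp add: power2_eq_square mult_left_le)
  have int: "integrable D Z"
    by (rule integrable_const_bound[of _ 1]) (use Z in auto)
  have i: "integrable D (\<lambda>x. exp (- (l * Z x)))"
    by (rule integrable_const_bound[of _ 1]) (use Z l in auto)
  have le: "(\<integral>x. exp (- (l * Z x)) \<partial>D) \<le> (\<integral>x. 1 - Z x * (l - l\<^sup>2 / 2) \<partial>D)"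
  proof (rule integral_mono)
    fix x assume "x \<in> space D"
    then have z: "0 \<le> Z x" "Z x \<le> 1" using Z by auto
    then have "exp (- (l * Z x)) \<le> 1 - l * Z x + (l * Z x)\<^sup>2 / 2"
      by (intro exp_minus_le_quadratic) (use l in auto)
    also have "(l * Z x)\<^sup>2 \<le> l\<^sup>2 * Z x"
      using z by (auto simp: power_mult_distrib power2_eq_square[of "Z x"] intro!: mult_left_mono mult_left_le)
    finally show "exp (- (l * Z x)) \<le> 1 - Z x * (l - l\<^sup>2 / 2)" by (simp add: algebra_simps)
  qed (use int i in auto)
  note le
  also have "\<dots> = 1 - (\<integral>x. Z x \<partial>D) * (l - l\<^sup>2 / 2)"
    using int by (simp add: prob_space)
  also have "\<dots> \<le> 1 - m * (l - l\<^sup>2 / 2)"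
    using m l l2 by (simp add: mult_right_mono)
  also have "\<dots> \<le> exp (- m * (l - l\<^sup>2 / 2))"
    using exp_ge_add_one_self[of "- m * (l - l\<^sup>2 / 2)"] by simp
  finally have le: "(\<integral>x. exp (- (l * Z x)) \<partial>D) \<le> exp (- m * (l - l\<^sup>2 / 2))" .
  have "measure (samples D) {\<omega> \<in> space (samples D). - (l * a) \<le> (\<Sum>i<N. - (l * Z (\<omega> i)))}
      \<le> exp (N * (- m * (l - l\<^sup>2 / 2)) - - (l * a))"
    by (intro samples_exp_bound[OF D]) (use i le in auto)
  with l0 show ?thesis by (simp add: mult.assoc sum_negf flip: sum_distrib_left)
qed

text \<open>The shift lowers both indices until the earlier draw is the first one. That draw is then
  a fixed value, which the later one avoids because X has no atoms.\<close>

lemma samples_AE_neq: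
  fixes X :: "scenario \<Rightarrow> real"
  assumes D: "prob_space D" and [measurable]: "X \<in> borel_measurable D"
    and null: "\<And>c. AE x in D. X x \<noteq> c" and "i < j"
  shows "AE \<omega> in samples D. X (\<omega> i) \<noteq> X (\<omega> j)"
proof -
  define h :: "nat \<Rightarrow> nat \<Rightarrow> (nat \<Rightarrow> scenario) \<Rightarrow> ennreal"
    where "h i j \<omega> = (if X (\<omega> i) = X (\<omega> j) then 1 else 0)" for i j \<omega>
  have [measurable]: "h i j \<in> borel_measurable (samples D)" for i j
    unfolding h_def by measurable
  have "(\<integral>\<^sup>+\<omega>. h i j \<omega> \<partial>samples D) = 0"
    using \<open>i < j\<close>
  proof (induction i arbitrary: j)
    case 0
    have "(\<integral>\<^sup>+\<omega>. h 0 j (case_nat x \<omega>) \<partial>samples D) = 0" for x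
    proof -
      have "AE \<omega> in samples D. X (\<omega> (j - 1)) \<noteq> X x"
        using AE_PiM_component[of UNIV "\<lambda>_. D" "j - 1" "\<lambda>y. X y \<noteq> X x"] null[of "X x"] D
        unfolding samples_def by simp
      then have "AE \<omega> in samples D. h 0 j (case_nat x \<omega>) = 0"
        by eventually_elim (use 0 in \<open>auto simp: h_def split: nat.splits\<close>)
      then have "(\<integral>\<^sup>+\<omega>. h 0 j (case_nat x \<omega>) \<partial>samples D) = (\<integral>\<^sup>+\<omega>. 0 \<partial>samples D)"
        by (rule nn_integral_cong_AE)
      then show ?thesis by simp
    qed
    then show ?case
      by (subst samples_nn_integral_shift[OF D]) simp_all
  next
    case (Suc i)
    then obtain k where k: "j = Suc k" "i < k" by (cases j) auto
    then show ?case
      using Suc.IH[of k] by (subst samples_nn_integral_shift[OF D]) (simp_all add: h_def)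
  qed
  then have "AE \<omega> in samples D. h i j \<omega> = 0"
    by (subst (asm) nn_integral_0_iff_AE) auto
  then show ?thesis
    by eventually_elim (auto simp: h_def split: if_splits)
qed

lemma samples_inequations_measurable:
  fixes X :: "scenario \<Rightarrow> real" and N :: nat
  assumes X [measurable]: "X \<in> borel_measurable D"
  shows "{\<omega> \<in> space (samples D). \<forall>i\<in>{..<N}. \<forall>j\<in>{..<N}. i < j \<longrightarrow> X (\<omega> i) \<noteq> X (\<omega> j)} \<in> sets (samples D)"
proof -
  have "{\<omega> \<in> space (samples D). i < j \<longrightarrow> X (\<omega> i) \<noteq> X (\<omega> j)} \<in> sets (samples D)" for i j :: nat
  proof -
    have "(\<lambda>\<omega>. X (\<omega> k)) \<in> borel_measurable (samples D)" for k by measurable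
    then have "{\<omega> \<in> space (samples D). X (\<omega> i) \<noteq> X (\<omega> j)} \<in> sets (samples D)"
      by (intro borel_measurable_neq)
    then show ?thesis by (cases "i < j") simp_all
  qed
  then show ?thesis by (intro sets.sets_Collect_finite_All finite_lessThan)
qed

section \<open>A cheap subset of the samples\<close>

text \<open>T is the infimum of the points where the distribution function is at least 1 - p. Right
  continuity at T gives the first bound and the left limit gives the second. Atoms are allowed, so
  the two masses may differ.\<close>

lemma obtain_quantile:
  fixes X :: "'a \<Rightarrow> real"
  assumes D: "prob_space D" and [measurable]: "X \<in> borel_measurable D" and p: "0 < p" "p < 1"
  obtains T where "measure D {x \<in> space D. T < X x} \<le> p" "p \<le> measure D {x \<in> space D. T \<le> X x}"
proof -
  interpret D: prob_space D by fact
  interpret R: real_distribution "distr D borel X"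
    by (rule D.real_distribution_distr) simp
  define F where "F = cdf (distr D borel X)"
  have gt: "measure D {x \<in> space D. t < X x} = 1 - F t" for t
  proof -
    have "F t = measure D {x \<in> space D. X x \<le> t}"
      by (simp add: F_def cdf_def measure_distr vimage_def Int_def conj_commute)
    moreover have "{x \<in> space D. t < X x} = space D - {x \<in> space D. X x \<le> t}" by auto
    ultimately show ?thesis by (simp add: D.prob_compl)
  qed
  have mono: "F s \<le> F t" if "s \<le> t" for s t
    unfolding F_def using that by (rule R.cdf_nondecreasing)
  have "eventually (\<lambda>t. 1 - p < F t) at_top"
    using R.cdf_lim_at_top_prob p unfolding F_def by (intro order_tendstoD) auto
  then obtain t1 where t1: "1 - p < F t1"
    by (auto simp: eventually_at_top_linorder)
  have "eventually (\<lambda>t. F t < 1 - p) at_bot"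
    using R.cdf_lim_at_bot p unfolding F_def by (intro order_tendstoD) auto
  then obtain t0 where t0: "F t0 < 1 - p"
    by (auto simp: eventually_at_bot_linorder)
  define S where "S = {t. 1 - p \<le> F t}"
  have "t0 \<le> t" if "t \<in> S" for t
    using t0 that mono[of t t0] unfolding S_def by (cases "t0 \<le> t") auto
  moreover have "t1 \<in> S" using t1 by (simp add: S_def)
  ultimately have S: "S \<noteq> {}" "bdd_below S"
    unfolding bdd_below_def by blast+
  define T where "T = Inf S"
  have right: "1 - p \<le> F t" if "T < t" for t
    using that S cInf_less_iff[of S t] mono unfolding T_def S_def
    by (metis (mono_tags, lifting) less_imp_le mem_Collect_eq order_trans)
  have left: "F t \<le> 1 - p" if "t < T" for t
    using that cInf_lower[OF _ S(2), of t] unfolding T_def S_def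
    by (metis (mono_tags, lifting) linorder_linear mem_Collect_eq not_le)
  have "(F \<longlongrightarrow> F T) (at_right T)"
    using R.cdf_is_right_cont[of T] by (simp add: F_def continuous_within)
  then have "1 - p \<le> F T"
    by (rule tendsto_lowerbound) (auto simp: eventually_at_right_field right intro!: exI[of _ "T + 1"])
  moreover have "(F \<longlongrightarrow> measure (distr D borel X) {..<T}) (at_left T)"
    unfolding F_def by (rule R.cdf_at_left)
  then have "measure (distr D borel X) {..<T} \<le> 1 - p"
    by (rule tendsto_upperbound) (auto simp: eventually_at_left_field left intro!: exI[of _ "T - 1"])
  then have "measure D {x \<in> space D. X x < T} \<le> 1 - p"
    by (simp add: measure_distr vimage_def Int_def conj_commute)
  moreover have "{x \<in> space D. T \<le> X x} = space D - {x \<in> space D. X x < T}" by auto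
  then have "measure D {x \<in> space D. T \<le> X x} = 1 - measure D {x \<in> space D. X x < T}"
    by (simp add: D.prob_compl)
  ultimately show ?thesis
    by (intro that[of T]) (auto simp: gt)
qed

lemma exp_le_quadratic:
  fixes x :: real assumes "x \<le> 1" shows "exp x \<le> 1 + x + x\<^sup>2"
proof (cases "0 \<le> x")
  case True
  then show ?thesis using assms by (rule exp_bound)
next
  case False
  have "x\<^sup>2 / 2 \<le> x\<^sup>2" by simp
  moreover have "exp x \<le> 1 + x + x\<^sup>2 / 2"
    using False exp_minus_le_quadratic[of "- x"] by simp
  ultimately show ?thesis by linarith
qed

text \<open>
  The weight \<open>w\<close> discards the most expensive part of the distribution, of mass \<open>p\<close>. The cost lost
  in this way exactly pays for the variance of what remains.
\<close>

lemma trimmed_excess_exp: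
  fixes X w :: "'a \<Rightarrow> real" and B T p :: real
  assumes D: "prob_space D" and [measurable]: "X \<in> borel_measurable D" "w \<in> borel_measurable D"
    and X: "\<And>x. x \<in> space D \<Longrightarrow> 0 \<le> X x" and int: "integrable D X" and B: "(\<integral>x. X x \<partial>D) \<le> B" "0 < B"
    and w: "\<And>x. x \<in> space D \<Longrightarrow> 0 \<le> w x \<and> w x \<le> 1" "(\<integral>x. 1 - w x \<partial>D) = p"
    and wT: "\<And>x. x \<in> space D \<Longrightarrow> X x < T \<Longrightarrow> w x = 1"
      "\<And>x. x \<in> space D \<Longrightarrow> T < X x \<Longrightarrow> w x = 0"
    and p: "0 < p" "p < 1"
  defines "f \<equiv> \<lambda>x. p / (3 * B) * (w x * (X x - B))"
  shows "integrable D (\<lambda>x. exp (f x))" "(\<integral>x. exp (f x) \<partial>D) \<le> 1"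
proof -
  interpret prob_space D by fact
  have [measurable]: "f \<in> borel_measurable D" unfolding f_def by measurable
  define V where "V = (\<lambda>x. w x * (X x - B))"
  define l where "l = p / (3 * B)"
  have l: "l > 0" using p B by (simp add: l_def)
  have f: "f = (\<lambda>x. l * V x)" by (simp add: f_def V_def l_def)
  \<comment> \<open>The range of \<open>V\<close> is [- B, T']: the weight vanishes above T, and X
    is nonnegative.\<close>
  define T' where "T' = max 0 (T - B)"
  have VT: "V x \<le> T'" if x: "x \<in> space D" for x
  proof (cases "T < X x")
    case False
    then have "w x * (X x - B) \<le> w x * T'"
      using w(1)[OF x] by (intro mult_left_mono) (auto simp: T'_def)
    also have "\<dots> \<le> T'" using w(1)[OF x] by (simp add: T'_def mult_left_le_one_le)
    finally show ?thesis by (simp add: V_def)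
  qed (use wT(2)[OF x] in \<open>simp add: V_def T'_def\<close>)
  have VB: "- B \<le> V x" if x: "x \<in> space D" for x
  proof -
    have "w x * (B - X x) \<le> w x * B" using w(1)[OF x] X[OF x] by (intro mult_left_mono) auto
    also have "\<dots> \<le> B" using w(1)[OF x] B by (simp add: mult_left_le_one_le)
    finally show ?thesis by (simp add: V_def algebra_simps)
  qed
  have intw: "integrable D w"
    by (rule integrable_const_bound[of _ 1]) (use w(1) in auto)
  have bd: "integrable D (\<lambda>x. h (V x))" if [measurable]: "h \<in> borel_measurable borel"
    and "\<And>v. - B \<le> v \<Longrightarrow> v \<le> T' \<Longrightarrow> \<bar>h v\<bar> \<le> c" for h :: "real \<Rightarrow> real" and c
    by (rule integrable_const_bound[of _ c]) (use that VT VB in \<open>auto simp: V_def\<close>)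
  show ie: "integrable D (\<lambda>x. exp (f x))"
    unfolding f by (rule bd[of "\<lambda>v. exp (l * v)" "exp (l * T')"]) (use l in auto)
  show "(\<integral>x. exp (f x) \<partial>D) \<le> 1"
  proof (cases "T < B")
    case True
    \<comment> \<open>If the quantile lies below the budget, everything kept costs at most B and
      \<open>V\<close> is nonpositive.\<close>
    then have "T' = 0" by (simp add: T'_def)
    have "(\<integral>x. exp (f x) \<partial>D) \<le> (\<integral>x. 1 \<partial>D)"
      using VT l \<open>T' = 0\<close> by (intro integral_mono ie) (auto simp: f mult_nonneg_nonpos)
    then show ?thesis by (simp add: prob_space)
  next
    case False
    then have T': "T = B + T'" "0 \<le> T'" by (auto simp: T'_def)
    have sq: "v\<^sup>2 \<le> (T' + B)\<^sup>2" if "- B \<le> v" "v \<le> T'" for v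
      using that T'(2) B(2) by (subst abs_le_square_iff[symmetric]) auto
    have intV: "integrable D V" and intV2: "integrable D (\<lambda>x. (V x)\<^sup>2)"
      and intP: "integrable D (\<lambda>x. max (V x) 0)" and intN: "integrable D (\<lambda>x. max (- V x) 0)"
      using bd[of "\<lambda>v. v" "T' + B"] bd[of "\<lambda>v. v\<^sup>2" "(T' + B)\<^sup>2"] bd[of "\<lambda>v. max v 0" "T' + B"]
        bd[of "\<lambda>v. max (-v) 0" "T' + B"] T'(2) B(2) sq by auto
    have intwX: "integrable D (\<lambda>x. w x * X x)"
      by (rule Bochner_Integration.integrable_bound[OF int])
        (use w(1) X in \<open>auto simp: abs_mult mult_left_le_one_le\<close>)
    \<comment> \<open>The removed mass p sits where X is at least T, so trimming lowers the mean by
      at least p * T. Relative to B this becomes the drift - p * T' of \<open>V\<close>.\<close>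
    have "p * T = (\<integral>x. (1 - w x) * T \<partial>D)" using w(2) by simp
    also have "\<dots> \<le> (\<integral>x. X x - w x * X x \<partial>D)"
    proof (rule integral_mono)
      fix x assume x: "x \<in> space D"
      show "(1 - w x) * T \<le> X x - w x * X x"
      proof (cases "X x < T")
        case False
        then have "(1 - w x) * T \<le> (1 - w x) * X x"
          using w(1)[OF x] by (intro mult_left_mono) auto
        then show ?thesis by (simp add: algebra_simps)
      qed (use wT(1)[OF x] in simp)
    qed (use intw int intwX in auto)
    also have "\<dots> = (\<integral>x. X x \<partial>D) - (\<integral>x. w x * X x \<partial>D)"
      using int intwX by simp
    finally have pT: "p * T \<le> B - (\<integral>x. w x * X x \<partial>D)" using B by simp
    have wp: "(\<integral>x. w x \<partial>D) = 1 - p"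
      using w(2) intw by (simp add: prob_space)
    have "(\<integral>x. V x \<partial>D) = (\<integral>x. w x * X x \<partial>D) - B * (\<integral>x. w x \<partial>D)"
      unfolding V_def using intw intwX by (simp add: right_diff_distrib)
    moreover have "B * (\<integral>x. w x \<partial>D) = B - p * B" by (simp add: wp algebra_simps)
    moreover have "p * T = p * B + p * T'" using T' by (simp add: algebra_simps)
    ultimately have EV: "(\<integral>x. V x \<partial>D) \<le> - p * T'"
      using pT by linarith
    have "0 \<le> (\<integral>x. w x * X x \<partial>D)" using w(1) X by (intro integral_nonneg_AE) auto
    with pT have "p * T \<le> B" by simp
    moreover have "p * T = p * B + p * T'" using T' by (simp add: algebra_simps)
    moreover have "0 \<le> p * B" using p B by simp
    ultimately have "p * T' \<le> B" by linarith
    then have lT: "l * T' \<le> 1 / 3" using B by (simp add: l_def field_simps)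
    have lB: "l * B = p / 3" using B by (simp add: l_def)
    define P where "P = (\<integral>x. max (V x) 0 \<partial>D)"
    define u where "u = (\<integral>x. max (- V x) 0 \<partial>D)"
    have P0: "0 \<le> P" and u0: "0 \<le> u" unfolding P_def u_def by (auto intro!: integral_nonneg_AE)
    have EVPu: "(\<integral>x. V x \<partial>D) = P - u"
    proof -
      have "(\<integral>x. V x \<partial>D) = (\<integral>x. max (V x) 0 - max (- V x) 0 \<partial>D)"
        by (intro Bochner_Integration.integral_cong) auto
      then show ?thesis unfolding P_def u_def using intP intN by simp
    qed
    have "P \<le> (\<integral>x. X x \<partial>D)"
      unfolding P_def
    proof (rule integral_mono)
      fix x assume x: "x \<in> space D"
      have "w x * (X x - B) \<le> w x * X x" using w(1)[OF x] B by (intro mult_left_mono) auto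
      also have "\<dots> \<le> X x" using w(1)[OF x] X[OF x] by (simp add: mult_left_le_one_le)
      finally show "max (V x) 0 \<le> X x" using X[OF x] by (simp add: V_def)
    qed (use int intP in auto)
    with B have PB: "P \<le> B" by simp
    have "(\<integral>x. (V x)\<^sup>2 \<partial>D) \<le> (\<integral>x. T' * max (V x) 0 + B * max (- V x) 0 \<partial>D)"
    proof (rule integral_mono)
      fix x assume x: "x \<in> space D"
      show "(V x)\<^sup>2 \<le> T' * max (V x) 0 + B * max (- V x) 0"
      proof (cases "0 \<le> V x")
        case True
        then show ?thesis using VT[OF x] by (simp add: power2_eq_square mult_right_mono)
      next
        case False
        then have "- V x * - V x \<le> B * - V x" using VB[OF x] by (intro mult_right_mono) auto
        with False show ?thesis by (simp add: power2_eq_square)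
      qed
    qed (use intV2 intP intN in auto)
    also have "\<dots> = T' * P + B * u" unfolding P_def u_def using intP intN by simp
    finally have EV2: "(\<integral>x. (V x)\<^sup>2 \<partial>D) \<le> T' * P + B * u" .
    \<comment> \<open>By exp x \<le> 1 + x + x^2 for x \<le> 1 this makes the exponential moment at
      most 1. The second moment is at most T' * P + B * u. If u \<le> 2 * T', this is at most 3 * B
      * T', and the rate p / (3 * B) makes its share p * T', which the drift cancels. If u > 2 * T',
      the positive part satisfies P \<le> T' < u / 2, the quadratic terms cost at most u / 6 + u /
      3, and the negative part alone pays for everything.\<close>
    have key: "(\<integral>x. V x \<partial>D) + l * (\<integral>x. (V x)\<^sup>2 \<partial>D) \<le> 0"
    proof -
      have l2: "l * (\<integral>x. (V x)\<^sup>2 \<partial>D) \<le> l * (T' * P + B * u)"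
        using EV2 l by (intro mult_left_mono) auto
      show ?thesis
      proof (cases "u \<le> 2 * T'")
        case True
        have "T' * P \<le> T' * B" using PB T' by (intro mult_left_mono) auto
        moreover have "B * u \<le> B * (2 * T')" using True B by (intro mult_left_mono) auto
        ultimately have "T' * P + B * u \<le> 3 * (B * T')" by (simp add: mult.commute)
        then have "l * (T' * P + B * u) \<le> l * (3 * (B * T'))"
          using l by (intro mult_left_mono) auto
        also have "\<dots> = 3 * (l * B) * T'" by simp
        also have "\<dots> = p * T'" by (simp add: lB)
        finally show ?thesis using l2 EV by linarith
      next
        case False
        have "P \<le> T'"
          unfolding P_def using VT T' integral_mono[OF intP, of "\<lambda>_. T'"] by (auto simp: prob_space)
        then have "T' * P \<le> T' * (u / 2)"
          using False T' by (intro mult_left_mono) auto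
        then have "l * (T' * P) \<le> (l * T') * (u / 2)" using l by (simp add: mult_left_mono mult.assoc)
        also have "\<dots> \<le> 1 / 3 * (u / 2)" using lT u0 by (intro mult_right_mono) auto
        finally have "l * (T' * P) \<le> u / 6" by simp
        moreover have "l * (B * u) \<le> u / 3"
          using mult_left_le_one_le[of u p] p u0 by (simp add: mult.assoc[symmetric] lB)
        moreover note \<open>P \<le> T'\<close>
        ultimately show ?thesis using l2 EVPu False by (simp add: distrib_left)
      qed
    qed
    have "(\<integral>x. exp (f x) \<partial>D) \<le> (\<integral>x. 1 + l * V x + l\<^sup>2 * (V x)\<^sup>2 \<partial>D)"
    proof (rule integral_mono[OF ie])
      fix x assume x: "x \<in> space D"
      have "l * V x \<le> l * T'" using VT[OF x] l by (intro mult_left_mono) auto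
      then have "exp (l * V x) \<le> 1 + l * V x + (l * V x)\<^sup>2" using lT by (intro exp_le_quadratic) auto
      then show "exp (f x) \<le> 1 + l * V x + l\<^sup>2 * (V x)\<^sup>2" by (simp add: f power_mult_distrib)
    qed (use intV intV2 in auto)
    also have "\<dots> = 1 + l * ((\<integral>x. V x \<partial>D) + l * (\<integral>x. (V x)\<^sup>2 \<partial>D))"
      using intV intV2 by (simp add: prob_space algebra_simps power2_eq_square)
    also have "\<dots> \<le> 1" using key l by (simp add: mult_nonneg_nonpos)
    finally show ?thesis .
  qed
qed

text \<open>Rounds the fractional weights to a subset. If T < B, everything up to T is below B and
  all ties can be taken. Otherwise each tie adds a nonnegative excess, so only as many ties are
  taken as are needed for N - r indices, and the weight bound shows that these are at most their
  fractional share \<theta> * card G1.\<close>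

lemma cheap_subset:
  fixes x w :: "nat \<Rightarrow> real" and \<theta> T B c :: real
  assumes \<theta>: "0 \<le> \<theta>" "\<theta> \<le> 1"
    and w: "\<And>i. w i = (if x i < T then 1 else if x i = T then \<theta> else 0)"
    and r: "(\<Sum>i<N. 1 - w i) \<le> real r" "r \<le> N"
    and c: "(\<Sum>i<N. w i * (x i - B)) \<le> c * real (N - r)" "0 \<le> c"
  shows "\<exists>G\<subseteq>{..<N}. N - r \<le> card G \<and> (\<Sum>i\<in>G. x i) \<le> (B + c) * real (card G)"
proof -
  have *: "\<exists>G\<subseteq>{..<N}. N - r \<le> card G \<and> (\<Sum>i\<in>G. x i - B) \<le> c * real (card G)"
  proof -
    define G0 where "G0 = {i \<in> {..<N}. x i < T}"
    define G1 where "G1 = {i \<in> {..<N}. x i = T}"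
    have fin: "finite G0" "finite G1" "G0 \<inter> G1 = {}" "G0 \<subseteq> {..<N}" "G1 \<subseteq> {..<N}"
      by (auto simp: G0_def G1_def)
    have sum_w: "(\<Sum>i<N. w i * g i) = (\<Sum>i\<in>G0. g i) + \<theta> * (\<Sum>i\<in>G1. g i)" for g :: "nat \<Rightarrow> real"
    proof -
      have "(\<Sum>i<N. w i * g i) = (\<Sum>i\<in>G0 \<union> G1. w i * g i)"
        by (intro sum.mono_neutral_right) (auto simp: G0_def G1_def w)
      also have "\<dots> = (\<Sum>i\<in>G0. w i * g i) + (\<Sum>i\<in>G1. w i * g i)"
        using fin by (intro sum.union_disjoint) auto
      also have "(\<Sum>i\<in>G0. w i * g i) = (\<Sum>i\<in>G0. g i)"
        by (intro sum.cong) (auto simp: G0_def w)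
      also have "(\<Sum>i\<in>G1. w i * g i) = \<theta> * (\<Sum>i\<in>G1. g i)"
        unfolding sum_distrib_left by (intro sum.cong) (auto simp: G1_def w)
      finally show ?thesis .
    qed
    have sum_G1: "(\<Sum>i\<in>H. x i - B) = real (card H) * (T - B)" if "H \<subseteq> G1" for H
    proof -
      have "(\<Sum>i\<in>H. x i - B) = (\<Sum>i\<in>H. T - B)"
        using that by (intro sum.cong) (auto simp: G1_def)
      then show ?thesis by simp
    qed
    have "real N - real r \<le> (\<Sum>i<N. w i)"
      using r by (simp add: sum_subtractf)
    then have Nr: "real (N - r) \<le> real (card G0) + \<theta> * real (card G1)"
      using sum_w[of "\<lambda>_. 1"] r(2) by (simp add: of_nat_diff)
    have le: "(\<Sum>i\<in>G0. x i - B) + \<theta> * (real (card G1) * (T - B)) \<le> c * real (N - r)"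
      using c(1) sum_w[of "\<lambda>i. x i - B"] sum_G1[of G1] by simp
    have \<theta>1: "\<theta> * real (card G1) \<le> real (card G1)"
      using \<theta> by (simp add: mult_left_le_one_le)
    consider "T < B" | "B \<le> T" "N - r \<le> card G0" | "B \<le> T" "card G0 < N - r" by linarith
    then show ?thesis
    proof cases
      case 1
      have "(\<Sum>i\<in>G0 \<union> G1. x i - B) \<le> 0"
        using 1 by (intro sum_nonpos) (auto simp: G0_def G1_def)
      also have "\<dots> \<le> c * real (card (G0 \<union> G1))" using c by simp
      moreover have "N - r \<le> card (G0 \<union> G1)"
        using Nr \<theta>1 fin by (subst card_Un_disjoint) auto
      ultimately show ?thesis using fin by (intro exI[of _ "G0 \<union> G1"]) auto
    next
      case 2
      have "0 \<le> \<theta> * (real (card G1) * (T - B))" using \<theta> 2 by simp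
      then have "(\<Sum>i\<in>G0. x i - B) \<le> c * real (N - r)" using le by linarith
      also have "\<dots> \<le> c * real (card G0)" using c 2 by (intro mult_left_mono) auto
      finally show ?thesis using 2 fin by (intro exI[of _ G0]) auto
    next
      case 3
      have "real (N - r) \<le> real (card G0 + card G1)" using Nr \<theta>1 by simp
      then have "N - r \<le> card G0 + card G1" unfolding of_nat_le_iff .
      then have "N - r - card G0 \<le> card G1" by (simp only: le_diff_conv add.commute)
      then obtain H where H: "H \<subseteq> G1" "card H = N - r - card G0" "finite H"
        by (rule obtain_subset_with_card_n)
      then have dis: "finite H" "G0 \<inter> H = {}" using fin finite_subset by auto
      have card: "card (G0 \<union> H) = N - r"
        using H 3 fin dis by (subst card_Un_disjoint) auto
      have "real (card H) \<le> \<theta> * real (card G1)"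
        using Nr H 3 by (simp add: of_nat_diff)
      then have "real (card H) * (T - B) \<le> \<theta> * real (card G1) * (T - B)"
        using 3 by (intro mult_right_mono) auto
      then have "(\<Sum>i\<in>G0. x i - B) + (\<Sum>i\<in>H. x i - B) \<le> c * real (N - r)"
        using le sum_G1[OF H(1)] by (simp add: mult.assoc)
      then have "(\<Sum>i\<in>G0 \<union> H. x i - B) \<le> c * real (card (G0 \<union> H))"
        using fin dis card by (subst sum.union_disjoint) auto
      then show ?thesis using card fin H by (intro exI[of _ "G0 \<union> H"]) auto
    qed
  qed
  then obtain G where G: "G \<subseteq> {..<N}" "N - r \<le> card G" "(\<Sum>i\<in>G. x i - B) \<le> c * real (card G)"
    by blast
  then have "(\<Sum>i\<in>G. x i) \<le> (B + c) * real (card G)"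
    by (simp add: sum_subtractf algebra_simps)
  with G show ?thesis by blast
qed

text \<open>The feasible side. X will be the cost of an optimal strategy, whose distribution may
  have atoms, since continuity is assumed only for potential strategies. This is why a tie weight
  \<theta> occurs.\<close>

lemma samples_cheap_subset:
  fixes X :: "scenario \<Rightarrow> real" and \<alpha> \<epsilon> B :: real and N :: nat
  assumes D: "prob_space D" and [measurable]: "X \<in> borel_measurable D"
    and X: "\<And>x. x \<in> space D \<Longrightarrow> 0 \<le> X x" and int: "integrable D X" and B: "(\<integral>x. X x \<partial>D) \<le> B"
    and \<alpha>: "0 < \<alpha>" "\<alpha> < 1" and \<epsilon>: "0 < \<epsilon>" "\<epsilon> < 1" and N: "32 \<le> \<alpha> * N"
  shows "\<exists>E\<in>sets (samples D). 1 - 2 * exp (- (\<epsilon> * \<alpha> * N / 512)) \<le> measure (samples D) E \<and>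
    (\<forall>\<omega>\<in>E. \<exists>G\<subseteq>{..<N}. N - \<alpha> * N / 16 \<le> card G \<and>
       (\<Sum>i\<in>G. X (\<omega> i)) \<le> (1 + \<epsilon> / 2) * B * card G)"
proof -
  interpret prob_space D by fact
  interpret S: prob_space "samples D"
    unfolding samples_def by (rule prob_space_PiM) (rule D)
  have "0 \<le> B"
    using B X by (smt (verit) integral_nonneg_AE AE_I2)
  show ?thesis
  \<comment> \<open>The rate p / (3 * B) requires B > 0. For B = 0 all sampled costs vanish almost
    surely and the full sample is cheap.\<close>
  proof (cases "B = 0")
    case True
    then have "(\<integral>x. X x \<partial>D) = 0"
      using B by (intro antisym integral_nonneg_AE) (use X in auto)
    then have "AE x in D. X x = 0"
      using integral_nonneg_eq_0_iff_AE[OF int] X by auto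
    then have "AE \<omega> in samples D. X (\<omega> i) = 0" for i
      unfolding samples_def using D by (intro AE_PiM_component) auto
    then have "AE \<omega> in samples D. \<forall>i\<in>{..<N}. X (\<omega> i) = 0"
      by (intro AE_finite_allI) auto
    then have "measure (samples D) {\<omega> \<in> space (samples D). \<forall>i\<in>{..<N}. X (\<omega> i) = 0} = 1"
      by (subst S.prob_Collect_eq_1) auto
    moreover have "0 \<le> \<alpha> * N" using \<alpha> by simp
    ultimately show ?thesis
      using True by (intro bexI[of _ "{\<omega> \<in> space (samples D). \<forall>i\<in>{..<N}. X (\<omega> i) = 0}"])
        (auto intro!: exI[of _ "{..<N}"] sum_nonpos)
  next
    case False
    with \<open>0 \<le> B\<close> have B0: "0 < B" by simp
    \<comment> \<open>The trimmed weight in the sample may double to 2 * p * N = \<alpha> * N / 32.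
      Rounding \<alpha> * N / 16 down to r loses at most half, as \<alpha> * N \<ge> 32, so r still
      covers it.\<close>
    define p where "p = \<alpha> / 64"
    have p: "0 < p" "p < 1" using \<alpha> by (auto simp: p_def)
    obtain T where T: "prob {x \<in> space D. T < X x} \<le> p" "p \<le> prob {x \<in> space D. T \<le> X x}"
      by (rule obtain_quantile[OF D _ p, of X]) auto
    have split: "prob {x \<in> space D. T \<le> X x} = prob {x \<in> space D. T < X x} + prob {x \<in> space D. X x = T}"
      by (subst finite_measure_Union[symmetric]) (auto intro!: arg_cong[where f = prob])
    \<comment> \<open>Splits the atom at T so that exactly mass p is removed. Without an atom the
      division by 0 gives \<theta> = 1, which is right because the mass above T is then p
      itself.\<close>
    define \<theta> where "\<theta> = 1 - (p - prob {x \<in> space D. T < X x}) / prob {x \<in> space D. X x = T}"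
    define w where "w x = (if X x < T then 1 else if X x = T then \<theta> else 0)" for x
    have [measurable]: "w \<in> borel_measurable D" unfolding w_def by measurable
    have \<theta>: "0 \<le> \<theta>" "\<theta> \<le> 1"
      using T split by (auto simp: \<theta>_def divide_le_eq_1)
    have w01: "0 \<le> w x" "w x \<le> 1" for x using \<theta> by (auto simp: w_def)
    have "(\<integral>x. 1 - w x \<partial>D) = (\<integral>x. indicator {x \<in> space D. T < X x} x +
        (1 - \<theta>) * indicator {x \<in> space D. X x = T} x \<partial>D)"
      by (intro Bochner_Integration.integral_cong) (auto simp: w_def indicator_def)
    also have "\<dots> = prob {x \<in> space D. T < X x} + (1 - \<theta>) * prob {x \<in> space D. X x = T}"
      by (subst Bochner_Integration.integral_add) (auto simp: less_top[symmetric])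
    also have "\<dots> = p"
      using T split by (cases "prob {x \<in> space D. X x = T} = 0") (auto simp: \<theta>_def)
    finally have wp: "(\<integral>x. 1 - w x \<partial>D) = p" .
    define r where "r = nat \<lfloor>\<alpha> * N / 16\<rfloor>"
    have r: "real r \<le> \<alpha> * N / 16" "\<alpha> * N / 32 \<le> real r"
      using N by (auto simp: r_def) linarith+
    have "\<alpha> * N \<le> N" using \<alpha> by (simp add: mult_left_le_one_le)
    then have rN: "r \<le> N" "15 / 16 * N \<le> real (N - r)" using r by linarith+
    define c where "c = \<epsilon> / 2 * B"
    have c: "0 < c" using \<epsilon> B0 by (simp add: c_def)
    define E1 where "E1 = {\<omega> \<in> space (samples D). c * real (N - r) \<le> (\<Sum>i<N. w (\<omega> i) * (X (\<omega> i) - B))}"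
    define E2 where "E2 = {\<omega> \<in> space (samples D). 2 * p * N \<le> (\<Sum>i<N. 1 - w (\<omega> i))}"
    have [measurable]: "E1 \<in> sets (samples D)" "E2 \<in> sets (samples D)"
      unfolding E1_def E2_def by measurable
    define l where "l = p / (3 * B)"
    have l: "0 < l" using p B0 by (simp add: l_def)
    have "measure (samples D) {\<omega> \<in> space (samples D).
        l * (c * real (N - r)) \<le> (\<Sum>i<N. l * (w (\<omega> i) * (X (\<omega> i) - B)))} \<le> exp (real N * 0 - l * (c * real (N - r)))"
      unfolding l_def
      by (rule samples_exp_bound[OF D])
        (use trimmed_excess_exp[OF D _ _ X int B B0 _ wp _ _ p, of T] w01 in \<open>auto simp: w_def\<close>)
    then have "measure (samples D) E1 \<le> exp (- (l * (c * real (N - r))))"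
      using l by (simp add: E1_def flip: sum_distrib_left)
    also have "\<dots> \<le> exp (- (\<epsilon> * \<alpha> * N / 512))"
    proof -
      \<comment> \<open>At least 15/16 of the samples remain, and 15 / (16 * 384) exceeds
        1/512.\<close>
      have "l * c = \<epsilon> * \<alpha> / 384" using B0 by (simp add: l_def c_def p_def)
      then have "l * (c * real (N - r)) = \<epsilon> * \<alpha> / 384 * real (N - r)" by (simp add: mult.assoc[symmetric])
      also have "\<dots> \<ge> \<epsilon> * \<alpha> / 384 * (15 / 16 * N)"
        using rN \<epsilon> \<alpha> by (intro mult_left_mono) auto
      finally have "\<epsilon> * \<alpha> / 384 * (15 / 16 * N) \<le> l * (c * real (N - r))" .
      moreover have "\<epsilon> * \<alpha> / 384 * (15 / 16 * N) = 15 / 6144 * (\<epsilon> * \<alpha> * N)" by simp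
      moreover have "0 \<le> \<epsilon> * \<alpha> * N" using \<epsilon> \<alpha> by simp
      ultimately have "\<epsilon> * \<alpha> * N / 512 \<le> l * (c * real (N - r))" by linarith
      then show ?thesis by simp
    qed
    finally have E1: "measure (samples D) E1 \<le> exp (- (\<epsilon> * \<alpha> * N / 512))" .
    have "measure (samples D) E2 \<le> exp (N * p * (1 / 2 + (1 / 2)\<^sup>2) - 1 / 2 * (2 * p * N))"
      unfolding E2_def by (rule samples_sum_upper_tail[OF D]) (use w01 wp in auto)
    also have "\<dots> \<le> exp (- (\<epsilon> * \<alpha> * N / 512))"
    proof -
      have "\<epsilon> * (\<alpha> * N) \<le> \<alpha> * N" using \<epsilon> \<alpha> by (simp add: mult_left_le_one_le)
      moreover have "0 \<le> \<alpha> * N" using \<alpha> by simp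
      ultimately show ?thesis by (simp add: p_def power2_eq_square field_simps)
    qed
    finally have E2: "measure (samples D) E2 \<le> exp (- (\<epsilon> * \<alpha> * N / 512))" .
    define E where "E = space (samples D) - (E1 \<union> E2)"
    have "measure (samples D) (E1 \<union> E2) \<le> 2 * exp (- (\<epsilon> * \<alpha> * N / 512))"
      using measure_Un_le[of E1 "samples D" E2] E1 E2 by simp
    then have "1 - 2 * exp (- (\<epsilon> * \<alpha> * N / 512)) \<le> measure (samples D) E"
      unfolding E_def by (subst S.prob_compl) auto
    moreover have "\<exists>G\<subseteq>{..<N}. N - \<alpha> * N / 16 \<le> card G \<and>
       (\<Sum>i\<in>G. X (\<omega> i)) \<le> (1 + \<epsilon> / 2) * B * card G" if "\<omega> \<in> E" for \<omega>
    proof -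
      have "(\<Sum>i<N. w (\<omega> i) * (X (\<omega> i) - B)) \<le> c * real (N - r)"
        "(\<Sum>i<N. 1 - w (\<omega> i)) \<le> 2 * p * N"
        using that by (auto simp: E_def E1_def E2_def)
      moreover have "2 * p * N \<le> r" using r by (simp add: p_def)
      ultimately have "\<exists>G\<subseteq>{..<N}. N - r \<le> card G \<and> (\<Sum>i\<in>G. X (\<omega> i)) \<le> (B + c) * real (card G)"
        using c \<theta> rN by (intro cheap_subset[of \<theta> "\<lambda>i. w (\<omega> i)" "\<lambda>i. X (\<omega> i)" T]) (auto simp: w_def)
      then obtain G where G: "G \<subseteq> {..<N}" "N - r \<le> card G" "(\<Sum>i\<in>G. X (\<omega> i)) \<le> (B + c) * real (card G)"
        by blast
      have "N - \<alpha> * N / 16 \<le> card G" using G(2) r(1) by linarith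
      with G(1,3) show ?thesis by (intro exI[of _ G]) (simp add: c_def algebra_simps)
    qed
    ultimately show ?thesis unfolding E_def by (intro bexI[of _ E]) (auto simp: E_def)
  qed
qed

section \<open>Generalization from a subset of the samples\<close>

lemma card_Collect_eq_sum: "real (card {i \<in> {..<N::nat}. P i}) = (\<Sum>i<N. if P i then 1 else 0)"
  by (simp add: sum.If_cases Int_def)

text \<open>\<open>E\<close> is fixed before G and T, so subsets and thresholds need no union bound.
  On \<open>E\<close> the sample quantile T lies between the quantiles s and t of mass \<alpha> and
  \<alpha> / 8. For costs capped at t, a cheap G bounds the total by N * b plus t for each of the at
  most \<alpha> * N / 16 other samples, whereas the part above t alone is expected to contribute t *
  \<alpha> * N / 8. A large truncated mean would therefore be a lower deviation with drift from both
  sources.\<close>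

lemma samples_trimmed_mean:
  fixes X :: "scenario \<Rightarrow> real" and \<alpha> \<epsilon> b B :: real and N :: nat
  assumes D: "prob_space D" and [measurable]: "X \<in> borel_measurable D"
    and X: "\<And>x. x \<in> space D \<Longrightarrow> 0 \<le> X x" and null: "\<And>c. AE x in D. X x \<noteq> c"
    and \<alpha>: "0 < \<alpha>" "\<alpha> < 1" and \<epsilon>: "0 < \<epsilon>" "\<epsilon> < 1" and N: "0 < N"
    and b: "b \<le> (1 + \<epsilon> / 2) * B" "0 \<le> B"
  shows "\<exists>E\<in>sets (samples D). 1 - 3 * exp (- (\<epsilon> * \<alpha> * N / 512)) \<le> measure (samples D) E \<and>
    (\<forall>\<omega>\<in>E. \<forall>G T. G \<subseteq> {..<N} \<longrightarrow> N - \<alpha> * N / 16 \<le> card G \<longrightarrow> (\<Sum>i\<in>G. X (\<omega> i)) \<le> b * card G \<longrightarrow>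
       \<alpha> * N / 4 \<le> card {i \<in> {..<N}. T \<le> X (\<omega> i)} \<longrightarrow> card {i \<in> {..<N}. T < X (\<omega> i)} < \<alpha> * N / 4 \<longrightarrow>
       measure D {x \<in> space D. T < X x} \<le> \<alpha> \<and>
       (\<integral>x. (if T < X x then 0 else X x) \<partial>D) \<le> b + \<epsilon> / 2 * B)"
proof -
  interpret prob_space D by fact
  interpret S: prob_space "samples D"
    unfolding samples_def by (rule prob_space_PiM) (rule D)
  have prob_ge: "prob {x \<in> space D. t \<le> X x} = prob {x \<in> space D. t < X x}" for t
    using null[of t] by (intro finite_measure_eq_AE) auto
  define p where "p = \<alpha> / 8"
  have p: "0 < p" "p < 1" using \<alpha> by (auto simp: p_def)
  obtain t where t: "prob {x \<in> space D. t < X x} = p"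
    by (rule obtain_quantile[OF D _ p, of X]) (auto simp: prob_ge)
  obtain s where s: "prob {x \<in> space D. s < X x} = \<alpha>"
    by (rule obtain_quantile[OF D _ \<alpha>, of X]) (auto simp: prob_ge)
  have "t > 0"
  proof (rule ccontr)
    assume "\<not> t > 0"
    then have "t \<le> X x" if "x \<in> space D" for x using X[OF that] by linarith
    then have "{x \<in> space D. t \<le> X x} = space D" by auto
    then show False using prob_ge[of t] t p by (simp add: prob_space)
  qed
  \<comment> \<open>Capping at t, as opposed to cutting off above t, gives the mass above t the
    value 1. The resulting summand p in the mean pays for the discarded samples.\<close>
  define Z where "Z x = min (X x) t / t" for x
  have [measurable]: "Z \<in> borel_measurable D" unfolding Z_def by measurable
  have Z01: "0 \<le> Z x \<and> Z x \<le> 1" if "x \<in> space D" for x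
    using X[OF that] \<open>t > 0\<close> by (auto simp: Z_def divide_le_eq_1)
  define \<nu> where "\<nu> = (\<integral>x. (if t < X x then 0 else X x) \<partial>D)"
  have int: "integrable D (\<lambda>x. if T < X x then 0 else X x)" for T
    by (rule integrable_const_bound[of _ "max 0 T"]) (use X in auto)
  have EZ: "(\<integral>x. Z x \<partial>D) = \<nu> / t + p"
  proof -
    have "(\<integral>x. Z x \<partial>D) = (\<integral>x. (if t < X x then 0 else X x) / t + indicator {x \<in> space D. t < X x} x \<partial>D)"
      using \<open>t > 0\<close> by (intro Bochner_Integration.integral_cong) (auto simp: Z_def indicator_def min_def)
    also have "\<dots> = \<nu> / t + p"
      using int[of t] t by (subst Bochner_Integration.integral_add) (auto simp: \<nu>_def less_top[symmetric])
    finally show ?thesis .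
  qed
  define E1 where "E1 = {\<omega> \<in> space (samples D). \<alpha> * N / 4 \<le> (\<Sum>i<N. if t < X (\<omega> i) then 1 else 0)}"
  define E2 where "E2 = {\<omega> \<in> space (samples D). (\<Sum>i<N. if s < X (\<omega> i) then 1 else 0) \<le> \<alpha> * N / 4}"
  \<comment> \<open>Nothing has to be excluded if the truncated mean is small already; the deviation
    bound applies only when there is a gap.\<close>
  define E3 where "E3 = (if \<nu> \<le> b + \<epsilon> / 2 * B then {} else
    {\<omega> \<in> space (samples D). (\<Sum>i<N. Z (\<omega> i)) \<le> N * b / t + \<alpha> * N / 16})"
  have [measurable]: "E1 \<in> sets (samples D)" unfolding E1_def by measurable
  have [measurable]: "E2 \<in> sets (samples D)" unfolding E2_def by measurable
  have "{\<omega> \<in> space (samples D). (\<Sum>i<N. Z (\<omega> i)) \<le> N * b / t + \<alpha> * N / 16} \<in> sets (samples D)"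
    by measurable
  then have [measurable]: "E3 \<in> sets (samples D)" unfolding E3_def by simp
  have ind: "(\<integral>x. (if T < X x then 1 else 0) \<partial>D) = prob {x \<in> space D. T < X x}" for T
    by (subst Bochner_Integration.integral_cong[where g = "indicator {x \<in> space D. T < X x}" and N = D])
      auto
  have \<epsilon>\<alpha>N: "0 \<le> \<epsilon> * \<alpha> * N" "\<epsilon> * \<alpha> * N \<le> \<alpha> * N"
    using \<epsilon> \<alpha> mult_left_le_one_le[of "\<alpha> * N" \<epsilon>] by (auto simp: mult.assoc)
  have "measure (samples D) E1 \<le> exp (N * p * (1 / 2 + (1 / 2)\<^sup>2) - 1 / 2 * (\<alpha> * N / 4))"
    unfolding E1_def by (rule samples_sum_upper_tail[OF D]) (auto simp: ind t)
  also have "\<dots> \<le> exp (- (\<epsilon> * \<alpha> * N / 512))"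
    using \<epsilon>\<alpha>N by (simp add: p_def power2_eq_square field_simps)
  finally have E1: "measure (samples D) E1 \<le> exp (- (\<epsilon> * \<alpha> * N / 512))" .
  have "measure (samples D) E2 \<le> exp (1 * (\<alpha> * N / 4) - N * \<alpha> * (1 - 1\<^sup>2 / 2))"
    unfolding E2_def by (rule samples_sum_lower_tail[OF D]) (auto simp: ind s)
  also have "\<dots> \<le> exp (- (\<epsilon> * \<alpha> * N / 512))"
    using \<epsilon>\<alpha>N by (simp add: field_simps)
  finally have E2: "measure (samples D) E2 \<le> exp (- (\<epsilon> * \<alpha> * N / 512))" .
  have E3: "measure (samples D) E3 \<le> exp (- (\<epsilon> * \<alpha> * N / 512))"
  proof (cases "\<nu> \<le> b + \<epsilon> / 2 * B")
    case False
    \<comment> \<open>With this rate the quadratic loss l / 2 * (b + \<epsilon> / 2 * B) is at most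
      \<epsilon> / 4 * B, since b + \<epsilon> / 2 * B \<le> 2 * B. The gap \<epsilon> / 2 * B
      covers it.\<close>
    define l where "l = \<epsilon> / 4"
    have l: "0 < l" "l \<le> 1" "l \<le> 1 / 4" using \<epsilon> by (auto simp: l_def)
    have "measure (samples D) E3 \<le>
        exp (l * (N * b / t + \<alpha> * N / 16) - N * (\<nu> / t + p) * (l - l\<^sup>2 / 2))"
      using False unfolding E3_def
      by (simp, intro samples_sum_lower_tail[OF D]) (use l Z01 EZ in auto)
    also have "\<dots> \<le> exp (- (\<epsilon> * \<alpha> * N / 512))"
    proof -
      have "b + \<epsilon> / 2 * B \<le> (1 + \<epsilon>) * B" using b by (simp add: field_simps)
      also have "\<dots> \<le> 2 * B" using \<epsilon> b by (intro mult_right_mono) auto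
      finally have "l / 2 * (b + \<epsilon> / 2 * B) \<le> l / 2 * (2 * B)" using l by (intro mult_left_mono) auto
      moreover have "l / 2 * (2 * B) \<le> \<epsilon> / 2 * B" using b \<epsilon> by (simp add: l_def)
      ultimately have "b \<le> (b + \<epsilon> / 2 * B) * (1 - l / 2)" by (simp add: algebra_simps)
      also have "\<dots> \<le> \<nu> * (1 - l / 2)" using False l by (intro mult_right_mono) auto
      finally have 1: "b / t \<le> \<nu> / t * (1 - l / 2)" using \<open>t > 0\<close> by (simp add: divide_right_mono)
      have 2: "p * (3 / 4) \<le> p * (1 - l / 2)" using p l by (intro mult_left_mono) auto
      have "b / t + p / 2 - (\<nu> / t + p) * (1 - l / 2) \<le> - p / 4"
        using 1 2 by (simp add: distrib_right)
      then have "N * l * (b / t + p / 2 - (\<nu> / t + p) * (1 - l / 2)) \<le> N * l * (- p / 4)"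
        using l by (intro mult_left_mono) auto
      also have "N * l * (b / t + p / 2 - (\<nu> / t + p) * (1 - l / 2)) =
          l * (N * b / t + \<alpha> * N / 16) - N * (\<nu> / t + p) * (l - l\<^sup>2 / 2)"
        by (simp add: p_def algebra_simps power2_eq_square)
      also have "N * l * (- p / 4) = - (\<epsilon> * \<alpha> * N / 128)" by (simp add: l_def p_def)
      also have "\<dots> \<le> - (\<epsilon> * \<alpha> * N / 512)" using \<epsilon>\<alpha>N(1) by linarith
      finally show ?thesis by simp
    qed
    finally show ?thesis .
  qed (simp add: E3_def)
  define E where "E = space (samples D) - (E1 \<union> E2 \<union> E3)"
  have "measure (samples D) (E1 \<union> E2 \<union> E3) \<le> 3 * exp (- (\<epsilon> * \<alpha> * N / 512))"
    using measure_Un_le[of "E1 \<union> E2" "samples D" E3] measure_Un_le[of E1 "samples D" E2] E1 E2 E3 by simp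
  then have "1 - 3 * exp (- (\<epsilon> * \<alpha> * N / 512)) \<le> measure (samples D) E"
    unfolding E_def by (subst S.prob_compl) auto
  moreover have "prob {x \<in> space D. T < X x} \<le> \<alpha> \<and>
       (\<integral>x. (if T < X x then 0 else X x) \<partial>D) \<le> b + \<epsilon> / 2 * B"
    if \<omega>: "\<omega> \<in> E" and G: "G \<subseteq> {..<N}" "N - \<alpha> * N / 16 \<le> card G" "(\<Sum>i\<in>G. X (\<omega> i)) \<le> b * card G"
      and T: "\<alpha> * N / 4 \<le> card {i \<in> {..<N}. T \<le> X (\<omega> i)}" "card {i \<in> {..<N}. T < X (\<omega> i)} < \<alpha> * N / 4"
    for \<omega> G T
  proof -
    have sp: "\<omega> i \<in> space D" for i
      using \<omega> by (auto simp: E_def samples_def space_PiM)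
    have "card {i \<in> {..<N}. t < X (\<omega> i)} < \<alpha> * N / 4" "\<alpha> * N / 4 < card {i \<in> {..<N}. s < X (\<omega> i)}"
      unfolding card_Collect_eq_sum using \<omega> by (auto simp: E_def E1_def E2_def not_le)
    then have ts: "T \<le> t" "s \<le> T"
    proof -
      show "T \<le> t"
      proof (rule ccontr)
        assume "\<not> T \<le> t"
        then have "card {i \<in> {..<N}. T \<le> X (\<omega> i)} \<le> card {i \<in> {..<N}. t < X (\<omega> i)}"
          by (intro card_mono) auto
        then show False
          using T \<open>card {i \<in> {..<N}. t < X (\<omega> i)} < \<alpha> * N / 4\<close> by linarith
      qed
      show "s \<le> T"
      proof (rule ccontr)
        assume "\<not> s \<le> T"
        then have "card {i \<in> {..<N}. s < X (\<omega> i)} \<le> card {i \<in> {..<N}. T < X (\<omega> i)}"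
          by (intro card_mono) auto
        then show False
          using T \<open>\<alpha> * N / 4 < card {i \<in> {..<N}. s < X (\<omega> i)}\<close> by linarith
      qed
    qed
    have "prob {x \<in> space D. T < X x} \<le> prob {x \<in> space D. s < X x}"
      using ts by (intro finite_measure_mono) auto
    moreover have "\<nu> \<le> b + \<epsilon> / 2 * B"
    proof (rule ccontr)
      assume neg: "\<not> \<nu> \<le> b + \<epsilon> / 2 * B"
      have fin: "finite G" using G by (auto intro: finite_subset)
      have cG: "card G \<le> N" using card_mono[OF _ G(1)] by simp
      have "\<alpha> * N \<le> N" using \<alpha> by (simp add: mult_left_le_one_le)
      then have "0 < real (card G)" using G N by linarith
      moreover have "0 \<le> (\<Sum>i\<in>G. X (\<omega> i))" using X sp by (intro sum_nonneg) auto
      \<comment> \<open>\<open>b\<close> will be a budget minus a stage-I cost; it is the existence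
        of a cheap nonempty G that makes it nonnegative.\<close>
      ultimately have "0 \<le> b * real (card G)" using G(3) by linarith
      with \<open>0 < real (card G)\<close> have "0 \<le> b" by (simp add: zero_le_mult_iff)
      have "(\<Sum>i<N. min (X (\<omega> i)) t) = (\<Sum>i\<in>G. min (X (\<omega> i)) t) + (\<Sum>i\<in>{..<N} - G. min (X (\<omega> i)) t)"
        using G by (subst sum.subset_diff[of G]) auto
      also have "\<dots> \<le> (\<Sum>i\<in>G. X (\<omega> i)) + (\<Sum>i\<in>{..<N} - G. t)"
        by (intro add_mono sum_mono) auto
      also have "\<dots> = (\<Sum>i\<in>G. X (\<omega> i)) + (N - real (card G)) * t"
        using G fin cG by (simp add: card_Diff_subset of_nat_diff)
      also have "\<dots> \<le> N * b + \<alpha> * N / 16 * t"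
      proof (rule add_mono)
        have "b * card G \<le> b * N" using \<open>0 \<le> b\<close> cG by (intro mult_left_mono) auto
        then show "(\<Sum>i\<in>G. X (\<omega> i)) \<le> N * b" using G by (simp add: mult.commute)
        show "(N - real (card G)) * t \<le> \<alpha> * N / 16 * t"
          using G \<open>t > 0\<close> by (intro mult_right_mono) auto
      qed
      finally have "(\<Sum>i<N. min (X (\<omega> i)) t) / t \<le> (N * b + \<alpha> * N / 16 * t) / t"
        using \<open>t > 0\<close> by (simp add: divide_right_mono)
      then have "(\<Sum>i<N. Z (\<omega> i)) \<le> N * b / t + \<alpha> * N / 16"
        using \<open>t > 0\<close> by (simp add: Z_def sum_divide_distrib add_divide_distrib)
      with \<omega> neg show False by (auto simp: E_def E3_def)
    qed
    moreover have "(\<integral>x. (if T < X x then 0 else X x) \<partial>D) \<le> \<nu>"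
      unfolding \<nu>_def using ts X by (intro integral_mono int) auto
    ultimately show ?thesis using s by simp
  qed
  ultimately show ?thesis by (intro bexI[of _ E]) (auto simp: E_def)
qed

section \<open>Black-box instances\<close>

text \<open>\<open>N\<close> is one less than the number of draws, a round at which the loop had not
  stopped yet. Taking logarithms gives N < 512 / (\<epsilon> * \<alpha>) * ln (3 * (q + 1) /
  \<gamma>). The logarithm is at most 4 * L1 * L2, hence 2048, and the last draw fits into
  4000.\<close>

lemma sample_count_le:
  fixes \<gamma> \<epsilon> \<alpha> :: real and n m q N :: nat
  assumes \<gamma>: "0 < \<gamma>" "\<gamma> < 1" and \<epsilon>: "0 < \<epsilon>" "\<epsilon> < 1" and \<alpha>: "0 < \<alpha>" "\<alpha> < 1"
    and nm: "1 \<le> n" "1 \<le> m"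
    and N: "\<gamma> / 3 * exp (\<epsilon> * \<alpha> / 512) ^ N < real q + 1"
  shows "real (Suc N) \<le> 4000 * sample_bound n m q \<gamma> \<epsilon> \<alpha>"
proof -
  define L1 where "L1 = Log (real n * real m * real q / \<gamma>)"
  define L2 where "L2 = Log (real n * real m / \<gamma>)"
  have L: "1 \<le> L1" "1 \<le> L2" by (auto simp: L1_def L2_def Log_def)
  have nm': "1 \<le> real n * real m" using nm mult_mono[of 1 "real n" 1 "real m"] by simp
  have ln3: "ln (3 :: real) \<le> 2" "ln (2 :: real) \<le> 1"
    using ln_le_minus_one[of "3 :: real"] ln_le_minus_one[of "2 :: real"] by auto
  have L12: "L1 \<le> L1 * L2" "L2 \<le> L1 * L2" "1 \<le> L1 * L2"
    using L mult_mono[of 1 L1 1 L2] by auto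
  have "exp (\<epsilon> * \<alpha> / 512 * N) = exp (\<epsilon> * \<alpha> / 512) ^ N"
    using exp_of_nat2_mult[of "\<epsilon> * \<alpha> / 512" N] by simp
  also have "\<dots> < 3 * (real q + 1) / \<gamma>" using N \<gamma> by (simp add: field_simps)
  finally have "\<epsilon> * \<alpha> / 512 * N < ln (3 * (real q + 1) / \<gamma>)"
    by (metis ln_less_cancel_iff ln_exp exp_gt_zero less_trans)
  also have "\<dots> = ln 3 + ln ((real q + 1) / \<gamma>)"
    using \<gamma> ln_mult[of 3 "(real q + 1) / \<gamma>"] by simp
  also have "\<dots> \<le> 4 * (L1 * L2)"
  proof (cases "q = 0")
    case True
    \<comment> \<open>For q = 0 the first logarithm carries no information on \<gamma>, so the
      second one absorbs 1 / \<gamma>.\<close>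
    have "1 / \<gamma> \<le> real n * real m / \<gamma>" using nm' \<gamma> by (simp add: divide_right_mono)
    then have "ln (1 / \<gamma>) \<le> ln (real n * real m / \<gamma>)" using \<gamma> nm' by (subst ln_le_cancel_iff) auto
    also have "\<dots> \<le> L2" by (simp add: L2_def Log_def)
    finally show ?thesis using True ln3 L12 by simp
  next
    case False
    then have "1 \<le> real q" by simp
    moreover have "real q \<le> real n * real m * real q"
      using nm' mult_right_mono[of 1 "real n * real m" "real q"] by simp
    ultimately have "real q + 1 \<le> 2 * (real n * real m * real q)" by linarith
    then have "(real q + 1) / \<gamma> \<le> 2 * (real n * real m * real q) / \<gamma>"
      using \<gamma> by (intro divide_right_mono) auto
    then have "(real q + 1) / \<gamma> \<le> 2 * (real n * real m * real q / \<gamma>)" by simp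
    then have "ln ((real q + 1) / \<gamma>) \<le> ln (2 * (real n * real m * real q / \<gamma>))"
      using \<gamma> nm' False by (subst ln_le_cancel_iff) (auto intro!: mult_pos_pos divide_pos_pos)
    also have "\<dots> = ln 2 + ln (real n * real m * real q / \<gamma>)"
      using \<gamma> nm False by (subst ln_mult) (auto intro!: mult_pos_pos divide_pos_pos)
    also have "\<dots> \<le> 1 + L1" using ln3 by (simp add: L1_def Log_def)
    finally show ?thesis using ln3 L12 by simp
  qed
  finally have "real N \<le> 2048 * (1 / (\<epsilon> * \<alpha>) * (L1 * L2))"
    using \<epsilon> \<alpha> by (simp add: field_simps)
  moreover define u where "u = 1 / (\<epsilon> * \<alpha>) * (L1 * L2)"
  moreover have "1 \<le> 1 / (\<epsilon> * \<alpha>) * (L1 * L2)"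
  proof -
    have "\<epsilon> * \<alpha> \<le> 1" using \<epsilon> \<alpha> by (simp add: mult_le_one)
    then have "1 \<le> 1 / (\<epsilon> * \<alpha>)" using \<epsilon> \<alpha> by (simp add: le_divide_eq)
    then show ?thesis using L12 \<epsilon> \<alpha> mult_mono[of 1 "1 / (\<epsilon> * \<alpha>)" 1 "L1 * L2"] by simp
  qed
  ultimately have "real (Suc N) \<le> 4000 * (1 / (\<epsilon> * \<alpha>) * (L1 * L2))"
    unfolding of_nat_Suc u_def[symmetric] by linarith
  then show ?thesis
    unfolding sample_bound_def L1_def[symmetric] L2_def[symmetric] by (simp add: mult.assoc)
qed

section \<open>Costs, coverage and truncation on a fixed black-box instance\<close>

context
  fixes P I D
  assumes bb: "bb_instance P I D"
begin

lemma bb_facts: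
  shows "valid_inst P I" "prob_space D" "space D \<subseteq> scenarios I"
    "finite (clients I)" "finite (facilities I)" "0 \<le> budget I"
  using bb by (auto simp: bb_instance_def valid_inst_def)

lemma stage2_cost_nonneg:
  assumes "A \<in> space D" "snd s A \<subseteq> facilities I"
  shows "0 \<le> stage2_cost s A"
proof -
  have "snd A \<in> facilities I \<rightarrow>\<^sub>E {0..}"
    using subsetD[OF bb_facts(3) assms(1)] by (auto simp: scenarios_def mem_Times_iff)
  then show ?thesis
    unfolding stage2_cost_def using assms(2) by (intro sum_nonneg) (auto simp: PiE_iff)
qed

lemma stage1_cost_nonneg: "fst s \<in> allowed I \<Longrightarrow> 0 \<le> stage1_cost I s"
  using allowed_subset[OF bb_facts(1)] bb_facts(1)
  by (auto simp: stage1_cost_def valid_inst_def intro!: sum_nonneg)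

lemma stage2_cost_measurable:
  assumes m: "snd s \<in> measurable D (count_space UNIV)" and sub: "\<And>A. A \<in> space D \<Longrightarrow> snd s A \<subseteq> facilities I"
  shows "stage2_cost s \<in> borel_measurable D"
proof -
  have [measurable]: "(\<lambda>A. i \<in> snd s A) \<in> measurable D (count_space UNIV)" for i
    using measurable_compose[OF m, of "\<lambda>Y. i \<in> Y"] by simp
  have "(\<lambda>A. if i \<in> snd s A then snd A i else 0) \<in> borel_measurable D" if "i \<in> facilities I" for i
    using bb that by (intro measurable_If) (auto simp: bb_instance_def)
  then have "(\<lambda>A. \<Sum>i\<in>facilities I. if i \<in> snd s A then snd A i else 0) \<in> borel_measurable D"
    by (intro borel_measurable_sum) auto
  moreover have "(\<Sum>i\<in>facilities I. if i \<in> snd s A then snd A i else 0) = stage2_cost s A"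
    if "A \<in> space D" for A
    unfolding stage2_cost_def using sub[OF that] bb_facts(5)
    by (intro sum.mono_neutral_cong_right) auto
  ultimately show ?thesis by (subst measurable_cong) (auto simp: fun_eq_iff)
qed

text \<open>The set of good scenarios has to be measurable, since \<open>measure\<close> vanishes on other sets.\<close>

lemma coverage_measurable:
  assumes m: "snd s \<in> measurable D (count_space UNIV)" and sub: "\<And>A. A \<in> space D \<Longrightarrow> snd s A \<subseteq> facilities I"
  shows "{A \<in> space D. Q (fst A) (snd s A)} \<in> sets D"
proof -
  have f: "fst \<in> measurable D (count_space UNIV)" using bb by (simp add: bb_instance_def)
  \<comment> \<open>Only finitely many pairs of a client set and a facility set occur, and each is
    pulled back by measurable maps into discrete spaces.\<close>
  have "{A \<in> space D. Q (fst A) (snd s A)} =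
    (\<Union>(X, Y)\<in>{(X, Y) \<in> Pow (clients I) \<times> Pow (facilities I). Q X Y}.
       (fst -` {X} \<inter> space D) \<inter> (snd s -` {Y} \<inter> space D))"
    using sub bb_facts(3) by (fastforce simp: scenarios_def)
  also have "\<dots> \<in> sets D"
  proof (rule sets.finite_UN)
    show "finite {(X, Y) \<in> Pow (clients I) \<times> Pow (facilities I). Q X Y}"
      using bb_facts(4,5) by (auto intro: finite_subset[of _ "Pow (clients I) \<times> Pow (facilities I)"])
    show "(case z of (X, Y) \<Rightarrow> (fst -` {X} \<inter> space D) \<inter> (snd s -` {Y} \<inter> space D)) \<in> sets D" for z
      using measurable_sets[OF f] measurable_sets[OF m] by (cases z) auto
  qed
  finally show ?thesis .
qed

lemma maxdist_le_imp_covered: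
  assumes "maxdist I s A \<le> ereal \<eta>" "j \<in> fst A" "A \<in> space D"
  shows "dist_to I j (fst s \<union> snd s A) \<le> ereal (\<eta> * radius I j)"
proof -
  have "j \<in> clients I"
    using subsetD[OF bb_facts(3) assms(3)] assms(2) by (auto simp: scenarios_def mem_Times_iff)
  then have R: "0 \<le> radius I j"
    using bb_facts(1) by (simp add: valid_inst_def)
  have le: "dist_to I j (fst s \<union> snd s A) / ereal (radius I j) \<le> ereal \<eta>"
    using assms(1,2) unfolding maxdist_def by (meson SUP_upper order_trans)
  show ?thesis
  proof (cases "radius I j = 0")
    case True
    \<comment> \<open>At radius 0 a positive distance would make the quotient infinite.\<close>
    have "dist_to I j (fst s \<union> snd s A) \<le> 0"
    proof (rule ccontr)
      assume "\<not> dist_to I j (fst s \<union> snd s A) \<le> 0"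
      then have "dist_to I j (fst s \<union> snd s A) / ereal (radius I j) = \<infinity>"
        using True by (auto simp: divide_ereal_def not_le)
      with le show False by simp
    qed
    then show ?thesis using True by (simp add: zero_ereal_def)
  next
    case False
    with R have "0 < ereal (radius I j)" by simp
    with le show ?thesis
      by (subst (asm) ereal_divide_le_pos) (auto simp: mult.commute)
  qed
qed

text \<open>Truncation changes only scenarios whose extended stage-II cost exceeds T. All others
  keep the distance guarantee of the extension, so the coverage failure is at most the tail
  mass.\<close>

lemma truncated_strategy:
  fixes \<alpha> \<eta> b C T :: real
  assumes dec: "\<And>Q v F L s T a c e. runs Q ext (VPair L (VPair s (VPair a c))) e \<Longrightarrow>
      runs Q dec (VPair v (VPair (VPair F (VPair (VPair L s) T)) (VPair a c)))
        (if vless T (vdot e c) = VNum 1 then vzero e else e)"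
    and ext: "sample_free ext" "extends_to ext (I\<lparr>budget := b\<rparr>) (space D) L s s'"
    and s: "fst s \<in> allowed I" and s': "snd s' \<in> measurable D (count_space UNIV)"
    and near: "\<And>A. A \<in> space D \<Longrightarrow> maxdist I s' A \<le> ereal \<eta>"
    and T: "measure D {A \<in> space D. T < stage2_cost s' A} \<le> \<alpha>"
      "stage1_cost I s' + (\<integral>A. (if T < stage2_cost s' A then 0 else stage2_cost s' A) \<partial>D) \<le> C"
    and out: "out = VPair (enc_subset (facilities I) (fst s))
      (VPair (VPair (enc_poly (I\<lparr>budget := b\<rparr>) L) (enc_strategy (I\<lparr>budget := b\<rparr>) L s)) (VNum T))"
  shows "\<exists>s. bb_outputs dec I D inp out s \<and> integrable D (stage2_cost s) \<and>
      stage1_cost I s + (\<integral>A. stage2_cost s A \<partial>D) \<le> C \<and>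
      measure D {A \<in> space D. \<forall>j\<in>fst A. dist_to I j (fst s \<union> snd s A) \<le> ereal (\<eta> * radius I j)} \<ge> 1 - \<alpha>"
proof -
  interpret D: prob_space D by (rule bb_facts)
  have sub: "snd s' A \<subseteq> facilities I" if "A \<in> space D" for A
    using ext(2) that by (auto simp: extends_to_def)
  note X [measurable] = stage2_cost_measurable[OF s' sub]
  have fst: "fst s' = fst s" using ext(2) by (simp add: extends_to_def)
  define u where "u = (fst s', \<lambda>A. if T < stage2_cost s' A then {} else snd s' A)"
  have u2: "stage2_cost u = (\<lambda>A. if T < stage2_cost s' A then 0 else stage2_cost s' A)"
    by (auto simp: u_def stage2_cost_def)
  have um: "snd u \<in> measurable D (count_space UNIV)"
    unfolding u_def snd_conv using s' by (intro measurable_If) auto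
  have usub: "snd u A \<subseteq> facilities I" if "A \<in> space D" for A
    using sub[OF that] by (auto simp: u_def)
  have "runs (allowed_query I) dec (VPair inp (VPair out (enc_scenario I A))) (enc_subset (facilities I) (snd u A))"
    if A: "A \<in> space D" for A
  proof -
    have "runs (allowed_query I) ext (enc_extension (I\<lparr>budget := b\<rparr>) L s A) (enc_subset (facilities I) (snd s' A))"
      using ext A by (auto simp: extends_to_def intro: run_imp_runs)
    then have "runs (allowed_query I) dec (VPair inp (VPair out (enc_scenario I A)))
        (if vless (VNum T) (vdot (enc_subset (facilities I) (snd s' A)) (vsnd (enc_scenario I A))) = VNum 1
         then vzero (enc_subset (facilities I) (snd s' A)) else enc_subset (facilities I) (snd s' A))"
      unfolding out using dec[of "allowed_query I" "enc_poly (I\<lparr>budget := b\<rparr>) L"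
          "enc_strategy (I\<lparr>budget := b\<rparr>) L s"]
      by (simp add: enc_extension_def enc_scenario_def del: apply_prim.simps(11))
    then show ?thesis
      using vdot_enc_scenario[OF bb_facts(5) sub[OF A]]
      by (simp add: vzero_enc_subset u_def split: if_splits del: apply_prim.simps(11))
  qed
  then have 1: "bb_outputs dec I D inp out u"
    using s um usub fst runs_imp_run
    by (fastforce simp: bb_outputs_def is_strategy_def out u_def)
  \<comment> \<open>Truncated costs are bounded by \<open>max 0 T\<close>; the extended strategy
    itself may have an infinite mean.\<close>
  have 2: "integrable D (stage2_cost u)"
    unfolding u2 by (rule D.integrable_const_bound[of _ "max 0 T"])
      (use stage2_cost_nonneg sub in auto)
  have 3: "stage1_cost I u + (\<integral>A. stage2_cost u A \<partial>D) \<le> C"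
    using T(2) by (simp add: u2) (simp add: stage1_cost_def u_def)
  have "1 - \<alpha> \<le> measure D (space D - {A \<in> space D. T < stage2_cost s' A})"
    using T(1) by (subst D.prob_compl) auto
  also have "\<dots> \<le> measure D {A \<in> space D. \<forall>j\<in>fst A. dist_to I j (fst u \<union> snd u A) \<le> ereal (\<eta> * radius I j)}"
  proof (rule D.finite_measure_mono)
    show "space D - {A \<in> space D. T < stage2_cost s' A} \<subseteq>
        {A \<in> space D. \<forall>j\<in>fst A. dist_to I j (fst u \<union> snd u A) \<le> ereal (\<eta> * radius I j)}"
      using maxdist_le_imp_covered[OF near] by (auto simp: u_def)
    show "{A \<in> space D. \<forall>j\<in>fst A. dist_to I j (fst u \<union> snd u A) \<le> ereal (\<eta> * radius I j)} \<in> sets D"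
      by (rule coverage_measurable[OF um usub,
          of "\<lambda>X Y. \<forall>j\<in>X. dist_to I j (fst u \<union> Y) \<le> ereal (\<eta> * radius I j)"])
  qed
  finally show ?thesis using 1 2 3 by blast
qed

text \<open>An optimal strategy for D also serves the listed scenarios, as they belong to the space
  of D. Hence INFEASIBLE on a cheap candidate contradicts the guarantee of
  \<open>alg\<close>.\<close>

lemma feasible_uniform_list:
  fixes b :: real
  assumes s: "is_strategy I D (space D) s" "\<And>A. A \<in> space D \<Longrightarrow> maxdist I s A \<le> 1"
    and c: "c \<noteq> []" "distinct c" "set c \<subseteq> space D" "(\<Sum>A\<in>set c. cost I s A) \<le> b * real (length c)"
  shows "feasible (I\<lparr>budget := b\<rparr>) (measure_pmf (pmf_of_list (uniform_list c))) (set c)"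
proof -
  have "within_budget (I\<lparr>budget := b\<rparr>) (measure_pmf (pmf_of_list (uniform_list c))) s"
    using c by (subst within_budget_uniform_list) auto
  then show ?thesis
    unfolding feasible_def using s c(3)
    by (intro exI[of _ s]) (auto simp: is_strategy_def)
qed

end

text \<open>Distinctness of the samples is built into the event: equal scenarios would have equal
  costs, so continuity for one potential strategy already forces it. The bound on the trimmed mean
  is applied with the relaxed budget minus the stage-I cost.\<close>

lemma strategy_event:
  fixes \<epsilon> \<alpha> :: real and N :: nat
  assumes bb: "bb_instance P I D" and cc: "continuous_costs alg ext \<epsilon> I D"
    and \<epsilon>: "0 < \<epsilon>" "\<epsilon> < 1" and \<alpha>: "0 < \<alpha>" "\<alpha> < 1" and N: "0 < N"
    and s: "s \<in> potential_strategies alg ext (I\<lparr>budget := (1 + \<epsilon> / 2) * budget I\<rparr>) (space D)"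
  shows "\<exists>E\<in>sets (samples D). 1 - 3 * exp (- (\<epsilon> * \<alpha> * N / 512)) \<le> measure (samples D) E \<and>
    (\<forall>\<omega>\<in>E. inj_on \<omega> {..<N} \<and>
      (\<forall>G T. G \<subseteq> {..<N} \<longrightarrow> N - \<alpha> * N / 16 \<le> card G \<longrightarrow>
         (\<Sum>i\<in>G. cost I s (\<omega> i)) \<le> (1 + \<epsilon> / 2) * budget I * card G \<longrightarrow>
         \<alpha> * N / 4 \<le> card {i \<in> {..<N}. T \<le> stage2_cost s (\<omega> i)} \<longrightarrow>
         card {i \<in> {..<N}. T < stage2_cost s (\<omega> i)} < \<alpha> * N / 4 \<longrightarrow>
         measure D {A \<in> space D. T < stage2_cost s A} \<le> \<alpha> \<and>
         stage1_cost I s + (\<integral>A. (if T < stage2_cost s A then 0 else stage2_cost s A) \<partial>D)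
           \<le> (1 + \<epsilon>) * budget I))"
proof -
  note facts = bb_facts[OF bb]
  interpret D: prob_space D by (rule facts)
  interpret S: prob_space "samples D"
    unfolding samples_def by (rule prob_space_PiM) (rule facts)
  define X where "X = stage2_cost s"
  have "(1 + \<epsilon> / 2) * budget I \<in> {budget I..(1 + \<epsilon>) * budget I}"
    using \<epsilon> facts(6) by (auto simp: algebra_simps)
  then have m: "snd s \<in> measurable D (count_space UNIV)"
    and cont: "continuous_on UNIV (cdf (distr D borel (cost I s)))"
    using cc s unfolding continuous_costs_def by blast+
  have sub: "snd s A \<subseteq> facilities I" if "A \<in> space D" for A
    using s that by (auto simp: potential_strategies_def extends_to_def)
  have X [measurable]: "X \<in> borel_measurable D"
    unfolding X_def by (rule stage2_cost_measurable[OF bb m sub])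
  have cost: "cost I s = (\<lambda>A. stage1_cost I s + X A)" by (auto simp: cost_def X_def)
  \<comment> \<open>The stage-I cost is a constant shift, so the stage-II cost inherits the absence
    of atoms.\<close>
  have null: "AE A in D. X A \<noteq> c" for c
  proof -
    interpret R: real_distribution "distr D borel (cost I s)"
      by (rule D.real_distribution_distr) (simp add: cost)
    have "isCont (cdf (distr D borel (cost I s))) (stage1_cost I s + c)"
      using cont by (simp add: continuous_on_eq_continuous_at)
    then have "measure (distr D borel (cost I s)) {stage1_cost I s + c} = 0"
      by (simp add: R.isCont_cdf)
    then have "D.prob {A \<in> space D. X A = c} = 0"
      by (simp add: measure_distr cost vimage_def Int_def conj_commute)
    then show ?thesis
      by (subst (asm) D.prob_eq_0) (auto simp: D.prob_eq_0)
  qed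
  have X0: "0 \<le> X A" if "A \<in> space D" for A
    unfolding X_def using stage2_cost_nonneg[OF bb that sub[OF that]] .
  have s10: "0 \<le> (1 + \<epsilon> / 2) * budget I" "0 \<le> budget I" using facts \<epsilon> by auto
  have fs: "fst s \<subseteq> facilities I"
    using s by (auto simp: potential_strategies_def extends_to_def returns_def)
  have "0 \<le> stage1_cost I s"
    using fs facts(1) by (auto simp: stage1_cost_def valid_inst_def intro!: sum_nonneg)
  then obtain E where E: "E \<in> sets (samples D)" "1 - 3 * exp (- (\<epsilon> * \<alpha> * N / 512)) \<le> measure (samples D) E"
    and good: "\<And>\<omega> G T. \<omega> \<in> E \<Longrightarrow> G \<subseteq> {..<N} \<Longrightarrow> N - \<alpha> * N / 16 \<le> card G \<Longrightarrow>
       (\<Sum>i\<in>G. X (\<omega> i)) \<le> ((1 + \<epsilon> / 2) * budget I - stage1_cost I s) * card G \<Longrightarrow>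
       \<alpha> * N / 4 \<le> card {i \<in> {..<N}. T \<le> X (\<omega> i)} \<Longrightarrow> card {i \<in> {..<N}. T < X (\<omega> i)} < \<alpha> * N / 4 \<Longrightarrow>
       measure D {x \<in> space D. T < X x} \<le> \<alpha> \<and>
       (\<integral>x. (if T < X x then 0 else X x) \<partial>D) \<le> ((1 + \<epsilon> / 2) * budget I - stage1_cost I s) + \<epsilon> / 2 * budget I"
    using samples_trimmed_mean[OF facts(2) X X0 null \<alpha> \<epsilon> N,
        of "(1 + \<epsilon> / 2) * budget I - stage1_cost I s" "budget I"] s10 by fastforce
  define E' where "E' = {\<omega> \<in> space (samples D). \<forall>i\<in>{..<N}. \<forall>j\<in>{..<N}. i < j \<longrightarrow> X (\<omega> i) \<noteq> X (\<omega> j)}"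
  have "AE \<omega> in samples D. i < j \<longrightarrow> X (\<omega> i) \<noteq> X (\<omega> j)" for i j
    using samples_AE_neq[OF facts(2) X null, of i j] by (cases "i < j") auto
  then have "AE \<omega> in samples D. \<forall>i\<in>{..<N}. \<forall>j\<in>{..<N}. i < j \<longrightarrow> X (\<omega> i) \<noteq> X (\<omega> j)"
    by (intro AE_finite_allI) auto
  then have "AE \<omega> in samples D. \<omega> \<in> E \<longleftrightarrow> \<omega> \<in> E \<inter> E'"
    using AE_space by eventually_elim (simp add: E'_def)
  moreover have E' [measurable]: "E' \<in> sets (samples D)"
    unfolding E'_def by (rule samples_inequations_measurable[OF X])
  ultimately have "measure (samples D) E = measure (samples D) (E \<inter> E')"
    using E(1) by (intro S.finite_measure_eq_AE) auto
  moreover have "inj_on \<omega> {..<N}" if "\<omega> \<in> E'" for \<omega>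
  proof (rule inj_onI)
    fix i j assume "i \<in> {..<N}" "j \<in> {..<N}" "\<omega> i = \<omega> j"
    with that show "i = j" by (cases i j rule: linorder_cases) (fastforce simp: E'_def)+
  qed
  moreover have "measure D {A \<in> space D. T < X A} \<le> \<alpha> \<and>
       stage1_cost I s + (\<integral>A. (if T < X A then 0 else X A) \<partial>D) \<le> (1 + \<epsilon>) * budget I"
    if "\<omega> \<in> E" "G \<subseteq> {..<N}" "N - \<alpha> * N / 16 \<le> card G"
      "(\<Sum>i\<in>G. cost I s (\<omega> i)) \<le> (1 + \<epsilon> / 2) * budget I * card G"
      "\<alpha> * N / 4 \<le> card {i \<in> {..<N}. T \<le> X (\<omega> i)}" "card {i \<in> {..<N}. T < X (\<omega> i)} < \<alpha> * N / 4"
    for \<omega> G T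
  proof -
    have "(\<Sum>i\<in>G. X (\<omega> i)) \<le> ((1 + \<epsilon> / 2) * budget I - stage1_cost I s) * card G"
      using that(4) by (simp add: cost sum.distrib algebra_simps)
    from good[OF that(1-3) this that(5,6)] show ?thesis by (simp add: algebra_simps)
  qed
  ultimately show ?thesis
    using E E' unfolding X_def by (intro bexI[of _ "E \<inter> E'"] conjI ballI) auto
qed

lemma length_filter_upt: "length (filter P (map f [0..<N])) = card {i \<in> {..<N}. P (f i)}"
proof -
  have "{i \<in> {..<N}. P (f i)} = set (filter (P \<circ> f) [0..<N])" by auto
  then show ?thesis by (simp add: filter_map distinct_card del: set_filter)
qed

lemma efficiently_generalizable_card:
  assumes "efficiently_generalizable P alg ext \<eta> \<psi>" "valid_inst P I" "\<Omega> \<subseteq> scenarios I" "0 \<le> b"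
  shows "finite (potential_strategies alg ext (I\<lparr>budget := b\<rparr>) \<Omega>) \<and>
    card (potential_strategies alg ext (I\<lparr>budget := b\<rparr>) \<Omega>) \<le> \<psi> I \<Omega>"
proof -
  have "\<forall>I \<Omega>. valid_inst P I \<longrightarrow> \<Omega> \<subseteq> scenarios I \<longrightarrow>
        (\<forall>b\<ge>0. finite (potential_strategies alg ext (I\<lparr>budget := b\<rparr>) \<Omega>) \<and>
                card (potential_strategies alg ext (I\<lparr>budget := b\<rparr>) \<Omega>) \<le> \<psi> I \<Omega>)"
    using assms(1) unfolding efficiently_generalizable_def by (elim conjE)
  from this[rule_format, OF assms(2-4)] show ?thesis .
qed

text \<open>The failure probability is 2 * \<delta> on the feasible side plus 3 * \<delta> for each
  potential strategy of the relaxed budget. The claim covers every result that meets the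
  specification, so measurability of the output as a function of the samples never comes up.\<close>

lemma good_event:
  fixes \<epsilon> \<alpha> \<gamma> :: real and N :: nat
  assumes alg: "approximation_algorithm P alg \<eta>" and gen: "efficiently_generalizable P alg ext \<eta> \<psi>"
    and bb: "bb_instance P I D" and cc: "continuous_costs alg ext \<epsilon> I D"
    and \<epsilon>: "0 < \<epsilon>" "\<epsilon> < 1" and \<alpha>: "0 < \<alpha>" "\<alpha> < 1" and N: "32 \<le> \<alpha> * N"
    and \<gamma>: "3 * (real (\<psi> I (space D)) + 1) * exp (- (\<epsilon> * \<alpha> * N / 512)) \<le> \<gamma>"
    and dec: "\<And>Q v F L s T a c e. runs Q ext (VPair L (VPair s (VPair a c))) e \<Longrightarrow>
      runs Q dec (VPair v (VPair (VPair F (VPair (VPair L s) T)) (VPair a c)))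
        (if vless T (vdot e c) = VNum 1 then vzero e else e)"
  shows "\<exists>E\<in>sets (samples D). measure (samples D) E \<ge> 1 - \<gamma> \<and>
    (\<forall>\<omega>\<in>E. \<forall>res. solver_spec alg ext \<eta> (I\<lparr>budget := (1 + \<epsilon> / 2) * budget I\<rparr>) (space D)
        (1 - \<alpha> / 16) (\<alpha> / 4) (map \<omega> (rev [0..<N])) res \<longrightarrow>
      (\<exists>s. bb_outputs dec I D inp res s \<and> integrable D (stage2_cost s) \<and>
         stage1_cost I s + (\<integral>A. stage2_cost s A \<partial>D) \<le> (1 + \<epsilon>) * budget I \<and>
         measure D {A \<in> space D. \<forall>j\<in>fst A.
             dist_to I j (fst s \<union> snd s A) \<le> ereal (\<eta> * radius I j)} \<ge> 1 - \<alpha>) \<or>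
      (res = INFEASIBLE \<and> \<not> feasible I D (space D)))"
proof -
  note facts = bb_facts[OF bb]
  interpret S: prob_space "samples D"
    unfolding samples_def by (rule prob_space_PiM) (rule facts)
  define b where "b = (1 + \<epsilon> / 2) * budget I"
  define I' where "I' = I\<lparr>budget := b\<rparr>"
  define \<delta> where "\<delta> = exp (- (\<epsilon> * \<alpha> * N / 512))"
  have b0: "0 \<le> b" using \<epsilon> facts(6) by (simp add: b_def)
  have I': "valid_inst P I'" unfolding I'_def by (rule valid_inst_budget_update[OF facts(1) b0])
  have N0: "0 < N" using N by (cases N) auto
  define S where "S = potential_strategies alg ext I' (space D)"
  have S: "finite S" "card S \<le> \<psi> I (space D)"
    unfolding S_def I'_def using efficiently_generalizable_card[OF gen facts(1,3) b0] by simp_all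
  have ext: "sample_free ext" using gen by (simp add: efficiently_generalizable_def)
  have "\<forall>s\<in>S. \<exists>E. E \<in> sets (samples D) \<and> 1 - 3 * \<delta> \<le> measure (samples D) E \<and>
    (\<forall>\<omega>\<in>E. inj_on \<omega> {..<N} \<and>
      (\<forall>G T. G \<subseteq> {..<N} \<longrightarrow> N - \<alpha> * N / 16 \<le> card G \<longrightarrow>
         (\<Sum>i\<in>G. cost I s (\<omega> i)) \<le> b * card G \<longrightarrow>
         \<alpha> * N / 4 \<le> card {i \<in> {..<N}. T \<le> stage2_cost s (\<omega> i)} \<longrightarrow>
         card {i \<in> {..<N}. T < stage2_cost s (\<omega> i)} < \<alpha> * N / 4 \<longrightarrow>
         measure D {A \<in> space D. T < stage2_cost s A} \<le> \<alpha> \<and>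
         stage1_cost I s + (\<integral>A. (if T < stage2_cost s A then 0 else stage2_cost s A) \<partial>D)
           \<le> (1 + \<epsilon>) * budget I))"
    using strategy_event[OF bb cc \<epsilon> \<alpha> N0] unfolding S_def I'_def b_def \<delta>_def by blast
  from bchoice[OF this] obtain Es where Es_all: "\<forall>s\<in>S. Es s \<in> sets (samples D) \<and>
    1 - 3 * \<delta> \<le> measure (samples D) (Es s) \<and>
    (\<forall>\<omega>\<in>Es s. inj_on \<omega> {..<N} \<and>
      (\<forall>G T. G \<subseteq> {..<N} \<longrightarrow> N - \<alpha> * N / 16 \<le> card G \<longrightarrow>
         (\<Sum>i\<in>G. cost I s (\<omega> i)) \<le> b * card G \<longrightarrow>
         \<alpha> * N / 4 \<le> card {i \<in> {..<N}. T \<le> stage2_cost s (\<omega> i)} \<longrightarrow>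
         card {i \<in> {..<N}. T < stage2_cost s (\<omega> i)} < \<alpha> * N / 4 \<longrightarrow>
         measure D {A \<in> space D. T < stage2_cost s A} \<le> \<alpha> \<and>
         stage1_cost I s + (\<integral>A. (if T < stage2_cost s A then 0 else stage2_cost s A) \<partial>D)
           \<le> (1 + \<epsilon>) * budget I))" ..
  have Es: "Es s \<in> sets (samples D)" "1 - 3 * \<delta> \<le> measure (samples D) (Es s)" if "s \<in> S" for s
    using bspec[OF Es_all that] by simp_all
  have inj: "inj_on \<omega> {..<N}" if "s \<in> S" "\<omega> \<in> Es s" for s \<omega>
    using bspec[OF Es_all that(1)] that(2) by simp
  have good: "measure D {A \<in> space D. T < stage2_cost s A} \<le> \<alpha> \<and>
         stage1_cost I s + (\<integral>A. (if T < stage2_cost s A then 0 else stage2_cost s A) \<partial>D)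
           \<le> (1 + \<epsilon>) * budget I"
    if "s \<in> S" "\<omega> \<in> Es s" "G \<subseteq> {..<N}" "N - \<alpha> * N / 16 \<le> card G" "(\<Sum>i\<in>G. cost I s (\<omega> i)) \<le> b * card G"
      "\<alpha> * N / 4 \<le> card {i \<in> {..<N}. T \<le> stage2_cost s (\<omega> i)}"
      "card {i \<in> {..<N}. T < stage2_cost s (\<omega> i)} < \<alpha> * N / 4" for s \<omega> G T
    using bspec[OF Es_all that(1), THEN conjunct2, THEN conjunct2, rule_format, OF that(2), THEN conjunct2,
        rule_format, OF that(3-7)] .
  have "\<exists>E\<in>sets (samples D). 1 - 2 * \<delta> \<le> measure (samples D) E \<and>
    (feasible I D (space D) \<longrightarrow> (\<exists>s. is_strategy I D (space D) s \<and> (\<forall>A\<in>space D. maxdist I s A \<le> 1) \<and>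
      (\<forall>\<omega>\<in>E. \<exists>G\<subseteq>{..<N}. N - \<alpha> * N / 16 \<le> card G \<and> (\<Sum>i\<in>G. cost I s (\<omega> i)) \<le> b * card G)))"
  proof (cases "feasible I D (space D)")
    case True
    then obtain s where s: "is_strategy I D (space D) s" "within_budget I D s" "\<forall>A\<in>space D. maxdist I s A \<le> 1"
      by (auto simp: feasible_def)
    have "0 \<le> cost I s A" if "A \<in> space D" for A
      using s(1) stage1_cost_nonneg[OF bb, of s] stage2_cost_nonneg[OF bb that, of s] that
      by (simp add: cost_def is_strategy_def)
    moreover have cs: "integrable D (cost I s)" "(\<integral>A. cost I s A \<partial>D) \<le> budget I"
      using s(2) by (simp_all add: within_budget_def)
    ultimately obtain E where "E \<in> sets (samples D)" "1 - 2 * \<delta> \<le> measure (samples D) E"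
      "\<forall>\<omega>\<in>E. \<exists>G\<subseteq>{..<N}. N - \<alpha> * N / 16 \<le> card G \<and> (\<Sum>i\<in>G. cost I s (\<omega> i)) \<le> b * card G"
      using samples_cheap_subset[OF facts(2) borel_measurable_integrable[OF cs(1)] _ cs \<alpha> \<epsilon> N]
      unfolding b_def \<delta>_def by auto
    then show ?thesis using s(1,3) by (intro bexI[of _ E] conjI impI exI[of _ s])
  next
    case False
    \<comment> \<open>For an infeasible instance the clause is void and the whole space is
      taken.\<close>
    have "1 - 2 * \<delta> \<le> measure (samples D) (space (samples D))" by (simp add: S.prob_space \<delta>_def)
    with False show ?thesis by blast
  qed
  then obtain E1 where E1: "E1 \<in> sets (samples D)" "1 - 2 * \<delta> \<le> measure (samples D) E1"
    and cheap: "feasible I D (space D) \<Longrightarrow> \<exists>s. is_strategy I D (space D) s \<and> (\<forall>A\<in>space D. maxdist I s A \<le> 1) \<and>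
      (\<forall>\<omega>\<in>E1. \<exists>G\<subseteq>{..<N}. N - \<alpha> * N / 16 \<le> card G \<and> (\<Sum>i\<in>G. cost I s (\<omega> i)) \<le> b * card G)"
    by blast
  define bad where "bad = (space (samples D) - E1) \<union> (\<Union>s\<in>S. space (samples D) - Es s)"
  define E where "E = space (samples D) - bad"
  have bad: "bad \<in> sets (samples D)" unfolding bad_def
    by (intro sets.Un sets.finite_UN sets.Diff sets.top E1 Es S)
  have "measure (samples D) (\<Union>s\<in>S. space (samples D) - Es s) \<le> (\<Sum>s\<in>S. measure (samples D) (space (samples D) - Es s))"
    using S Es by (intro S.finite_measure_subadditive_finite) auto
  also have "\<dots> \<le> (\<Sum>s\<in>S. 3 * \<delta>)"
  proof (rule sum_mono)
    fix s assume "s \<in> S"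
    then show "measure (samples D) (space (samples D) - Es s) \<le> 3 * \<delta>"
      using S.prob_compl[OF Es(1)] Es(2)[of s] by simp
  qed
  also have "\<dots> \<le> real (\<psi> I (space D)) * (3 * \<delta>)"
    using S(2) by (simp add: \<delta>_def)
  finally have le: "measure (samples D) (\<Union>s\<in>S. space (samples D) - Es s) \<le> real (\<psi> I (space D)) * (3 * \<delta>)" .
  have "measure (samples D) bad \<le> 2 * \<delta> + real (\<psi> I (space D)) * (3 * \<delta>)"
  proof -
    have "measure (samples D) bad \<le> measure (samples D) (space (samples D) - E1) +
        measure (samples D) (\<Union>s\<in>S. space (samples D) - Es s)"
      unfolding bad_def by (intro measure_Un_le sets.finite_UN sets.Diff sets.top E1 Es S)
    then show ?thesis using le S.prob_compl[OF E1(1)] E1(2) by simp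
  qed
  also have "\<dots> \<le> 3 * (real (\<psi> I (space D)) + 1) * \<delta>" by (simp add: \<delta>_def algebra_simps)
  also have "\<dots> \<le> \<gamma>" using \<gamma> by (simp add: \<delta>_def)
  finally have E: "E \<in> sets (samples D)" "1 - \<gamma> \<le> measure (samples D) E"
    unfolding E_def using bad by (auto simp: S.prob_compl)
  have "(\<exists>s. bb_outputs dec I D inp res s \<and> integrable D (stage2_cost s) \<and>
         stage1_cost I s + (\<integral>A. stage2_cost s A \<partial>D) \<le> (1 + \<epsilon>) * budget I \<and>
         measure D {A \<in> space D. \<forall>j\<in>fst A.
             dist_to I j (fst s \<union> snd s A) \<le> ereal (\<eta> * radius I j)} \<ge> 1 - \<alpha>) \<or>
      (res = INFEASIBLE \<and> \<not> feasible I D (space D))"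
    if \<omega>: "\<omega> \<in> E" and spec: "solver_spec alg ext \<eta> I' (space D)
        (1 - \<alpha> / 16) (\<alpha> / 4) (map \<omega> (rev [0..<N])) res" for \<omega> res
  proof -
    define xs where "xs = map \<omega> (rev [0..<N])"
    have sp: "\<omega> i \<in> space D" for i using \<omega> by (auto simp: E_def samples_def space_PiM)
    have xs: "set xs = \<omega> ` {..<N}" "length xs = N" by (auto simp: xs_def)
    have \<omega>1: "\<omega> \<in> E1" and \<omega>s: "\<And>s. s \<in> S \<Longrightarrow> \<omega> \<in> Es s" using \<omega> by (auto simp: E_def bad_def)
    have inS: "s' \<in> S" if "poly_list I' L" "set (map fst L) \<subseteq> space D" "returns alg I' L s"
      "extends_to ext I' (space D) L s s'" for L s s'
      using that unfolding S_def potential_strategies_def by blast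
    from spec[unfolded solver_spec_def, folded xs_def] show ?thesis
    proof (elim disjE conjE bexE exE)
      assume res: "res = INFEASIBLE" and no: "\<forall>c\<in>set (candidates xs).
          (1 - \<alpha> / 16) * real (length xs) \<le> real (length c) \<longrightarrow>
          \<not> feasible I' (measure_pmf (pmf_of_list (uniform_list c))) (set c)"
      have "\<not> feasible I D (space D)"
      proof
        assume "feasible I D (space D)"
        from cheap[OF this] \<omega>1 obtain s G where s: "is_strategy I D (space D) s"
          "\<And>A. A \<in> space D \<Longrightarrow> maxdist I s A \<le> 1"
          and G: "G \<subseteq> {..<N}" "N - \<alpha> * N / 16 \<le> card G" "(\<Sum>i\<in>G. cost I s (\<omega> i)) \<le> b * card G"
          by blast
        have finG: "finite G" using G(1) finite_subset by blast
        have "\<alpha> * N \<le> N" using \<alpha> by (simp add: mult_left_le_one_le)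
        then have "0 < real (card G)" using G(2) N0 by linarith
        then have "G \<noteq> {}" by auto
        \<comment> \<open>Distinctness of the samples is known only on the events
          \<open>Es s\<close>, so some member of \<open>S\<close> has to be found. An index of cost
          at most the average gives a feasible instance with one scenario; \<open>alg\<close> must
          return a strategy for it, and the extension of this strategy lies in
          \<open>S\<close>.\<close>
        have "\<exists>i\<in>G. cost I s (\<omega> i) \<le> b"
        proof (rule ccontr)
          assume "\<not> (\<exists>i\<in>G. cost I s (\<omega> i) \<le> b)"
          then have "(\<Sum>i\<in>G. b) < (\<Sum>i\<in>G. cost I s (\<omega> i))"
            using finG \<open>G \<noteq> {}\<close> by (intro sum_strict_mono) auto
          with G(3) show False by (simp add: mult.commute)
        qed
        then obtain i where i: "i \<in> G" "cost I s (\<omega> i) \<le> b" by blast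
        let ?L = "uniform_list [\<omega> i]"
        have "feasible I' (measure_pmf (pmf_of_list ?L)) (set [\<omega> i])"
          unfolding I'_def by (rule feasible_uniform_list[OF bb s]) (use i sp in auto)
        moreover have L: "poly_list I' ?L" "set (map fst ?L) \<subseteq> space D"
          using poly_list_uniform_list[of "[\<omega> i]" I'] sp[of i] facts(3) by (auto simp: I'_def)
        ultimately obtain s1 where s1: "returns alg I' ?L s1"
          using approximation_algorithm_run[OF alg I' L(1)] by (auto split: if_splits)
        have "space D \<subseteq> scenarios I'" using facts(3) by (simp add: I'_def)
        then obtain s' where "extends_to ext I' (space D) ?L s1 s'"
          using efficiently_generalizable_extends[OF gen I' _ L s1] by blast
        then have s': "s' \<in> S" using inS L s1 by blast
        have inj: "inj_on \<omega> G" using inj[OF s' \<omega>s[OF s']] G(1) by (rule inj_on_subset)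
        obtain c where c: "c \<in> set (candidates xs)" "set c = \<omega> ` G"
          using candidates_complete[of "\<omega> ` G" xs] G(1) xs by blast
        have dc: "distinct c" using candidates_sound[OF c(1)] by simp
        have lc: "length c = card G" using distinct_card[OF dc] c(2) card_image[OF inj] by simp
        have "(1 - \<alpha> / 16) * real (length xs) \<le> real (length c)"
          using G(2) xs lc by (simp add: algebra_simps)
        moreover have "feasible I' (measure_pmf (pmf_of_list (uniform_list c))) (set c)"
          unfolding I'_def
        proof (rule feasible_uniform_list[OF bb s])
          show "c \<noteq> []" using lc \<open>0 < real (card G)\<close> by auto
          show "(\<Sum>A\<in>set c. cost I s A) \<le> b * real (length c)"
            using G(3) by (simp add: c(2) lc sum.reindex[OF inj])
        qed (use dc c(2) sp in auto)
        ultimately show False using no c(1) by blast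
      qed
      with res show ?thesis by blast
    next
      fix c s s'
      assume c: "c \<in> set (candidates xs)" "(1 - \<alpha> / 16) * real (length xs) \<le> real (length c)"
        and s: "fst s \<in> allowed I'" "returns alg I' (uniform_list c) s"
          "within_budget I' (measure_pmf (pmf_of_list (uniform_list c))) s"
        and s': "extends_to ext I' (space D) (uniform_list c) s s'"
          "\<forall>A\<in>space D. maxdist I' s' A \<le> ereal \<eta>" "\<forall>A\<in>set c. snd s' A = snd s A"
        and res: "res = VPair (enc_subset (facilities I') (fst s))
          (VPair (VPair (enc_poly I' (uniform_list c)) (enc_strategy I' (uniform_list c) s))
            (VNum (threshold (\<alpha> / 4 * real (length xs)) (rev (map (stage2_cost s') xs)))))"
      have dc: "distinct c" "set c \<subseteq> \<omega> ` {..<N}" using candidates_sound[OF c(1)] xs by auto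
      have cl: "N - \<alpha> * N / 16 \<le> length c" using c(2) xs by (simp add: algebra_simps)
      moreover have \<alpha>N: "\<alpha> * N \<le> N" using \<alpha> by (simp add: mult_left_le_one_le)
      ultimately have "0 < real (length c)" using N0 by linarith
      then have "c \<noteq> []" by auto
      have "poly_list I' (uniform_list c)" "set (map fst (uniform_list c)) \<subseteq> space D"
        using poly_list_uniform_list[OF \<open>c \<noteq> []\<close> dc(1), of I'] dc(2) sp facts(3)
        by (auto simp: I'_def)
      then have s'S: "s' \<in> S" using inS s(2) s'(1) by blast
      note inj = inj[OF s'S \<omega>s[OF s'S]]
      \<comment> \<open>Since the samples are distinct, \<open>G\<close> indexes the candidate
        bijectively, and the average over the candidate becomes a sum over sample indices.\<close>
      define G where "G = {i \<in> {..<N}. \<omega> i \<in> set c}"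
      have G: "G \<subseteq> {..<N}" "\<omega> ` G = set c" using dc(2) by (auto simp: G_def)
      have injG: "inj_on \<omega> G" using inj G(1) by (rule inj_on_subset)
      have cG: "card G = length c" using card_image[OF injG] G(2) distinct_card[OF dc(1)] by simp
      have "(\<Sum>i\<in>G. cost I s' (\<omega> i)) = (\<Sum>A\<in>set c. cost I s' A)"
        by (simp add: G(2)[symmetric] sum.reindex[OF injG])
      \<comment> \<open>The extension agrees with the returned strategy on stage I and on the listed
        scenarios, so the budget bound of \<open>alg\<close> carries over.\<close>
      also have "\<dots> = (\<Sum>A\<in>set c. cost I s A)"
        using s'(1,3) by (intro sum.cong) (auto simp: cost_def stage1_cost_def stage2_cost_def extends_to_def)
      also have "\<dots> \<le> b * card G"
        using s(3) within_budget_uniform_list[OF \<open>c \<noteq> []\<close> dc(1)] by (simp add: I'_def cG)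
      finally have Gcost: "(\<Sum>i\<in>G. cost I s' (\<omega> i)) \<le> b * card G" .
      \<comment> \<open>The reversal by the threshold computation undoes that of the sampler, so
        \<open>ys\<close> is in the order of the draws.\<close>
      define ys where "ys = map (\<lambda>i. stage2_cost s' (\<omega> i)) [0..<N]"
      have ys: "rev (map (stage2_cost s') xs) = ys" by (simp add: ys_def xs_def rev_map comp_def)
      define T where "T = threshold (\<alpha> / 4 * real (length xs)) ys"
      have "0 \<le> stage2_cost s' (\<omega> i)" for i
        using s'(1) sp by (intro stage2_cost_nonneg[OF bb]) (auto simp: extends_to_def I'_def)
      then have "\<alpha> / 4 * real (length xs) \<le> count_ge T ys"
        unfolding T_def using \<alpha>N xs(2) by (intro threshold_count_ge) (auto simp: ys_def)
      moreover have "real (length (filter (\<lambda>y. T < y) ys)) < \<alpha> / 4 * real (length xs)"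
        unfolding T_def by (rule threshold_count_greater) (use \<alpha> N0 xs(2) in simp)
      ultimately have "\<alpha> * N / 4 \<le> card {i \<in> {..<N}. T \<le> stage2_cost s' (\<omega> i)}"
        "card {i \<in> {..<N}. T < stage2_cost s' (\<omega> i)} < \<alpha> * N / 4"
        unfolding ys_def count_ge_def length_filter_upt xs(2) by simp_all
      from good[OF s'S \<omega>s[OF s'S] G(1) _ Gcost this] cl cG
      have T: "measure D {A \<in> space D. T < stage2_cost s' A} \<le> \<alpha>"
        "stage1_cost I s' + (\<integral>A. (if T < stage2_cost s' A then 0 else stage2_cost s' A) \<partial>D)
           \<le> (1 + \<epsilon>) * budget I"
        by auto
      have "b \<in> {budget I..(1 + \<epsilon>) * budget I}"
        using \<epsilon> facts(6) by (auto simp: b_def algebra_simps)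
      then have "snd s' \<in> measurable D (count_space UNIV)"
        using cc s'S unfolding continuous_costs_def S_def I'_def by blast
      from truncated_strategy[OF bb dec ext s'(1)[unfolded I'_def] _ this _ T, where \<eta> = \<eta>]
      show ?thesis
        using s(1) s'(2) res unfolding ys T_def[symmetric] I'_def by auto
    qed
  qed
  with E show ?thesis unfolding I'_def b_def by blast
qed

theorem theorem1:
  shows "\<exists>K>0. \<forall>P alg ext \<eta> \<psi>.
    approximation_algorithm P alg \<eta> \<longrightarrow> efficiently_generalizable P alg ext \<eta> \<psi> \<longrightarrow>
    (\<forall>\<gamma>\<in>{0<..<1}. \<forall>\<epsilon>\<in>{0<..<1}. \<forall>\<alpha>\<in>{0<..<1}.
      \<exists>bb dec. sample_free dec \<and>
        (\<forall>I D. bb_instance P I D \<longrightarrow> continuous_costs alg ext \<epsilon> I D \<longrightarrow>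
          (let n = card (clients I); m = card (facilities I); q = \<psi> I (space D);
               inp = VPair (enc_inst I) (VNum (real q)) in
           \<exists>res.
             (\<forall>\<omega>\<in>space (samples D). \<exists>k t.
                exec (allowed_query I) (\<lambda>i. enc_scenario I (\<omega> i)) bb inp 0 (res \<omega>) k t \<and>
                real k \<le> K * sample_bound n m q \<gamma> \<epsilon> \<alpha>) \<and>
             (\<exists>E\<in>sets (samples D). measure (samples D) E \<ge> 1 - \<gamma> \<and>
               (\<forall>\<omega>\<in>E.
                 (\<exists>s. bb_outputs dec I D inp (res \<omega>) s \<and>
                    integrable D (stage2_cost s) \<and>
                    stage1_cost I s + (\<integral>A. stage2_cost s A \<partial>D) \<le> (1 + \<epsilon>) * budget I \<and>
                    measure D {A \<in> space D. \<forall>j\<in>fst A.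
                        dist_to I j (fst s \<union> snd s A) \<le> ereal (\<eta> * radius I j)} \<ge> 1 - \<alpha>) \<or>
                 (res \<omega> = INFEASIBLE \<and> \<not> feasible I D (space D)))))))"
\<comment> \<open>The constant of \<open>sample_count_le\<close>, independent of the problem, the
  algorithms and the parameters.\<close>
proof (rule exI[of _ 4000], intro conjI allI impI ballI)
  fix P alg ext \<eta> \<psi> and \<gamma> \<epsilon> \<alpha> :: real
  assume alg: "approximation_algorithm P alg \<eta>" and gen: "efficiently_generalizable P alg ext \<eta> \<psi>"
    and "\<gamma> \<in> {0<..<1}" "\<epsilon> \<in> {0<..<1}" "\<alpha> \<in> {0<..<1}"
  then have \<gamma>: "0 < \<gamma>" "\<gamma> < 1" and \<epsilon>: "0 < \<epsilon>" "\<epsilon> < 1" and \<alpha>: "0 < \<alpha>" "\<alpha> < 1" by auto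
  \<comment> \<open>Each further sample divides the failure probability of every single event by
    \<beta>; 512 is the denominator common to all tail bounds above.\<close>
  define \<beta> where "\<beta> = exp (\<epsilon> * \<alpha> / 512)"
  have \<beta>: "1 < \<beta>" using \<epsilon> \<alpha> by (simp add: \<beta>_def)
  obtain smp where smp: "\<And>Q \<omega> v q N. (\<forall>n<N. \<gamma> / 3 * \<beta> ^ n < q + 1) \<Longrightarrow> q + 1 \<le> \<gamma> / 3 * \<beta> ^ N \<Longrightarrow>
     (\<exists>t. exec Q \<omega> smp (VPair v (VNum q)) 0
        (VPair (VPair v (VNum q)) (vlist (map \<omega> (rev [0..<N])))) N t)"
    using sampler_exists[of "\<gamma> / 3" \<beta>] by blast
  have "0 \<le> 1 + \<epsilon> / 2" "0 < 1 - \<alpha> / 16" using \<epsilon> \<alpha> by auto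
  from bb_solver_exists[OF alg gen this, of "\<alpha> / 4"]
  obtain p where p: "\<And>I \<Omega> xs qv. valid_inst P I \<Longrightarrow> \<Omega> \<subseteq> scenarios I \<Longrightarrow> set xs \<subseteq> \<Omega> \<Longrightarrow> xs \<noteq> [] \<Longrightarrow>
    (\<exists>res. runs (allowed_query I) p (VPair (VPair (enc_inst I) qv) (vlist (map (enc_scenario I) xs))) res \<and>
      solver_spec alg ext \<eta> (I\<lparr>budget := (1 + \<epsilon> / 2) * budget I\<rparr>) \<Omega> (1 - \<alpha> / 16) (\<alpha> / 4) xs res)"
    by blast
  have "sample_free ext" using gen by (simp add: efficiently_generalizable_def)
  from decoder_exists[OF this] obtain dec where sf: "sample_free dec"
    and dec: "\<And>Q v F L s T a c e. runs Q ext (VPair L (VPair s (VPair a c))) e \<Longrightarrow>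
      runs Q dec (VPair v (VPair (VPair F (VPair (VPair L s) T)) (VPair a c)))
        (if vless T (vdot e c) = VNum 1 then vzero e else e)"
    by blast
  show "\<exists>bb dec. sample_free dec \<and>
        (\<forall>I D. bb_instance P I D \<longrightarrow> continuous_costs alg ext \<epsilon> I D \<longrightarrow>
          (let n = card (clients I); m = card (facilities I); q = \<psi> I (space D);
               inp = VPair (enc_inst I) (VNum (real q)) in
           \<exists>res.
             (\<forall>\<omega>\<in>space (samples D). \<exists>k t.
                exec (allowed_query I) (\<lambda>i. enc_scenario I (\<omega> i)) bb inp 0 (res \<omega>) k t \<and>
                real k \<le> 4000 * sample_bound n m q \<gamma> \<epsilon> \<alpha>) \<and>
             (\<exists>E\<in>sets (samples D). measure (samples D) E \<ge> 1 - \<gamma> \<and>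
               (\<forall>\<omega>\<in>E.
                 (\<exists>s. bb_outputs dec I D inp (res \<omega>) s \<and>
                    integrable D (stage2_cost s) \<and>
                    stage1_cost I s + (\<integral>A. stage2_cost s A \<partial>D) \<le> (1 + \<epsilon>) * budget I \<and>
                    measure D {A \<in> space D. \<forall>j\<in>fst A.
                        dist_to I j (fst s \<union> snd s A) \<le> ereal (\<eta> * radius I j)} \<ge> 1 - \<alpha>) \<or>
                 (res \<omega> = INFEASIBLE \<and> \<not> feasible I D (space D))))))"
  \<comment> \<open>Both programs are fixed before the instance: \<gamma>, \<epsilon> and \<alpha>
    enter as literals, and the bound on the number of strategies is read from the input.\<close>
  proof (rule exI[of _ "Then smp p"], rule exI[of _ dec], intro conjI sf allI impI, unfold Let_def)
    fix I D assume bb: "bb_instance P I D" and cc: "continuous_costs alg ext \<epsilon> I D"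
    note facts = bb_facts[OF bb]
    define q where "q = \<psi> I (space D)"
    define inp where "inp = VPair (enc_inst I) (VNum (real q))"
    \<comment> \<open>The least number of samples for which the union bound over at most q
      strategies and the feasible side stays within \<gamma>.\<close>
    define N where "N = (LEAST N. real q + 1 \<le> \<gamma> / 3 * \<beta> ^ N)"
    obtain N' where "3 * (real q + 1) / \<gamma> < \<beta> ^ N'" using real_arch_pow[OF \<beta>] by blast
    then have "real q + 1 \<le> \<gamma> / 3 * \<beta> ^ N'" using \<gamma> by (simp add: field_simps)
    then have qN: "real q + 1 \<le> \<gamma> / 3 * \<beta> ^ N" unfolding N_def by (rule LeastI)
    have less: "\<gamma> / 3 * \<beta> ^ n < real q + 1" if "n < N" for n
      using not_less_Least[of n "\<lambda>N. real q + 1 \<le> \<gamma> / 3 * \<beta> ^ N"] that by (simp add: N_def)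
    have N0: "0 < N" using qN \<gamma> by (cases N) auto
    have \<beta>N: "\<beta> ^ N = exp (\<epsilon> * \<alpha> * N / 512)"
      using exp_of_nat2_mult[of "\<epsilon> * \<alpha> / 512" N] by (simp add: \<beta>_def)
    have "3 * (real q + 1) \<le> \<gamma> * exp (\<epsilon> * \<alpha> * N / 512)" using qN by (simp add: \<beta>N)
    then have N2: "3 * (real q + 1) * exp (- (\<epsilon> * \<alpha> * N / 512)) \<le> \<gamma>"
      by (simp add: exp_minus field_simps)
    \<comment> \<open>Since exp 1 \<le> 3 and \<gamma> < 1, the stopping rule alone forces
      \<epsilon> * \<alpha> * N \<ge> 512, far more than the rounding of the discarded fraction
      requires.\<close>
    have "exp 1 \<le> 3 * (real q + 1)" using exp_le by (smt (verit) of_nat_0_le_iff)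
    also have "\<dots> \<le> \<gamma> * exp (\<epsilon> * \<alpha> * N / 512)" by fact
    also have "\<dots> \<le> exp (\<epsilon> * \<alpha> * N / 512)" using \<gamma> by simp
    finally have "512 \<le> \<epsilon> * (\<alpha> * N)" by simp
    also have "\<dots> \<le> \<alpha> * N" using \<epsilon> \<alpha> by (simp add: mult_left_le_one_le)
    finally have N32: "32 \<le> \<alpha> * N" by simp
    have nm: "1 \<le> card (clients I)" "1 \<le> card (facilities I)"
      using facts by (auto simp: valid_inst_def Suc_le_eq card_gt_0_iff)
    \<comment> \<open>By minimality the stopping rule fails at N - 1, which is the premise of
      \<open>sample_count_le\<close>.\<close>
    have count: "real N \<le> 4000 * sample_bound (card (clients I)) (card (facilities I)) q \<gamma> \<epsilon> \<alpha>"
      using sample_count_le[OF \<gamma> \<epsilon> \<alpha> nm, of "N - 1" q] less[of "N - 1"] N0 by (simp add: \<beta>_def)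
    have "\<exists>res. (\<exists>t. exec (allowed_query I) (\<lambda>i. enc_scenario I (\<omega> i)) (Then smp p) inp 0 res N t) \<and>
        solver_spec alg ext \<eta> (I\<lparr>budget := (1 + \<epsilon> / 2) * budget I\<rparr>) (space D) (1 - \<alpha> / 16) (\<alpha> / 4)
          (map \<omega> (rev [0..<N])) res" if \<omega>: "\<omega> \<in> space (samples D)" for \<omega>
    proof -
      obtain t where t: "exec (allowed_query I) (\<lambda>i. enc_scenario I (\<omega> i)) smp inp 0
          (VPair inp (vlist (map (\<lambda>i. enc_scenario I (\<omega> i)) (rev [0..<N])))) N t"
        using smp[of N "real q"] less qN unfolding inp_def by blast
      have "set (map \<omega> (rev [0..<N])) \<subseteq> space D" "map \<omega> (rev [0..<N]) \<noteq> []"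
        using \<omega> N0 by (auto simp: samples_def space_PiM)
      from p[OF facts(1,3) this, of "VNum (real q)"] obtain res where
        res: "runs (allowed_query I) p (VPair inp (vlist (map (enc_scenario I) (map \<omega> (rev [0..<N]))))) res"
        and spec: "solver_spec alg ext \<eta> (I\<lparr>budget := (1 + \<epsilon> / 2) * budget I\<rparr>) (space D)
          (1 - \<alpha> / 16) (\<alpha> / 4) (map \<omega> (rev [0..<N])) res"
        unfolding inp_def by blast
      obtain t' where "exec (allowed_query I) (\<lambda>i. enc_scenario I (\<omega> i)) p
          (VPair inp (vlist (map (\<lambda>i. enc_scenario I (\<omega> i)) (rev [0..<N])))) N res N t'"
        using res unfolding runs_def by (auto simp: comp_def)
      with spec show ?thesis using exec_Then[OF t] by blast
    qed
    \<comment> \<open>\<open>res\<close> is chosen pointwise from the executions; only the event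
      \<open>E\<close> has to be measurable.\<close>
    from bchoice[OF ballI[OF this]] obtain res where res_all: "\<forall>\<omega>\<in>space (samples D).
        (\<exists>t. exec (allowed_query I) (\<lambda>i. enc_scenario I (\<omega> i)) (Then smp p) inp 0 (res \<omega>) N t) \<and>
        solver_spec alg ext \<eta> (I\<lparr>budget := (1 + \<epsilon> / 2) * budget I\<rparr>) (space D) (1 - \<alpha> / 16) (\<alpha> / 4)
          (map \<omega> (rev [0..<N])) (res \<omega>)" ..
    note res = bspec[OF res_all, THEN conjunct1] and spec = bspec[OF res_all, THEN conjunct2]
    from good_event[OF alg gen bb cc \<epsilon> \<alpha> N32 N2[unfolded q_def] dec, of inp]
    obtain E where E: "E \<in> sets (samples D)" "1 - \<gamma> \<le> measure (samples D) E"
      and good: "\<And>\<omega> res. \<omega> \<in> E \<Longrightarrow> solver_spec alg ext \<eta> (I\<lparr>budget := (1 + \<epsilon> / 2) * budget I\<rparr>) (space D)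
        (1 - \<alpha> / 16) (\<alpha> / 4) (map \<omega> (rev [0..<N])) res \<Longrightarrow>
      (\<exists>s. bb_outputs dec I D inp res s \<and> integrable D (stage2_cost s) \<and>
         stage1_cost I s + (\<integral>A. stage2_cost s A \<partial>D) \<le> (1 + \<epsilon>) * budget I \<and>
         measure D {A \<in> space D. \<forall>j\<in>fst A.
             dist_to I j (fst s \<union> snd s A) \<le> ereal (\<eta> * radius I j)} \<ge> 1 - \<alpha>) \<or>
      (res = INFEASIBLE \<and> \<not> feasible I D (space D))"
      by blast
    note E_space = subsetD[OF sets.sets_into_space[OF E(1)]]
    show "\<exists>res. (\<forall>\<omega>\<in>space (samples D). \<exists>k t.
                exec (allowed_query I) (\<lambda>i. enc_scenario I (\<omega> i)) (Then smp p)
                  (VPair (enc_inst I) (VNum (real (\<psi> I (space D))))) 0 (res \<omega>) k t \<and>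
                real k \<le> 4000 * sample_bound (card (clients I)) (card (facilities I)) (\<psi> I (space D)) \<gamma> \<epsilon> \<alpha>) \<and>
             (\<exists>E\<in>sets (samples D). measure (samples D) E \<ge> 1 - \<gamma> \<and>
               (\<forall>\<omega>\<in>E.
                 (\<exists>s. bb_outputs dec I D (VPair (enc_inst I) (VNum (real (\<psi> I (space D))))) (res \<omega>) s \<and>
                    integrable D (stage2_cost s) \<and>
                    stage1_cost I s + (\<integral>A. stage2_cost s A \<partial>D) \<le> (1 + \<epsilon>) * budget I \<and>
                    measure D {A \<in> space D. \<forall>j\<in>fst A.
                        dist_to I j (fst s \<union> snd s A) \<le> ereal (\<eta> * radius I j)} \<ge> 1 - \<alpha>) \<or>
                 (res \<omega> = INFEASIBLE \<and> \<not> feasible I D (space D))))"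
      unfolding q_def[symmetric] inp_def[symmetric]
    proof (intro exI[of _ res] conjI ballI bexI[of _ E])
      fix \<omega> assume "\<omega> \<in> space (samples D)"
      then show "\<exists>k t. exec (allowed_query I) (\<lambda>i. enc_scenario I (\<omega> i)) (Then smp p) inp 0 (res \<omega>) k t \<and>
          real k \<le> 4000 * sample_bound (card (clients I)) (card (facilities I)) q \<gamma> \<epsilon> \<alpha>"
        using res count by blast
    next
      fix \<omega> assume \<omega>: "\<omega> \<in> E"
      show "(\<exists>s. bb_outputs dec I D inp (res \<omega>) s \<and> integrable D (stage2_cost s) \<and>
           stage1_cost I s + (\<integral>A. stage2_cost s A \<partial>D) \<le> (1 + \<epsilon>) * budget I \<and>
           measure D {A \<in> space D. \<forall>j\<in>fst A.
             dist_to I j (fst s \<union> snd s A) \<le> ereal (\<eta> * radius I j)} \<ge> 1 - \<alpha>) \<or>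
         (res \<omega> = INFEASIBLE \<and> \<not> feasible I D (space D))"
        by (rule good[OF \<omega> spec[OF E_space[OF \<omega>]]])
    next
      show "1 - \<gamma> \<le> measure (samples D) E" by (rule E(2))
      show "E \<in> sets (samples D)" by (rule E(1))
    qed
  qed
qed simp

end
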